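(* Let $n\ge 4$, let $W$ be the Coxeter group of type $D_n$, let $w\in W$ be a quasi-Coxeter element, and let $\Delta=\Delta_{m,n}$ ($1\le m\le\lfloor n/2\rfloor$) be its associated Carter diagram. Then the interval group $G([1,w])$ admits a presentation over generators $x_1,\dots,x_n$ corresponding to the vertices of $\Delta$, with relations those described by $\Delta$ (that is, $x_ax_bx_a=x_bx_ax_b$ if the vertices $a,b$ are joined by an edge and $x_ax_b=x_bx_a$ if not) together with, when $\Delta$ contains a $4$-cycle (i.e. when $m\ge 2$), the twisted cycle commutator relator associated with the $4$-cycle $(x_1,x_m,x_{m+1},x_{m+2})$ of $\Delta$. That is, for $m\ge 2$, $$G([1,w])\;\cong\; A(\Delta)\big/\big\langle\big\langle\,[\,x_1,\;x_m^{-1}x_{m+1}x_{m+2}x_{m+1}^{-1}x_m\,]\,\big\rangle\big\rangle ,$$ and for $m=1$ (i.e. $w$ a Coxeter element) $G([1,w])\cong A(\Delta_{1,n})$, the Artin group of type $D_n$.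
   Context: Type $D_n$: $W$ is the group of $n\times n$ monomial matrices whose nonzero entries are $\pm1$ with product $1$. A marked cycle $(x_1,\dots,x_k)$, each $x_a$ being $p_a$ or $\overline{p_a}$ with $p_1,\dots,p_k\in\{1,\dots,n\}$ distinct, means that row $p_a$ has its nonzero entry in column $p_{a+1}$ (indices mod $k$), equal to $-1$ if $x_a$ is overlined and to $1$ otherwise; elements of $W$ are written as products of disjoint marked cycles, unmarked $1$-cycles being omitted. The set $T$ of reflections of $W$ is $\{(i,j),(\overline i,\overline j): 1\le i<j\le n\}$. Reflection length: $\ell_T(v)$ is the least $k$ such that $v$ is a product of $k$ elements of $T$; an expression $v=t_1\cdots t_k$ with $t_i\in T$, $k=\ell_T(v)$ is a reduced decomposition. Absolute order: $v\preceq w$ iff $\ell_T(w)=\ell_T(v)+\ell_T(v^{-1}w)$; $[1,w]=\{v\in W: v\preceq w\}$. Quasi-Coxeter element: an element $w\in W$ having a reduced decomposition $w=t_1\cdots t_n$ (with $n$ the rank) such that $\langle t_1,\dots,t_n\rangle=W$. A Coxeter element is a conjugate of a product, in some order, of the simple reflections of $W$. Interval group: $G([1,w])$ is the group with generating set $\{\boldsymbol{v}: v\in[1,w]\}$ in bijection with $[1,w]$ and relations $\boldsymbol{u}\,\boldsymbol{v}=\boldsymbol{r}$ whenever $u,v,r\in[1,w]$, $uv=r$ and $\ell_T(r)=\ell_T(u)+\ell_T(v)$. Associated Carter diagram: every quasi-Coxeter element of $W$ is conjugate in $W$ to $w_m=(m,m-1,\dots,2,\overline1)(n,n-1,\dots,m+2,\overline{m+1})$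 for exactly one $m$ with $1\le m\le\lfloor n/2\rfloor$ (a known result of Carter); the associated Carter diagram is then the graph $\Delta_{m,n}$ with vertices $1,\dots,n$ and the following edges. For $m\ge2$: $\{k,k+1\}$ for $2\le k\le n-1$, together with $\{1,m\}$ and $\{1,m+2\}$ (so the vertices $1,m,m+1,m+2$ form the unique cycle, a $4$-cycle). For $m=1$: $\{k,k+1\}$ for $2\le k\le n-1$, together with $\{1,3\}$ (the Coxeter diagram of type $D_n$). $A(\Delta)$ is the group with generators $x_a$ indexed by the vertices of $\Delta$ and only the relations $x_ax_bx_a=x_bx_ax_b$ (for edges $\{a,b\}$) and $x_ax_b=x_bx_a$ (for non-edges). $\langle\langle\cdot\rangle\rangle$ denotes normal closure and $[x,y]$ the commutator. *)

theory Defs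
  imports
    "HOL-Algebra.Coset"
    "HOL-Algebra.Generated_Groups"
    "Jordan_Normal_Form.Matrix"
begin

section \<open>Groups given by generators and relations\<close>

text \<open>A letter \<open>(x, True)\<close> stands for the generator \<open>x\<close>, and \<open>(x, False)\<close> for its formal inverse.
  A relation \<open>u = v\<close> is a pair \<open>(u, v)\<close> of words.\<close>

type_synonym 'a word = "('a \<times> bool) list"

definition words :: "'a set \<Rightarrow> 'a word set" where
  "words X = {u. fst ` set u \<subseteq> X}"

inductive pres_eq :: "'a set \<Rightarrow> ('a word \<times> 'a word) set \<Rightarrow> 'a word \<Rightarrow> 'a word \<Rightarrow> bool"
  for X R where
  refl: "u \<in> words X \<Longrightarrow> pres_eq X R u u"
| sym: "pres_eq X R u v \<Longrightarrow> pres_eq X R v u"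
| trans: "pres_eq X R u v \<Longrightarrow> pres_eq X R v z \<Longrightarrow> pres_eq X R u z"
| append: "pres_eq X R u u' \<Longrightarrow> pres_eq X R v v' \<Longrightarrow> pres_eq X R (u @ v) (u' @ v')"
| cancel: "x \<in> X \<Longrightarrow> pres_eq X R [(x, b), (x, \<not> b)] []"
| rel: "(u, v) \<in> R \<Longrightarrow> u \<in> words X \<Longrightarrow> v \<in> words X \<Longrightarrow> pres_eq X R u v"

definition pres_class :: "'a set \<Rightarrow> ('a word \<times> 'a word) set \<Rightarrow> 'a word \<Rightarrow> 'a word set" where
  "pres_class X R u = {v. pres_eq X R u v}"

definition presented_group :: "'a set \<Rightarrow> ('a word \<times> 'a word) set \<Rightarrow> 'a word set monoid" where
  "presented_group X R =
    \<lparr>carrier = pres_class X R ` words X,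
     monoid.mult = (\<lambda>A B. \<Union>u\<in>A. \<Union>v\<in>B. pres_class X R (u @ v)),
     one = pres_class X R []\<rparr>"

lemma pres_eq_words: "pres_eq X R u v \<Longrightarrow> u \<in> words X \<and> v \<in> words X"
  by (induction rule: pres_eq.induct) (auto simp: words_def)

lemma pres_class_eq_iff:
  assumes "u \<in> words X"
  shows "pres_class X R u = pres_class X R v \<longleftrightarrow> pres_eq X R u v"
proof
  assume "pres_class X R u = pres_class X R v"
  moreover have "u \<in> pres_class X R u"
    using assms by (simp add: pres_class_def pres_eq.refl)
  ultimately show "pres_eq X R u v"
    by (auto simp: pres_class_def intro: pres_eq.sym)
next
  assume uv: "pres_eq X R u v"
  show "pres_class X R u = pres_class X R v"
    unfolding pres_class_def
    using pres_eq.trans[OF uv] pres_eq.trans[OF pres_eq.sym[OF uv]] by blast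
qed

lemma presented_group_mult:
  assumes "u \<in> words X" "v \<in> words X"
  shows "pres_class X R u \<otimes>\<^bsub>presented_group X R\<^esub> pres_class X R v = pres_class X R (u @ v)"
proof -
  have "pres_class X R (u' @ v') = pres_class X R (u @ v)"
    if "u' \<in> pres_class X R u" "v' \<in> pres_class X R v" for u' v'
  proof -
    have "pres_eq X R (u @ v) (u' @ v')"
      using that by (intro pres_eq.append) (auto simp: pres_class_def)
    then show ?thesis
      using assms pres_class_eq_iff[of "u @ v" X R "u' @ v'"] pres_eq_words[of X R "u @ v"] by simp
  qed
  moreover have "u \<in> pres_class X R u" "v \<in> pres_class X R v"
    using assms by (simp_all add: pres_class_def pres_eq.refl)
  ultimately have "(\<Union>u'\<in>pres_class X R u. \<Union>v'\<in>pres_class X R v. pres_class X R (u' @ v'))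
      = pres_class X R (u @ v)"
    by blast
  then show ?thesis
    by (simp add: presented_group_def)
qed

lemma word_inverse:
  assumes "u \<in> words X"
  shows "\<exists>v\<in>words X. pres_eq X R (v @ u) []"
  using assms
proof (induction u)
  case Nil
  then show ?case by (intro bexI[of _ "[]"]) (auto simp: words_def intro: pres_eq.refl)
next
  case (Cons a u)
  obtain x b where a: "a = (x, b)" by (cases a)
  have x: "x \<in> X" and u: "u \<in> words X"
    using Cons.prems by (auto simp: a words_def)
  then obtain v where v: "v \<in> words X" "pres_eq X R (v @ u) []"
    using Cons.IH by blast
  have "pres_eq X R (v @ ([(x, \<not> b), (x, b)] @ u)) (v @ ([] @ u))"
    using pres_eq.append[OF pres_eq.refl[OF v(1)]
        pres_eq.append[OF pres_eq.cancel[OF x, of R "\<not> b"] pres_eq.refl[OF u]]] by simp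
  then have "pres_eq X R ((v @ [(x, \<not> b)]) @ a # u) []"
    using pres_eq.trans[OF _ v(2)] by (simp add: a)
  moreover have "v @ [(x, \<not> b)] \<in> words X"
    using v(1) x by (auto simp: words_def)
  ultimately show ?case by blast
qed

lemma group_presented_group: "group (presented_group X R)"
proof (rule groupI)
  let ?G = "presented_group X R"
  have carr: "carrier ?G = pres_class X R ` words X" and one: "\<one>\<^bsub>?G\<^esub> = pres_class X R []"
    by (simp_all add: presented_group_def)
  have app: "u @ v \<in> words X" if "u \<in> words X" "v \<in> words X" for u v :: "'a word"
    using that by (auto simp: words_def)
  have nil: "[] \<in> words X"
    by (simp add: words_def)
  show "x \<otimes>\<^bsub>?G\<^esub> y \<in> carrier ?G" if "x \<in> carrier ?G" "y \<in> carrier ?G" for x y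
    using that by (auto simp: carr presented_group_mult app)
  show "\<one>\<^bsub>?G\<^esub> \<in> carrier ?G"
    using nil by (simp add: carr one)
  show "x \<otimes>\<^bsub>?G\<^esub> y \<otimes>\<^bsub>?G\<^esub> z = x \<otimes>\<^bsub>?G\<^esub> (y \<otimes>\<^bsub>?G\<^esub> z)"
    if "x \<in> carrier ?G" "y \<in> carrier ?G" "z \<in> carrier ?G" for x y z
    using that by (auto simp: carr presented_group_mult app)
  show "\<one>\<^bsub>?G\<^esub> \<otimes>\<^bsub>?G\<^esub> x = x" if "x \<in> carrier ?G" for x
    using that nil by (auto simp: carr one presented_group_mult)
  show "\<exists>y\<in>carrier ?G. y \<otimes>\<^bsub>?G\<^esub> x = \<one>\<^bsub>?G\<^esub>" if x: "x \<in> carrier ?G" for x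
  proof -
    obtain u where u: "u \<in> words X" "x = pres_class X R u"
      using x by (auto simp: carr)
    obtain v where v: "v \<in> words X" "pres_eq X R (v @ u) []"
      using word_inverse[OF u(1)] by blast
    then have "pres_class X R v \<otimes>\<^bsub>?G\<^esub> x = \<one>\<^bsub>?G\<^esub>"
      using u by (simp add: one presented_group_mult pres_class_eq_iff app)
    then show ?thesis
      using v(1) by (auto simp: carr)
  qed
qed

definition normal_closure :: "('a, 'b) monoid_scheme \<Rightarrow> 'a set \<Rightarrow> 'a set" where
  "normal_closure G S = \<Inter> {N. N \<lhd> G \<and> S \<subseteq> N}"

definition commutator :: "('a, 'b) monoid_scheme \<Rightarrow> 'a \<Rightarrow> 'a \<Rightarrow> 'a" where
  "commutator G x y = x \<otimes>\<^bsub>G\<^esub> y \<otimes>\<^bsub>G\<^esub> inv\<^bsub>G\<^esub> x \<otimes>\<^bsub>G\<^esub> inv\<^bsub>G\<^esub> y"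


section \<open>Reflection length, absolute order and interval groups\<close>

definition list_prod :: "('a, 'b) monoid_scheme \<Rightarrow> 'a list \<Rightarrow> 'a" where
  "list_prod G ts = foldr (\<lambda>x y. x \<otimes>\<^bsub>G\<^esub> y) ts \<one>\<^bsub>G\<^esub>"

definition refl_length :: "('a, 'b) monoid_scheme \<Rightarrow> 'a set \<Rightarrow> 'a \<Rightarrow> nat" where
  "refl_length G T v = (LEAST k. \<exists>ts. length ts = k \<and> set ts \<subseteq> T \<and> v = list_prod G ts)"

definition reduced_decomposition ::
    "('a, 'b) monoid_scheme \<Rightarrow> 'a set \<Rightarrow> 'a \<Rightarrow> 'a list \<Rightarrow> bool" where
  "reduced_decomposition G T v ts \<longleftrightarrow>
     set ts \<subseteq> T \<and> v = list_prod G ts \<and> length ts = refl_length G T v"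

definition abs_le :: "('a, 'b) monoid_scheme \<Rightarrow> 'a set \<Rightarrow> 'a \<Rightarrow> 'a \<Rightarrow> bool" where
  "abs_le G T v w \<longleftrightarrow>
     refl_length G T w = refl_length G T v + refl_length G T (inv\<^bsub>G\<^esub> v \<otimes>\<^bsub>G\<^esub> w)"

definition abs_interval :: "('a, 'b) monoid_scheme \<Rightarrow> 'a set \<Rightarrow> 'a \<Rightarrow> 'a set" where
  "abs_interval G T w = {v \<in> carrier G. abs_le G T v w}"

definition quasi_Coxeter :: "('a, 'b) monoid_scheme \<Rightarrow> 'a set \<Rightarrow> nat \<Rightarrow> 'a \<Rightarrow> bool" where
  "quasi_Coxeter G T rank w \<longleftrightarrow> w \<in> carrier G \<and>
     (\<exists>ts. reduced_decomposition G T w ts \<and> length ts = rank \<and>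
           generate G (set ts) = carrier G)"

definition interval_group :: "('a, 'b) monoid_scheme \<Rightarrow> 'a set \<Rightarrow> 'a \<Rightarrow> 'a word set monoid" where
  "interval_group G T w =
     presented_group (abs_interval G T w)
       {([(u, True), (v, True)], [(r, True)]) | u v r.
          u \<in> abs_interval G T w \<and> v \<in> abs_interval G T w \<and> r \<in> abs_interval G T w \<and>
          u \<otimes>\<^bsub>G\<^esub> v = r \<and> refl_length G T r = refl_length G T u + refl_length G T v}"


section \<open>The Coxeter group of type \<open>D\<^sub>n\<close>\<close>

definition D_group :: "nat \<Rightarrow> int mat monoid" where
  "D_group n =
    \<lparr>carrier = {A \<in> carrier_mat n n.
       (\<forall>i<n. \<exists>!j. j < n \<and> A $$ (i, j) \<noteq> 0) \<and>
       (\<forall>j<n. \<exists>!i. i < n \<and> A $$ (i, j) \<noteq> 0) \<and>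
       (\<forall>i<n. \<forall>j<n. A $$ (i, j) \<noteq> 0 \<longrightarrow> A $$ (i, j) \<in> {1, -1}) \<and>
       (\<Prod>p \<in> {(i, j). i < n \<and> j < n \<and> A $$ (i, j) \<noteq> 0}. A $$ p) = 1},
     monoid.mult = (*),
     one = 1\<^sub>m n\<rparr>"

text \<open>A marked cycle is given by a list of nonzero integers, \<open>p\<close> encoding the unmarked number
  \<open>p\<close> and \<open>- p\<close> the overlined one. Matrix indices start at \<open>0\<close>, hence the shift by one. Rows
  that do not occur in the cycle are those of the identity matrix. A single marked
  cycle with an odd number of overlined entries is a monomial matrix outside the
  group of type \<open>D\<^sub>n\<close>.\<close>

definition marked_cycle :: "nat \<Rightarrow> int list \<Rightarrow> int mat" where
  "marked_cycle n xs = mat n n (\<lambda>(i, j).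
     if \<exists>a<length xs. \<bar>xs ! a\<bar> = int (i + 1)
     then (\<Sum>a | a < length xs \<and> \<bar>xs ! a\<bar> = int (i + 1) \<and>
               \<bar>xs ! ((a + 1) mod length xs)\<bar> = int (j + 1). sgn (xs ! a))
     else if i = j then 1 else 0)"

definition D_reflections :: "nat \<Rightarrow> int mat set" where
  "D_reflections n =
     {marked_cycle n [int i, int j] | i j. 1 \<le> i \<and> i < j \<and> j \<le> n} \<union>
     {marked_cycle n [- int i, - int j] | i j. 1 \<le> i \<and> i < j \<and> j \<le> n}"

text \<open>The element \<open>w\<^sub>m = (m, m-1, \<dots>, 2, \<open>overlined 1\<close>)(n, n-1, \<dots>, m+2, \<open>overlined m+1\<close>)\<close>.\<close>

definition carter_rep :: "nat \<Rightarrow> nat \<Rightarrow> int mat" where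
  "carter_rep m n =
     marked_cycle n (map int (rev [2..<m + 1]) @ [- 1]) *
     marked_cycle n (map int (rev [m + 2..<n + 1]) @ [- int (m + 1)])"

definition carter_edges :: "nat \<Rightarrow> nat \<Rightarrow> nat set set" where
  "carter_edges m n =
     {{k, k + 1} | k. 2 \<le> k \<and> k \<le> n - 1} \<union>
     (if m = 1 then {{1, 3}} else {{1, m}, {1, m + 2}})"

definition has_carter_diagram :: "nat \<Rightarrow> int mat \<Rightarrow> nat \<Rightarrow> bool" where
  "has_carter_diagram n w m \<longleftrightarrow> 1 \<le> m \<and> m \<le> n div 2 \<and>
     (\<exists>g\<in>carrier (D_group n).
        w = g \<otimes>\<^bsub>D_group n\<^esub> carter_rep m n \<otimes>\<^bsub>D_group n\<^esub> inv\<^bsub>D_group n\<^esub> g)"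


section \<open>Artin groups of graphs\<close>

definition artin_relations :: "'a set \<Rightarrow> 'a set set \<Rightarrow> ('a word \<times> 'a word) set" where
  "artin_relations V E =
     {([(a, True), (b, True), (a, True)], [(b, True), (a, True), (b, True)]) | a b.
        a \<in> V \<and> b \<in> V \<and> a \<noteq> b \<and> {a, b} \<in> E} \<union>
     {([(a, True), (b, True)], [(b, True), (a, True)]) | a b.
        a \<in> V \<and> b \<in> V \<and> a \<noteq> b \<and> {a, b} \<notin> E}"

definition artin_group :: "'a set \<Rightarrow> 'a set set \<Rightarrow> 'a word set monoid" where
  "artin_group V E = presented_group V (artin_relations V E)"

definition artin_gen :: "'a set \<Rightarrow> 'a set set \<Rightarrow> 'a \<Rightarrow> 'a word set" where
  "artin_gen V E a = pres_class V (artin_relations V E) [(a, True)]"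

definition twisted_cycle_commutator ::
    "'a set \<Rightarrow> 'a set set \<Rightarrow> 'a \<Rightarrow> 'a \<Rightarrow> 'a \<Rightarrow> 'a \<Rightarrow> 'a word set" where
  "twisted_cycle_commutator V E a b c d =
    (let A = artin_group V E; x = artin_gen V E in
       commutator A (x a)
         (inv\<^bsub>A\<^esub> x b \<otimes>\<^bsub>A\<^esub> x c \<otimes>\<^bsub>A\<^esub> x d \<otimes>\<^bsub>A\<^esub> inv\<^bsub>A\<^esub> x c \<otimes>\<^bsub>A\<^esub> x b))"

end

theory Submission
  imports Defs "HOL-Library.Sublist" "HOL-Library.Numeral_Type"
begin

text \<open>A reflection is a pair of letters, up to sign and order, and \<open>w\<close> acts on the letters by two negative
  cycles \<open>p i \<mapsto> p (i + 1)\<close> and \<open>q j \<mapsto> q (j + 1)\<close>. Every reduced factorization of \<open>w\<close> contains a reflection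
  \<open>(p i, q j)\<close> mixing the two cycles; moving it to the front leaves a factorization of a single cycle
  through \<open>n\<close> letters, a situation of type \<open>A\<close>. Therefore a map from the reflections to a group that
  satisfies the dual braid relations of type \<open>A\<close> on each of these sets of letters, and that treats
  \<open>(p i, q j)\<close> compatibly, extends to the interval group.

  Such a map is constructed with values in the presented group \<open>P\<close> (acting on itself by translations and
  extended by an automorphism \<open>\<sigma>\<close>). The automorphism exchanges \<open>x 1\<close> with \<open>x (m + 1)\<close>, conjugates \<open>x m\<close>
  by \<open>x 1 x (m + 1)\<close> and fixes the other generators; that it respects the relations is what the twisted
  cycle commutator guarantees. Together with \<open>\<sigma>\<close>, the two arms of the diagram yield commuting elements
  \<open>\<delta>\<close> and \<open>\<epsilon>\<close>, and \<open>(p i, q j)\<close> is sent to the conjugate of \<open>x (m + 1)\<close> by \<open>\<delta>\<^sup>i \<epsilon>\<^sup>j\<close>. The composite of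
  the surjection from \<open>P\<close> to the interval group with this map is the right regular representation of
  \<open>P\<close>, so the surjection is injective.\<close>

section \<open>Presented groups\<close>

text \<open>Signs force the automorphism. A negative cycle changes an odd number of signs, so
  neither cycle of \<open>w\<close> lies in the group of type D; only their product does. Let
  \<open>\<sigma>\<close> and \<open>\<tau>\<close> stand for the sign changes of the single letters
  \<open>p 0\<close> and \<open>q 0\<close>, and \<open>x 1\<close>, \<open>x (m + 1)\<close> for
  \<open>(p 0, - q 0)\<close> and \<open>(p 0, q 0)\<close>. The sign change of \<open>p 0\<close>
  exchanges these two, acts on the reflection \<open>(p 0, p 1)\<close> of vertex \<open>m\<close>
  (for \<open>m \<ge> 2\<close>) as their product does, and fixes the other generators: this is the
  automorphism. Both sign changes together make up that product, hence \<open>\<tau>\<close> is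
  chosen with \<open>\<sigma> + \<tau> = x 1 + x (m + 1)\<close>, and
  \<open>\<delta> + \<epsilon>\<close> stands for \<open>w\<close>. The obstacle is that removing
  \<open>(p i, q j)\<close> leaves a cycle whose letters and signs depend on \<open>i\<close> and
  \<open>j\<close>, so the relations of type A are needed on a whole family of lists. Conjugation by
  \<open>\<delta>\<close> and \<open>\<epsilon>\<close> carries one list to all others. The
  relations are therefore checked on a single list; what remains is periodicity, since each letter
  has infinitely many indices.\<close>

definition word_eval :: "('b, 'c) monoid_scheme \<Rightarrow> ('a \<Rightarrow> 'b) \<Rightarrow> 'a word \<Rightarrow> 'b" where
  "word_eval G f u = foldr (\<lambda>(x, b) y. (if b then f x else inv\<^bsub>G\<^esub> f x) \<otimes>\<^bsub>G\<^esub> y) u \<one>\<^bsub>G\<^esub>"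

lemma word_eval_Nil [simp]: "word_eval G f [] = \<one>\<^bsub>G\<^esub>"
  by (simp add: word_eval_def)

lemma word_eval_Cons [simp]:
  "word_eval G f ((x, b) # u) = (if b then f x else inv\<^bsub>G\<^esub> f x) \<otimes>\<^bsub>G\<^esub> word_eval G f u"
  by (simp add: word_eval_def)

lemma words_Nil [simp]: "[] \<in> words X"
  and words_Cons [simp]: "(x, b) # u \<in> words X \<longleftrightarrow> x \<in> X \<and> u \<in> words X"
  and words_append [simp]: "u @ v \<in> words X \<longleftrightarrow> u \<in> words X \<and> v \<in> words X"
  by (auto simp: words_def)

lemma presented_group_carrierE:
  assumes "x \<in> carrier (presented_group X R)"
  obtains u where "u \<in> words X" "x = pres_class X R u"
  using assms by (auto simp: presented_group_def)

context group
begin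

lemma word_eval_closed: "f \<in> X \<rightarrow> carrier G \<Longrightarrow> u \<in> words X \<Longrightarrow> word_eval G f u \<in> carrier G"
  by (induction u) (auto simp: Pi_iff)

lemma word_eval_append:
  "f \<in> X \<rightarrow> carrier G \<Longrightarrow> u \<in> words X \<Longrightarrow> v \<in> words X \<Longrightarrow>
    word_eval G f (u @ v) = word_eval G f u \<otimes> word_eval G f v"
proof (induction u)
  case (Cons a u)
  obtain x b where "a = (x, b)" by (cases a)
  with Cons show ?case
    using word_eval_closed[OF Cons.prems(1), of u] word_eval_closed[OF Cons.prems(1), of v]
    by (auto simp: Pi_iff m_assoc)
qed (simp add: word_eval_closed)

lemma pres_eq_word_eval:
  assumes "f \<in> X \<rightarrow> carrier G"
    and "\<And>u v. (u, v) \<in> R \<Longrightarrow> u \<in> words X \<Longrightarrow> v \<in> words X \<Longrightarrow> word_eval G f u = word_eval G f v"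
  shows "pres_eq X R u v \<Longrightarrow> word_eval G f u = word_eval G f v"
proof (induction rule: pres_eq.induct)
  case (append u u' v v')
  then show ?case
    using pres_eq_words[OF append(1)] pres_eq_words[OF append(2)]
    by (simp add: word_eval_append[OF assms(1)])
next
  case (cancel x b)
  then show ?case using assms(1) by (auto simp: Pi_iff)
qed (use assms(2) in auto)

text \<open>Von Dyck's theorem, the source of the maps from \<open>P\<close> to the interval group
  and back to permutations of \<open>P\<close>. A class is evaluated at an arbitrary
  representative.\<close>

lemma presented_group_universal:
  assumes f: "f \<in> X \<rightarrow> carrier G"
    and R: "\<And>u v. (u, v) \<in> R \<Longrightarrow> u \<in> words X \<Longrightarrow> v \<in> words X \<Longrightarrow> word_eval G f u = word_eval G f v"
  obtains h where "h \<in> hom (presented_group X R) G"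
    and "\<And>u. u \<in> words X \<Longrightarrow> h (pres_class X R u) = word_eval G f u"
proof -
  define h where "h A = word_eval G f (SOME u. u \<in> A)" for A
  have h: "h (pres_class X R u) = word_eval G f u" if "u \<in> words X" for u
  proof -
    have "u \<in> pres_class X R u"
      using that by (simp add: pres_class_def pres_eq.refl)
    then have "(SOME v. v \<in> pres_class X R u) \<in> pres_class X R u"
      by (rule someI)
    then have "pres_eq X R u (SOME v. v \<in> pres_class X R u)"
      by (simp add: pres_class_def)
    from pres_eq_word_eval[OF f R this] show ?thesis
      by (simp add: h_def)
  qed
  have "h \<in> hom (presented_group X R) G"
  proof (rule homI)
    show "h x \<in> carrier G" if "x \<in> carrier (presented_group X R)" for x
      using that h by (auto simp: presented_group_def word_eval_closed[OF f])
    show "h (x \<otimes>\<^bsub>presented_group X R\<^esub> y) = h x \<otimes> h y"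
      if xy: "x \<in> carrier (presented_group X R)" "y \<in> carrier (presented_group X R)" for x y
    proof -
      obtain u where "u \<in> words X" "x = pres_class X R u"
        using xy(1) by (rule presented_group_carrierE)
      moreover obtain v where "v \<in> words X" "y = pres_class X R v"
        using xy(2) by (rule presented_group_carrierE)
      ultimately show ?thesis
        by (simp add: presented_group_mult h word_eval_append[OF f])
    qed
  qed
  with h that show thesis by blast
qed

end

lemma pres_class_carrier [simp]: "u \<in> words X \<Longrightarrow> pres_class X R u \<in> carrier (presented_group X R)"
  by (simp add: presented_group_def)

lemma presented_group_one: "\<one>\<^bsub>presented_group X R\<^esub> = pres_class X R []"
  by (simp add: presented_group_def)

definition pres_gen :: "'a set \<Rightarrow> ('a word \<times> 'a word) set \<Rightarrow> 'a \<Rightarrow> 'a word set" where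
  "pres_gen X R x = pres_class X R [(x, True)]"

lemma pres_gen_carrier [simp]: "x \<in> X \<Longrightarrow> pres_gen X R x \<in> carrier (presented_group X R)"
  by (simp add: pres_gen_def)

lemma inv_pres_gen:
  assumes "x \<in> X"
  shows "inv\<^bsub>presented_group X R\<^esub> pres_gen X R x = pres_class X R [(x, False)]"
proof -
  interpret group "presented_group X R" by (rule group_presented_group)
  have "pres_eq X R [(x, False), (x, True)] []"
    using pres_eq.cancel[OF assms, of R False] by simp
  then have "pres_class X R [(x, False)] \<otimes>\<^bsub>presented_group X R\<^esub> pres_gen X R x = \<one>\<^bsub>presented_group X R\<^esub>"
    using assms by (simp add: pres_gen_def presented_group_mult presented_group_one pres_class_eq_iff)
  then show ?thesis
    by (rule inv_equality) (use assms in auto)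
qed

lemma word_eval_pres_gen:
  "u \<in> words X \<Longrightarrow> word_eval (presented_group X R) (pres_gen X R) u = pres_class X R u"
proof (induction u)
  case (Cons a u)
  obtain x b where a: "a = (x, b)" by (cases a)
  with Cons show ?case
    using presented_group_mult[of "[(x, b)]" X u R]
    by (cases b) (simp_all add: inv_pres_gen pres_gen_def[symmetric])
qed (simp add: presented_group_one)

lemma pres_gen_relation:
  "(u, v) \<in> R \<Longrightarrow> u \<in> words X \<Longrightarrow> v \<in> words X \<Longrightarrow>
    word_eval (presented_group X R) (pres_gen X R) u = word_eval (presented_group X R) (pres_gen X R) v"
  by (simp add: word_eval_pres_gen pres_class_eq_iff pres_eq.rel)

lemma hom_word_eval:
  assumes "group G" "group K" "h \<in> hom G K" "f \<in> X \<rightarrow> carrier G" "u \<in> words X"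
  shows "h (word_eval G f u) = word_eval K (h \<circ> f) u"
  using assms(5)
proof (induction u)
  case Nil
  then show ?case using hom_one[OF assms(3,1,2)] by simp
next
  case (Cons a u)
  interpret group_hom G K h
    using assms by (simp add: group_hom_def group_hom_axioms_def)
  obtain x b where "a = (x, b)" by (cases a)
  with Cons show ?case
    using G.word_eval_closed[OF assms(4), of u] assms(4) by (auto simp: Pi_iff)
qed

lemma presented_group_hom_eqI:
  assumes "group K" "h \<in> hom (presented_group X R) K" "h' \<in> hom (presented_group X R) K"
    and "\<And>x. x \<in> X \<Longrightarrow> h (pres_gen X R x) = h' (pres_gen X R x)"
    and "y \<in> carrier (presented_group X R)"
  shows "h y = h' y"
proof -
  obtain u where u: "u \<in> words X" "y = pres_class X R u"
    using assms(5) by (rule presented_group_carrierE)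
  have eq: "word_eval K (h \<circ> pres_gen X R) u = word_eval K (h' \<circ> pres_gen X R) u"
    using u(1) by (induction u) (auto simp: assms(4))
  have "pres_gen X R \<in> X \<rightarrow> carrier (presented_group X R)"
    by auto
  from hom_word_eval[OF group_presented_group assms(1) assms(2) this u(1)]
    hom_word_eval[OF group_presented_group assms(1) assms(3) this u(1)] eq
  show ?thesis
    by (simp add: u word_eval_pres_gen)
qed

lemma presented_group_add_relator:
  fixes X R and r :: "'a word"
  defines "A \<equiv> presented_group X R"
  defines "N \<equiv> normal_closure A {pres_class X R r}"
  assumes r: "r \<in> words X"
  shows "presented_group X (insert (r, []) R) \<cong> A Mod N"
proof -
  let ?P = "presented_group X (insert (r, []) R)"
  interpret A: group A unfolding A_def by (rule group_presented_group)
  interpret P: group ?P by (rule group_presented_group)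
  have gen: "pres_gen X S \<in> X \<rightarrow> carrier (presented_group X S)" for S
    by auto
  obtain \<pi> where \<pi>: "\<pi> \<in> hom A ?P"
    and \<pi>_class: "\<And>u. u \<in> words X \<Longrightarrow> \<pi> (pres_class X R u) = pres_class X (insert (r, []) R) u"
    unfolding A_def
    by (rule P.presented_group_universal[of "pres_gen X (insert (r, []) R)" X R])
      (auto simp: word_eval_pres_gen pres_class_eq_iff intro: pres_eq.rel)
  interpret \<pi>: group_hom A ?P \<pi>
    by unfold_locales (rule \<pi>)
  have surj: "\<pi> ` carrier A = carrier ?P"
  proof
    show "carrier ?P \<subseteq> \<pi> ` carrier A"
    proof
      fix y assume "y \<in> carrier ?P"
      then obtain u where "u \<in> words X" "y = pres_class X (insert (r, []) R) u"
        by (rule presented_group_carrierE)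
      then show "y \<in> \<pi> ` carrier A"
        using \<pi>_class[of u] by (auto simp: A_def intro!: image_eqI[of _ \<pi> "pres_class X R u"])
    qed
  qed auto
  have r_cl: "pres_class X R r \<in> carrier A"
    using r by (simp add: A_def)
  have ker_r: "pres_class X R r \<in> kernel A ?P \<pi>"
    using r r_cl by (auto simp: kernel_def \<pi>_class presented_group_one pres_class_eq_iff intro: pres_eq.rel)
  have "kernel A ?P \<pi> = N"
  proof
    show "N \<subseteq> kernel A ?P \<pi>"
      using ker_r \<pi>.normal_kernel by (auto simp: N_def normal_closure_def)
    show "kernel A ?P \<pi> \<subseteq> N"
    proof
      fix x assume x: "x \<in> kernel A ?P \<pi>"
      \<comment> \<open>For a normal \<open>M\<close> containing the relator, \<open>A Mod M\<close>
        satisfies the enlarged set of relations, so the coset map factors as \<open>\<kappa>\<close>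
        after \<open>\<pi>\<close>. Whatever \<open>\<pi>\<close> kills therefore lies in
        \<open>M\<close>.\<close>
      have "x \<in> M" if M: "M \<lhd> A" "pres_class X R r \<in> M" for M
      proof -
        interpret M: normal M A by (rule M(1))
        interpret AM: group "A Mod M" by (rule M.factorgroup_is_group)
        interpret MH: group_hom A "A Mod M" "\<lambda>a. M #>\<^bsub>A\<^esub> a"
          by unfold_locales (rule M.r_coset_hom_Mod)
        have ev: "word_eval (A Mod M) ((\<lambda>a. M #>\<^bsub>A\<^esub> a) \<circ> pres_gen X R) u = M #>\<^bsub>A\<^esub> pres_class X R u"
          if "u \<in> words X" for u
          using hom_word_eval[OF A.is_group AM.is_group M.r_coset_hom_Mod, of "pres_gen X R" X u] that
          by (simp add: A_def word_eval_pres_gen)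
        have "M #>\<^bsub>A\<^esub> pres_class X R r = \<one>\<^bsub>A Mod M\<^esub>"
          using M(2) by (simp add: A.coset_join2 M.subgroup_axioms FactGroup_def r_cl)
        moreover have "M #>\<^bsub>A\<^esub> pres_class X R [] = \<one>\<^bsub>A Mod M\<^esub>"
          using MH.hom_one by (simp add: A_def presented_group_one)
        ultimately have rel: "word_eval (A Mod M) ((\<lambda>a. M #>\<^bsub>A\<^esub> a) \<circ> pres_gen X R) u'
            = word_eval (A Mod M) ((\<lambda>a. M #>\<^bsub>A\<^esub> a) \<circ> pres_gen X R) v'"
          if "(u', v') \<in> insert (r, []) R" "u' \<in> words X" "v' \<in> words X" for u' v'
        proof (cases "(u', v') = (r, [])")
          case False
          then have "pres_class X R u' = pres_class X R v'"
            using that by (auto simp: pres_class_eq_iff intro: pres_eq.rel)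
          then show ?thesis
            using that ev by simp
        qed (use that ev in auto)
        have cl: "(\<lambda>a. M #>\<^bsub>A\<^esub> a) \<circ> pres_gen X R \<in> X \<rightarrow> carrier (A Mod M)"
          using MH.hom_closed[of "pres_gen X R _"] unfolding A_def by (intro funcsetI) simp
        obtain \<kappa> where \<kappa>: "\<kappa> \<in> hom ?P (A Mod M)"
          and \<kappa>_ev: "\<And>u. u \<in> words X \<Longrightarrow> \<kappa> (pres_class X (insert (r, []) R) u)
            = word_eval (A Mod M) ((\<lambda>a. M #>\<^bsub>A\<^esub> a) \<circ> pres_gen X R) u"
          by (rule AM.presented_group_universal[OF cl, of "insert (r, []) R"], rule rel, assumption+)
            (rule that)
        note \<kappa>_class = HOL.trans[OF \<kappa>_ev ev]
        obtain u where u: "u \<in> words X" "x = pres_class X R u"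
          using x by (auto simp: kernel_def A_def elim: presented_group_carrierE)
        have "\<kappa> (\<pi> x) = M #>\<^bsub>A\<^esub> x"
          using u by (simp add: \<pi>_class \<kappa>_class)
        moreover have "\<kappa> (\<pi> x) = M"
          using x hom_one[OF \<kappa> P.is_group AM.is_group] by (simp add: kernel_def FactGroup_def)
        ultimately show "x \<in> M"
          using x A.rcos_self[OF _ M.subgroup_axioms, of x] by (auto simp: kernel_def)
      qed
      then show "x \<in> N"
        by (auto simp: N_def normal_closure_def)
    qed
  qed
  then have iso: "A Mod N \<cong> ?P" and N: "N \<lhd> A"
    using \<pi>.FactGroup_iso[OF surj] \<pi>.normal_kernel by simp_all
  show ?thesis
    by (rule group.iso_sym[OF normal.factorgroup_is_group[OF N] iso])
qed

section \<open>Groups of permutations\<close>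

text \<open>Permutations, composed from left to right, form a type of class group_add. Every group
  embeds into such a type by right translations; this makes the simplifier available for the
  computations with generators and relations.\<close>

typedef 'a perms = "{f :: 'a \<Rightarrow> 'a. bij f}"
  morphisms app Perm
  by (rule exI[of _ id]) simp

setup_lifting type_definition_perms

instantiation perms :: (type) group_add
begin

lift_definition zero_perms :: "'a perms" is "id" by simp
lift_definition plus_perms :: "'a perms \<Rightarrow> 'a perms \<Rightarrow> 'a perms" is "\<lambda>f g. g \<circ> f"
  by (rule bij_comp)
lift_definition uminus_perms :: "'a perms \<Rightarrow> 'a perms" is "inv_into UNIV"
  by (rule bij_imp_bij_inv)
definition minus_perms :: "'a perms \<Rightarrow> 'a perms \<Rightarrow> 'a perms" where
  "minus_perms f g = f + - g"

instance
proof
  fix a b c :: "'a perms"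
  show "a + b + c = a + (b + c)" by transfer (simp add: o_assoc)
  show "0 + a = a" by transfer simp
  show "a + 0 = a" by transfer simp
  show "- a + a = 0" by transfer (simp add: fun_eq_iff bij_is_surj surj_f_inv_f)
  show "a + - b = a - b" by (simp add: minus_perms_def)
qed

end

lemma app_zero [simp]: "app 0 x = x"
  by transfer simp

lemma app_plus [simp]: "app (f + g) x = app g (app f x)"
  by transfer simp

lemma app_minus_app [simp]: "app (- f) (app f x) = x"
  by transfer (simp add: bij_is_inj)

lemma app_app_minus [simp]: "app f (app (- f) x) = x"
  by transfer (simp add: bij_is_surj surj_f_inv_f)

lemma perms_eqI: "(\<And>x. app f x = app g x) \<Longrightarrow> f = g"
  by transfer auto

lemma app_Perm: "bij f \<Longrightarrow> app (Perm f) = f"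
  by (simp add: Perm_inverse)

lemma app_eq_iff [simp]: "app f x = app f y \<longleftrightarrow> x = y"
  by (metis app_minus_app)

definition perm_group :: "'a perms monoid" where
  "perm_group = \<lparr>carrier = UNIV, monoid.mult = (+), one = 0\<rparr>"

lemma perm_group_simps [simp]:
  "carrier perm_group = UNIV" "f \<otimes>\<^bsub>perm_group\<^esub> g = f + g" "\<one>\<^bsub>perm_group\<^esub> = 0"
  by (simp_all add: perm_group_def)

lemma group_perm_group: "group perm_group"
proof (rule groupI)
  show "\<exists>g\<in>carrier perm_group. g \<otimes>\<^bsub>perm_group\<^esub> f = \<one>\<^bsub>perm_group\<^esub>" for f :: "'a perms"
    by (auto intro: exI[of _ "- f"])
qed (auto simp: add.assoc)

lemma inv_perm_group [simp]: "inv\<^bsub>perm_group\<^esub> f = - f"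
  by (rule group.inv_equality[OF group_perm_group]) auto

text \<open>The identity outside the carrier makes the translation a bijection of the whole
  type.\<close>

definition right_mult :: "('a, 'b) monoid_scheme \<Rightarrow> 'a \<Rightarrow> 'a perms" where
  "right_mult G x = Perm (\<lambda>y. if y \<in> carrier G then y \<otimes>\<^bsub>G\<^esub> x else y)"

context group
begin

lemma app_right_mult:
  assumes "x \<in> carrier G"
  shows "app (right_mult G x) y = (if y \<in> carrier G then y \<otimes> x else y)"
proof -
  have "bij (\<lambda>y. if y \<in> carrier G then y \<otimes> x else y)"
    by (rule o_bij[of "\<lambda>y. if y \<in> carrier G then y \<otimes> inv x else y"])
      (use assms in \<open>auto simp: fun_eq_iff m_assoc\<close>)
  then show ?thesis by (simp add: right_mult_def app_Perm)
qed

lemma right_mult_hom: "right_mult G \<in> hom G perm_group"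
  by (rule homI) (auto intro!: perms_eqI simp: app_right_mult m_assoc)

lemma right_mult_inj:
  assumes "x \<in> carrier G" "y \<in> carrier G" "right_mult G x = right_mult G y"
  shows "x = y"
proof -
  have "app (right_mult G x) \<one> = app (right_mult G y) \<one>" using assms(3) by simp
  then show ?thesis using assms(1,2) by (simp add: app_right_mult)
qed

lemma right_mult_mult:
  "x \<in> carrier G \<Longrightarrow> y \<in> carrier G \<Longrightarrow> right_mult G (x \<otimes> y) = right_mult G x + right_mult G y"
  using right_mult_hom by (simp add: hom_def)

lemma right_mult_one [simp]: "right_mult G \<one> = 0"
  by (rule perms_eqI) (simp add: app_right_mult)

lemma right_mult_inv: "x \<in> carrier G \<Longrightarrow> right_mult G (inv x) = - right_mult G x"
  using right_mult_mult[of "inv x" x] by (simp add: eq_neg_iff_add_eq_0)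

end


section \<open>Dual generators of braid groups\<close>

abbreviation commute :: "'g::group_add \<Rightarrow> 'g \<Rightarrow> bool" where
  "commute x y \<equiv> x + y = y + x"

definition braid :: "'g::group_add \<Rightarrow> 'g \<Rightarrow> bool" where
  "braid x y \<longleftrightarrow> x + y + x = y + x + y"

text \<open>A right action, in keeping with composition from left to right:
  \<open>cj (g + h)\<close> applies \<open>cj g\<close> first, and conjugating a reflection by a
  signed permutation applies that permutation to its letters.\<close>

definition cj :: "'g::group_add \<Rightarrow> 'g \<Rightarrow> 'g" where
  "cj g x = - g + x + g"

lemma cj_0 [simp]: "cj 0 x = x"
  and cj_zero [simp]: "cj g 0 = 0"
  and cj_add: "cj g (x + y) = cj g x + cj g y"
  and cj_uminus: "cj g (- x) = - cj g x"
  and cj_cj: "cj g (cj h x) = cj (h + g) x"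
  and cj_minus_cancel [simp]: "cj (- g) (cj g x) = x"
  and cj_cancel_minus [simp]: "cj g (cj (- g) x) = x"
  by (simp_all add: cj_def add.assoc minus_add diff_conv_add_uminus del: add_uminus_conv_diff)

lemma cj_inject [simp]: "cj g x = cj g y \<longleftrightarrow> x = y"
  by (metis cj_minus_cancel)

lemma cj_self [simp]: "cj g g = g"
  by (simp add: cj_def)

lemma cj_eq_self_iff: "cj g x = x \<longleftrightarrow> commute g x"
proof -
  have "cj g x = x \<longleftrightarrow> g + cj g x = g + x" by simp
  also have "\<dots> \<longleftrightarrow> x + g = g + x" by (simp add: cj_def add.assoc del: add_left_cancel)
  finally show ?thesis by auto
qed

lemma cj_sum_list: "cj g (sum_list xs) = sum_list (map (cj g) xs)"
  by (induction xs) (simp_all add: cj_add)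

lemma commute_add:
  assumes "commute x y" "commute x z"
  shows "commute x (y + z)"
proof -
  have "x + (y + z) = (x + y) + z" by (simp add: add.assoc)
  also have "\<dots> = y + (x + z)" unfolding assms(1) by (simp add: add.assoc)
  also have "\<dots> = y + z + x" unfolding assms(2) by (simp add: add.assoc)
  finally show ?thesis .
qed

lemma commute_uminus:
  assumes "commute x y"
  shows "commute x (- y)"
proof -
  have "cj y x = x" using assms by (simp add: cj_eq_self_iff)
  then have "cj (- y) x = x" by (metis cj_minus_cancel)
  then show ?thesis by (simp add: cj_eq_self_iff)
qed

lemma commute_cj: "commute x g \<Longrightarrow> commute x y \<Longrightarrow> commute x (cj g y)"
  unfolding cj_def by (intro commute_add commute_uminus)

lemma commute_sum_list: "(\<And>y. y \<in> set ys \<Longrightarrow> commute x y) \<Longrightarrow> commute x (sum_list ys)"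
  by (induction ys) (auto intro: commute_add)

lemma commute_cj_cj [simp]: "commute (cj g x) (cj g y) \<longleftrightarrow> commute x y"
  by (simp flip: cj_add)

lemma braid_sym: "braid x y \<longleftrightarrow> braid y x"
  by (auto simp: braid_def)

lemma braid_cj_cj [simp]: "braid (cj g x) (cj g y) \<longleftrightarrow> braid x y"
  by (simp add: braid_def flip: cj_add)

text \<open>Cancelling \<open>x\<close> on the left and \<open>y\<close> on the right turns the
  braid relation into an equality of two conjugates. In this form it pushes generators along a
  chain.\<close>

lemma braid_iff_cj: "braid x y \<longleftrightarrow> cj x y = cj (- y) x"
proof -
  have "cj x y = cj (- y) x \<longleftrightarrow> x + cj x y + y = x + cj (- y) x + y" by simp
  also have "\<dots> \<longleftrightarrow> y + x + y = x + y + x"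
    by (simp add: cj_def add.assoc del: add_left_cancel add_right_cancel)
  finally show ?thesis by (auto simp: braid_def)
qed

lemma cj_cj_distrib: "cj g (cj x y) = cj (cj g x) (cj g y)"
  by (simp add: cj_cj) (simp add: cj_def add.assoc)

lemma add_eq_cj: "x + y = cj (- x) y + x" "x + y = y + cj y x"
  by (simp_all add: cj_def add.assoc)

lemma cj_cj_braid: "braid x y \<Longrightarrow> cj (- x) (cj (- y) x) = y"
  using cj_minus_cancel[of x y] by (simp add: braid_iff_cj)

text \<open>The Birman-Ko-Lee relation for three letters in cyclic order: the three ways of writing
  one 3-cycle as a product of two transpositions get the same value.\<close>

definition triangle :: "('a \<times> 'a \<Rightarrow> 'g::group_add) \<Rightarrow> 'a \<Rightarrow> 'a \<Rightarrow> 'a \<Rightarrow> bool" where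
  "triangle \<psi> a b c \<longleftrightarrow> \<psi> (b, c) + \<psi> (a, b) = \<psi> (a, c) + \<psi> (b, c) \<and>
     \<psi> (b, c) + \<psi> (a, b) = \<psi> (a, b) + \<psi> (a, c)"

text \<open>With the four letters placed in this order on a circle, these are the two ways of
  joining them by disjoint chords; nothing is asked of the crossing chords \<open>ac\<close> and
  \<open>bd\<close>.\<close>

definition noncrossing :: "('a \<times> 'a \<Rightarrow> 'g::group_add) \<Rightarrow> 'a \<Rightarrow> 'a \<Rightarrow> 'a \<Rightarrow> 'a \<Rightarrow> bool" where
  "noncrossing \<psi> a b c d \<longleftrightarrow>
     commute (\<psi> (a, b)) (\<psi> (c, d)) \<and> commute (\<psi> (a, d)) (\<psi> (b, c))"

definition dual_rels :: "('a \<times> 'a \<Rightarrow> 'g::group_add) \<Rightarrow> 'a list \<Rightarrow> bool" where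
  "dual_rels \<psi> xs \<longleftrightarrow> (\<forall>a b c. subseq [a, b, c] xs \<longrightarrow> triangle \<psi> a b c) \<and>
     (\<forall>a b c d. subseq [a, b, c, d] xs \<longrightarrow> noncrossing \<psi> a b c d)"

text \<open>The cycle through \<open>x\<^sub>1, \<dots>, x\<^sub>k\<close> is the product
  \<open>(x\<^sub>k\<^sub>-\<^sub>1 x\<^sub>k) \<cdots> (x\<^sub>2 x\<^sub>3) (x\<^sub>1 x\<^sub>2)\<close>.\<close>

fun cycle_word :: "'a list \<Rightarrow> ('a \<times> 'a) list" where
  "cycle_word (x # y # xs) = cycle_word (y # xs) @ [(x, y)]"
| "cycle_word _ = []"

lemma length_cycle_word [simp]: "length (cycle_word xs) = length xs - 1"
  by (induction xs rule: cycle_word.induct) auto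

lemma set_cycle_word: "(a, b) \<in> set (cycle_word xs) \<Longrightarrow> subseq [a, b] xs"
  by (induction xs rule: cycle_word.induct) (auto intro: subseq_Cons')

lemma cycle_word_append:
  "cycle_word (xs @ x # y # ys) = cycle_word (y # ys) @ [(x, y)] @ cycle_word (xs @ [x])"
proof (induction xs)
  case (Cons z xs)
  then show ?case by (cases xs) auto
qed auto

lemma dual_rels_subseq: "dual_rels \<psi> xs \<Longrightarrow> subseq ys xs \<Longrightarrow> dual_rels \<psi> ys"
  unfolding dual_rels_def by (meson subseq_order.order_trans)

lemma subseq_snocE:
  assumes "subseq (as @ [a]) (xs @ [x])"
  shows "subseq (as @ [a]) xs \<or> (a = x \<and> subseq as xs)"
proof -
  obtain us vs where uv: "as @ [a] = us @ vs" "subseq us xs" "subseq vs [x]"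
    using assms by (auto simp: subseq_append_iff)
  show ?thesis
  proof (cases vs rule: rev_cases)
    case (snoc vs' b)
    then have "vs' = []" using uv(3) list_emb_length[OF uv(3)] by simp
    then show ?thesis using uv snoc by (auto simp: subseq_singleton_left split: if_splits)
  qed (use uv in simp)
qed

text \<open>For \<open>i < k\<close> this is the Birman-Ko-Lee generator of the strands
  \<open>i\<close> and \<open>k\<close>: the generator \<open>g i\<close> of neighbouring strands,
  conjugated successively by the inverses of \<open>g (i + 1)\<close> up to
  \<open>g (k - 1)\<close>. The value for \<open>k \<le> i\<close> is a filler.\<close>

fun bkl :: "(nat \<Rightarrow> 'g::group_add) \<Rightarrow> nat \<Rightarrow> nat \<Rightarrow> 'g" where
  "bkl g i 0 = g i"
| "bkl g i (Suc k) = (if k \<le> i then g i else cj (- g k) (bkl g i k))"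

definition braid_chain :: "nat \<Rightarrow> (nat \<Rightarrow> 'g::group_add) \<Rightarrow> bool" where
  "braid_chain M g \<longleftrightarrow> (\<forall>i. Suc i < M \<longrightarrow> braid (g i) (g (Suc i))) \<and>
     (\<forall>i j. Suc i < j \<longrightarrow> j < M \<longrightarrow> commute (g i) (g j))"

lemma commute_bkl:
  "i < k \<Longrightarrow> (\<And>r. i \<le> r \<Longrightarrow> r < k \<Longrightarrow> commute x (g r)) \<Longrightarrow> commute x (bkl g i k)"
  by (induction k) (auto intro!: commute_cj commute_uminus)

context
  fixes M and g :: "nat \<Rightarrow> 'g::group_add"
  assumes chain: "braid_chain M g"
begin

lemma chain_commute: "i < M \<Longrightarrow> j < M \<Longrightarrow> Suc i < j \<or> Suc j < i \<Longrightarrow> commute (g i) (g j)"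
  using chain by (metis braid_chain_def)

lemma chain_braid: "Suc i < M \<Longrightarrow> braid (g i) (g (Suc i))"
  using chain by (simp add: braid_chain_def)

lemma bkl_commute_disjoint:
  "i < k \<Longrightarrow> k \<le> M \<Longrightarrow> j < M \<Longrightarrow> Suc j < i \<or> k < j \<Longrightarrow> commute (g j) (bkl g i k)"
  by (rule commute_bkl) (auto intro!: chain_commute)

text \<open>Everything rests on the case \<open>k = j + 2\<close>. There both elements are
  conjugates, by one and the same element, of \<open>g (j + 1)\<close> and \<open>bkl g i j\<close>,
  whose indices are far enough apart. Larger \<open>k\<close> only conjugate by generators commuting
  with \<open>g j\<close>.\<close>

lemma bkl_commute_nested:
  assumes "i < j" "Suc j < k" "k \<le> M"
  shows "commute (g j) (bkl g i k)"
  using assms(2,3)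
proof (induction k)
  case (Suc k)
  show ?case
  proof (cases "Suc j < k")
    case True
    then show ?thesis using Suc assms(1)
      by (auto intro!: commute_cj commute_uminus chain_commute)
  next
    case False
    then have k: "k = Suc j" using Suc by simp
    have "bkl g i (Suc k) = cj (- g (Suc j)) (cj (- g j) (bkl g i j))"
      using assms(1) by (simp add: k)
    moreover have "g j = cj (- g (Suc j)) (cj (- g j) (g (Suc j)))"
      using chain_braid[of j] Suc(3) by (intro cj_cj_braid[symmetric]) (simp add: k braid_sym)
    ultimately have "commute (g j) (bkl g i (Suc k)) \<longleftrightarrow> commute (g (Suc j)) (bkl g i j)"
      by (metis commute_cj_cj)
    then show ?thesis
      using bkl_commute_disjoint[of i j "Suc j"] assms(1) Suc(3) k by simp
  qed
qed simp

lemma bkl_commute_bkl_nested: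
  "i < j \<Longrightarrow> j < k \<Longrightarrow> k < l \<Longrightarrow> l \<le> M \<Longrightarrow> commute (bkl g i l) (bkl g j k)"
  by (rule commute_bkl) (auto intro!: bkl_commute_nested[symmetric])

lemma bkl_commute_bkl_disjoint:
  "i < j \<Longrightarrow> j < k \<Longrightarrow> k < l \<Longrightarrow> l \<le> M \<Longrightarrow> commute (bkl g i j) (bkl g k l)"
  by (rule commute_bkl) (auto intro!: bkl_commute_disjoint[symmetric])

text \<open>By the previous instance, \<open>bkl g i (j + 1)\<close> is the conjugate of
  \<open>g j\<close> by \<open>bkl g i j\<close>. The same conjugation fixes
  \<open>g (j + 1)\<close>, so the claim is a conjugate of the braid relation of \<open>g j\<close>
  and \<open>g (j + 1)\<close>.\<close>

lemma braid_bkl: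
  assumes "i < j" "j < M"
  shows "braid (bkl g i j) (g j)"
  using assms
proof (induction j)
  case (Suc j)
  show ?case
  proof (cases "j = i")
    case False
    then have "braid (bkl g i j) (g j)" using Suc by simp
    then have "bkl g i (Suc j) = cj (bkl g i j) (g j)"
      using False Suc by (simp add: braid_iff_cj)
    moreover have "cj (bkl g i j) (g (Suc j)) = g (Suc j)"
      using bkl_commute_disjoint[of i j "Suc j"] Suc False by (simp add: cj_eq_self_iff)
    ultimately show ?thesis
      using chain_braid[of j] Suc(3) by (metis braid_cj_cj[of "bkl g i j"])
  qed (use chain_braid[of i] Suc in simp)
qed simp

text \<open>The start \<open>k = j + 1\<close> is \<open>braid_bkl\<close>. Each further step
  conjugates all three elements by the same generator, which leaves \<open>bkl g i j\<close>
  unchanged.\<close>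

lemma bkl_triangle:
  assumes "i < j" "j < k" "k \<le> M"
  shows "bkl g i k = cj (- bkl g j k) (bkl g i j)" "bkl g i k = cj (bkl g i j) (bkl g j k)"
proof -
  have "bkl g i k = cj (- bkl g j k) (bkl g i j) \<and> bkl g i k = cj (bkl g i j) (bkl g j k)"
    using assms(2,3)
  proof (induction k)
    case (Suc k)
    show ?case
    proof (cases "k = j")
      case True
      then show ?thesis using braid_bkl[of i j] Suc assms(1) by (simp add: braid_iff_cj)
    next
      case False
      have c: "cj (- g k) (bkl g i j) = bkl g i j"
        unfolding cj_eq_self_iff using bkl_commute_disjoint[of i j k] Suc assms(1) False
        by (intro commute_uminus[symmetric]) auto
      have "bkl g i (Suc k) = cj (- g k) (bkl g i k)" "bkl g j (Suc k) = cj (- g k) (bkl g j k)"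
        using Suc assms(1) False by simp_all
      moreover have "bkl g i k = cj (- bkl g j k) (bkl g i j)" "bkl g i k = cj (bkl g i j) (bkl g j k)"
        using Suc False by auto
      ultimately show ?thesis
        using c cj_cj_distrib[of "- g k" "- bkl g j k" "bkl g i j"] cj_cj_distrib[of "- g k" "bkl g i j" "bkl g j k"]
        by (simp add: cj_uminus)
    qed
  qed simp
  then show "bkl g i k = cj (- bkl g j k) (bkl g i j)" "bkl g i k = cj (bkl g i j) (bkl g j k)" by auto
qed

end

lemma subseq_map_upt:
  assumes "subseq zs (map y [i..<N])"
  obtains ks where "zs = map y ks" "sorted_wrt (<) ks" "set ks \<subseteq> {i..<N}"
proof -
  have "\<exists>ks. zs = map y ks \<and> sorted_wrt (<) ks \<and> set ks \<subseteq> {i..<N}"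
    using assms
  proof (induction N arbitrary: zs)
    case (Suc N)
    show ?case
    proof (cases "i \<le> N")
      case True
      show ?thesis
      proof (cases zs rule: rev_cases)
        case (snoc as a)
        then consider "subseq zs (map y [i..<N])" | "a = y N" "subseq as (map y [i..<N])"
          using Suc(2) True subseq_snocE[of as a "map y [i..<N]" "y N"] by auto
        then show ?thesis
        proof cases
          case 1
          with Suc(1) show ?thesis by fastforce
        next
          case 2
          with Suc(1)[of as] obtain ks where "as = map y ks" "sorted_wrt (<) ks" "set ks \<subseteq> {i..<N}"
            by blast
          then show ?thesis
            using 2 snoc True by (intro exI[of _ "ks @ [N]"]) (auto simp: sorted_wrt_append)
        qed
      qed simp
    qed (use Suc in simp)
  qed simp
  with that show thesis by blast
qed

lemma dual_rels_bkl:
  assumes chain: "braid_chain M g"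
    and \<psi>: "\<And>i j. i < j \<Longrightarrow> j \<le> M \<Longrightarrow> \<psi> (y i, y j) = bkl g i j"
  shows "dual_rels \<psi> (map y [0..<Suc M])"
  unfolding dual_rels_def
proof (intro conjI allI impI)
  fix a b c assume "subseq [a, b, c] (map y [0..<Suc M])"
  then obtain ks where ks: "[a, b, c] = map y ks" "sorted_wrt (<) ks" "set ks \<subseteq> {0..<Suc M}"
    by (rule subseq_map_upt)
  then obtain i j k where "ks = [i, j, k]" by auto
  with ks have ijk: "i < j" "j < k" "k \<le> M" and eq: "a = y i" "b = y j" "c = y k"
    by auto
  have "bkl g j k + bkl g i j = bkl g i k + bkl g j k"
    unfolding bkl_triangle(1)[OF chain ijk] by (rule add_eq_cj(1))
  moreover have "bkl g j k + bkl g i j = bkl g i j + bkl g i k"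
    unfolding bkl_triangle(2)[OF chain ijk] by (rule add_eq_cj(2))
  ultimately show "triangle \<psi> a b c"
    using ijk by (simp add: triangle_def \<psi> eq)
next
  fix a b c d assume "subseq [a, b, c, d] (map y [0..<Suc M])"
  then obtain ks where ks: "[a, b, c, d] = map y ks" "sorted_wrt (<) ks" "set ks \<subseteq> {0..<Suc M}"
    by (rule subseq_map_upt)
  then obtain i j k l where "ks = [i, j, k, l]" by auto
  with ks show "noncrossing \<psi> a b c d"
    using bkl_commute_bkl_nested[OF chain, of i j k l] bkl_commute_bkl_disjoint[OF chain, of i j k l]
    by (auto simp: noncrossing_def \<psi>)
qed

definition cyc :: "('a \<times> 'a \<Rightarrow> 'g::group_add) \<Rightarrow> 'a list \<Rightarrow> 'g" where
  "cyc \<psi> xs = sum_list (map \<psi> (cycle_word xs))"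

lemma cyc_simps [simp]:
  "cyc \<psi> [] = 0" "cyc \<psi> [x] = 0" "cyc \<psi> (x # y # xs) = cyc \<psi> (y # xs) + \<psi> (x, y)"
  by (simp_all add: cyc_def)

lemma cyc_append:
  "cyc \<psi> (xs @ x # y # ys) = cyc \<psi> (y # ys) + \<psi> (x, y) + cyc \<psi> (xs @ [x])"
  by (simp add: cyc_def cycle_word_append add.assoc)

lemma cyc_snoc:
  assumes "xs \<noteq> []"
  shows "cyc \<psi> (xs @ [z]) = \<psi> (last xs, z) + cyc \<psi> xs"
  using assms cyc_append[of \<psi> "butlast xs" "last xs" z "[]"]
  by (metis append.assoc append_Cons append_Nil append_butlast_last_id cyc_simps(2) add.left_neutral)

text \<open>Rotation invariance rests on moving a letter \<open>(z, x)\<close> through the whole cycle.\<close>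

lemma cyc_move:
  "dual_rels \<psi> (z # xs) \<Longrightarrow> xs \<noteq> [] \<Longrightarrow> cyc \<psi> xs + \<psi> (z, hd xs) = \<psi> (z, last xs) + cyc \<psi> xs"
proof (induction xs rule: cycle_word.induct)
  case (1 x y xs)
  have tri: "triangle \<psi> z x y"
    using 1(2) by (auto simp: dual_rels_def)
  have "dual_rels \<psi> (z # y # xs)"
    using 1(2) by (rule dual_rels_subseq) auto
  note IH = 1(1)[OF this]
  have "cyc \<psi> (x # y # xs) + \<psi> (z, x) = cyc \<psi> (y # xs) + (\<psi> (x, y) + \<psi> (z, x))"
    by (simp add: add.assoc)
  also have "\<dots> = cyc \<psi> (y # xs) + \<psi> (z, y) + \<psi> (x, y)"
    using tri by (simp add: triangle_def add.assoc)
  also have "\<dots> = \<psi> (z, last (y # xs)) + (cyc \<psi> (y # xs) + \<psi> (x, y))"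
    using IH by (simp add: add.assoc)
  finally show ?case by simp
qed auto

locale symmetric_pairs =
  fixes \<psi> :: "'a \<times> 'a \<Rightarrow> 'g::group_add"
  assumes pair_sym: "\<psi> (a, b) = \<psi> (b, a)"
begin

text \<open>Pairs are unordered, so triangles and disjoint chords depend only on the cyclic order of
  the letters.\<close>

lemma dual_rels_rotate1:
  assumes "dual_rels \<psi> (x # xs)"
  shows "dual_rels \<psi> (xs @ [x])"
  unfolding dual_rels_def
proof (intro conjI allI impI)
  fix a b c assume "subseq [a, b, c] (xs @ [x])"
  then consider "subseq [a, b, c] xs" | "c = x" "subseq [a, b] xs"
    using subseq_snocE[of "[a, b]" c xs x] by auto
  then show "triangle \<psi> a b c"
  proof cases
    case 1
    moreover have "dual_rels \<psi> xs" by (rule dual_rels_subseq[OF assms]) auto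
    ultimately show ?thesis by (simp add: dual_rels_def)
  next
    case 2
    then have "triangle \<psi> x a b" using assms by (auto simp: dual_rels_def)
    with 2 show ?thesis by (simp add: triangle_def pair_sym[of _ x]) metis
  qed
next
  fix a b c d assume "subseq [a, b, c, d] (xs @ [x])"
  then consider "subseq [a, b, c, d] xs" | "d = x" "subseq [a, b, c] xs"
    using subseq_snocE[of "[a, b, c]" d xs x] by auto
  then show "noncrossing \<psi> a b c d"
  proof cases
    case 1
    moreover have "dual_rels \<psi> xs" by (rule dual_rels_subseq[OF assms]) auto
    ultimately show ?thesis by (simp add: dual_rels_def)
  next
    case 2
    then have "noncrossing \<psi> x a b c" using assms by (auto simp: dual_rels_def)
    with 2 show ?thesis by (simp add: noncrossing_def pair_sym[of _ x])
  qed
qed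

lemma dual_rels_rotate: "dual_rels \<psi> (xs @ ys) \<Longrightarrow> dual_rels \<psi> (ys @ xs)"
proof (induction xs arbitrary: ys)
  case (Cons x xs)
  then show ?case using dual_rels_rotate1[of x "xs @ ys"] Cons.IH[of "ys @ [x]"] by simp
qed simp

lemma cyc_rotate1:
  assumes "dual_rels \<psi> (x # xs)"
  shows "cyc \<psi> (x # xs) = cyc \<psi> (xs @ [x])"
proof (cases xs)
  case (Cons y ys)
  then have "cyc \<psi> (x # xs) = cyc \<psi> xs + \<psi> (x, hd xs)" by simp
  also have "\<dots> = \<psi> (x, last xs) + cyc \<psi> xs"
    using assms Cons by (intro cyc_move) auto
  also have "\<dots> = cyc \<psi> (xs @ [x])"
    using Cons pair_sym by (subst cyc_snoc) auto
  finally show ?thesis .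
qed simp

lemma cyc_rotate: "dual_rels \<psi> (xs @ ys) \<Longrightarrow> cyc \<psi> (xs @ ys) = cyc \<psi> (ys @ xs)"
proof (induction xs arbitrary: ys)
  case (Cons x xs)
  then show ?case
    using dual_rels_rotate1[of x "xs @ ys"] cyc_rotate1[of x "xs @ ys"] Cons.IH[of "ys @ [x]"] by simp
qed simp

text \<open>Cutting the list between \<open>xs\<close> and \<open>ys\<close> puts the factor of the
  two adjacent ends in the middle; \<open>cyc_move\<close> carries it through the cycle of
  \<open>ys\<close>, and the cycles of the two parts commute because their chords are
  disjoint.\<close>

lemma cyc_split:
  assumes "dual_rels \<psi> (xs @ ys)" "xs \<noteq> []" "ys \<noteq> []"
  shows "cyc \<psi> (xs @ ys) = \<psi> (last xs, last ys) + cyc \<psi> xs + cyc \<psi> ys"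
proof -
  have eq: "butlast xs @ last xs # ys = xs @ ys"
    using assms(2) by (metis append.assoc append_Cons append_Nil append_butlast_last_id)
  have "dual_rels \<psi> (last xs # ys)"
  proof (rule dual_rels_subseq[OF assms(1)])
    have "subseq ([last xs] @ ys) (xs @ ys)"
      using assms(2) by (intro list_emb_append_mono) (auto simp: subseq_singleton_left)
    then show "subseq (last xs # ys) (xs @ ys)" by simp
  qed
  note move = cyc_move[OF this assms(3)]
  have comm: "commute (cyc \<psi> xs) (cyc \<psi> ys)"
    unfolding cyc_def
  proof (rule commute_sum_list, rule commute_sum_list[symmetric])
    fix u v assume "u \<in> set (map \<psi> (cycle_word ys))" "v \<in> set (map \<psi> (cycle_word xs))"
    then obtain a b c d where uv: "(a, b) \<in> set (cycle_word xs)" "(c, d) \<in> set (cycle_word ys)"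
      "u = \<psi> (c, d)" "v = \<psi> (a, b)" by auto
    then have "subseq ([a, b] @ [c, d]) (xs @ ys)"
      by (intro list_emb_append_mono set_cycle_word)
    then have "noncrossing \<psi> a b c d"
      using assms(1) by (simp add: dual_rels_def)
    then show "commute u v"
      using uv by (simp add: noncrossing_def)
  qed
  have "cyc \<psi> (xs @ ys) = cyc \<psi> ys + \<psi> (last xs, hd ys) + cyc \<psi> xs"
    using cyc_append[of \<psi> "butlast xs" "last xs" "hd ys" "tl ys"] assms(2,3) by (simp add: eq)
  also have "\<dots> = \<psi> (last xs, last ys) + (cyc \<psi> ys + cyc \<psi> xs)"
    unfolding move by (simp add: add.assoc)
  finally show ?thesis using comm by (simp add: add.assoc)
qed

text \<open>Rotating the last letter to the front splits off its factor on the right. The star is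
  what allows a few reflections through a common letter to be completed to a factorization of
  \<open>w\<close>.\<close>

lemma cyc_star:
  assumes "dual_rels \<psi> (x # xs)"
  shows "cyc \<psi> (x # xs) = sum_list (map (\<lambda>y. \<psi> (x, y)) xs)"
  using assms
proof (induction xs rule: rev_induct)
  case (snoc y xs)
  have *: "dual_rels \<psi> (x # xs)"
    using snoc(2) by (rule dual_rels_subseq) auto
  have "cyc \<psi> ((x # xs) @ [y]) = cyc \<psi> (y # x # xs)"
    using cyc_rotate[of "x # xs" "[y]"] snoc(2) by simp
  then show ?case using snoc(1)[OF *] pair_sym[of y x] by simp
qed simp

end

section \<open>Signed permutations and their reflections\<close>

definition signed :: "nat \<Rightarrow> int perms \<Rightarrow> bool" where
  "signed n f \<longleftrightarrow> (\<forall>x. app f (- x) = - app f x) \<and> (\<forall>x. \<bar>x\<bar> > int n \<longrightarrow> app f x = x)"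

lemma signed_zero [simp]: "signed n 0"
  and signed_plus: "signed n f \<Longrightarrow> signed n g \<Longrightarrow> signed n (f + g)"
  by (auto simp: signed_def)

lemma signed_uminus:
  assumes "signed n f" shows "signed n (- f)"
  unfolding signed_def
proof (intro conjI allI impI)
  fix x
  have "app f (app (- f) (- x)) = app f (- app (- f) x)"
    using assms by (simp add: signed_def)
  then show "app (- f) (- x) = - app (- f) x"
    by (simp only: app_eq_iff)
  assume "int n < \<bar>x\<bar>"
  then have "app f x = x" using assms by (simp add: signed_def)
  then show "app (- f) x = x" by (metis app_minus_app)
qed

lemma signed_app_uminus: "signed n f \<Longrightarrow> app f (- x) = - app f x"
  by (simp add: signed_def)

lemma signed_app_0: assumes "signed n f" shows "app f 0 = 0"
proof -
  have "app f 0 = - app f 0"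
    using signed_app_uminus[OF assms, of 0] unfolding minus_zero .
  then show ?thesis by linarith
qed

lemma signed_app_abs_eq_iff: "signed n f \<Longrightarrow> \<bar>app f x\<bar> = \<bar>app f y\<bar> \<longleftrightarrow> \<bar>x\<bar> = \<bar>y\<bar>"
  unfolding abs_eq_iff app_eq_iff[of f x "- y", symmetric] by (simp add: signed_app_uminus)

lemma signed_app_bound: "signed n f \<Longrightarrow> \<bar>app f x\<bar> \<le> int n \<longleftrightarrow> \<bar>x\<bar> \<le> int n"
  by (metis app_eq_iff[of f] not_less signed_def)

definition swap_pm :: "int \<Rightarrow> int \<Rightarrow> int \<Rightarrow> int" where
  "swap_pm a b x = (if x = a then b else if x = b then a
     else if x = - a then - b else if x = - b then - a else x)"

lemma swap_pm_simps [simp]: "swap_pm a b a = b" "swap_pm a b b = a"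
  by (simp_all add: swap_pm_def)

lemma swap_pm_other: "\<bar>x\<bar> \<noteq> \<bar>a\<bar> \<Longrightarrow> \<bar>x\<bar> \<noteq> \<bar>b\<bar> \<Longrightarrow> swap_pm a b x = x"
  by (auto simp: swap_pm_def)

text \<open>Degenerate pairs give the identity, so that \<open>rfl_sym\<close>,
  \<open>rfl_uminus\<close> and \<open>rfl_rfl\<close> hold for all pairs.\<close>

definition rfl :: "int \<times> int \<Rightarrow> int perms" where
  "rfl = (\<lambda>(a, b). if a = 0 \<or> b = 0 \<or> \<bar>a\<bar> = \<bar>b\<bar> then 0 else Perm (swap_pm a b))"

definition refl_pairs :: "nat \<Rightarrow> (int \<times> int) set" where
  "refl_pairs n = {(a, b). a \<noteq> 0 \<and> b \<noteq> 0 \<and> \<bar>a\<bar> \<le> int n \<and> \<bar>b\<bar> \<le> int n \<and> \<bar>a\<bar> \<noteq> \<bar>b\<bar>}"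

lemma app_rfl:
  "app (rfl (a, b)) x = (if a = 0 \<or> b = 0 \<or> \<bar>a\<bar> = \<bar>b\<bar> then x else swap_pm a b x)"
proof (cases "a = 0 \<or> b = 0 \<or> \<bar>a\<bar> = \<bar>b\<bar>")
  case False
  then have "swap_pm a b (swap_pm a b x) = x" for x
    by (auto simp: swap_pm_def)
  then have "bij (swap_pm a b)"
    by (intro o_bij[of "swap_pm a b"]) (auto simp: fun_eq_iff)
  then show ?thesis using False by (simp add: rfl_def app_Perm)
qed (auto simp: rfl_def)

lemma app_rfl_other: "\<bar>x\<bar> \<noteq> \<bar>a\<bar> \<Longrightarrow> \<bar>x\<bar> \<noteq> \<bar>b\<bar> \<Longrightarrow> app (rfl (a, b)) x = x"
  by (simp add: app_rfl swap_pm_other)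

lemma rfl_sym: "rfl (a, b) = rfl (b, a)"
  by (rule perms_eqI) (auto simp: app_rfl swap_pm_def)

lemma rfl_uminus: "rfl (- a, - b) = rfl (a, b)"
  by (rule perms_eqI) (auto simp: app_rfl swap_pm_def)

lemma rfl_rfl [simp]: "rfl p + rfl p = 0"
  by (cases p, rule perms_eqI) (auto simp: app_rfl swap_pm_def)

lemma uminus_rfl [simp]: "- rfl p = rfl p"
  by (rule minus_unique) simp

lemma signed_rfl: "p \<in> refl_pairs n \<Longrightarrow> signed n (rfl p)"
  by (cases p) (auto simp: signed_def refl_pairs_def app_rfl swap_pm_def)

lemma signed_sum_rfl: "set ps \<subseteq> refl_pairs n \<Longrightarrow> signed n (sum_list (map rfl ps))"
  by (induction ps) (auto intro: signed_plus signed_rfl)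

lemma cj_rfl:
  assumes "signed n f"
  shows "cj f (rfl (a, b)) = rfl (app f a, app f b)"
proof -
  have m: "app f (- x) = - app f x" for x using assms by (rule signed_app_uminus)
  have c: "app f x = - app f y \<longleftrightarrow> x = - y" "app f x = 0 \<longleftrightarrow> x = 0" for x y
    using app_eq_iff[of f x "- y"] app_eq_iff[of f x 0] signed_app_0[OF assms] by (simp_all add: m)
  have "rfl (a, b) + f = f + rfl (app f a, app f b)"
    by (rule perms_eqI) (simp add: app_rfl swap_pm_def m c signed_app_abs_eq_iff[OF assms])
  then show ?thesis by (simp add: cj_def add.assoc)
qed

definition map_pair :: "int perms \<Rightarrow> int \<times> int \<Rightarrow> int \<times> int" where
  "map_pair f = (\<lambda>(a, b). (app f a, app f b))"

lemma rfl_map_pair: "signed n f \<Longrightarrow> rfl (map_pair f p) = cj f (rfl p)"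
  by (cases p) (simp add: map_pair_def cj_rfl)

lemma map_pair_refl_pairs: "signed n f \<Longrightarrow> p \<in> refl_pairs n \<Longrightarrow> map_pair f p \<in> refl_pairs n"
  using signed_app_0 app_eq_iff[of f _ 0]
  by (cases p) (auto simp: map_pair_def refl_pairs_def signed_app_bound signed_app_abs_eq_iff)

interpretation rfl: symmetric_pairs rfl
  by standard (rule rfl_sym)

lemma cj_rfl_rfl:
  assumes "a \<noteq> 0" "b \<noteq> 0" "\<bar>a\<bar> \<noteq> \<bar>b\<bar>"
  shows "cj (rfl (a, b)) (rfl (c, d)) = rfl (swap_pm a b c, swap_pm a b d)"
proof -
  have "signed (nat (max \<bar>a\<bar> \<bar>b\<bar>)) (rfl (a, b))"
    using assms by (intro signed_rfl) (auto simp: refl_pairs_def)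
  from cj_rfl[OF this] show ?thesis using assms by (simp add: app_rfl)
qed

lemma commute_rfl:
  assumes "a \<noteq> 0" "b \<noteq> 0" "\<bar>a\<bar> \<noteq> \<bar>b\<bar>" "\<bar>c\<bar> \<notin> {\<bar>a\<bar>, \<bar>b\<bar>}" "\<bar>d\<bar> \<notin> {\<bar>a\<bar>, \<bar>b\<bar>}"
  shows "commute (rfl (a, b)) (rfl (c, d))"
proof -
  have "swap_pm a b c = c" "swap_pm a b d = d" using assms by (simp_all add: swap_pm_other)
  then have "cj (rfl (a, b)) (rfl (c, d)) = rfl (c, d)"
    using cj_rfl_rfl[OF assms(1-3), of c d] by simp
  then show ?thesis by (simp only: cj_eq_self_iff)
qed

lemma triangle_rfl:
  assumes "distinct [\<bar>a\<bar>, \<bar>b\<bar>, \<bar>c\<bar>]" "a \<noteq> 0" "b \<noteq> 0" "c \<noteq> 0"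
  shows "triangle rfl a b c"
proof -
  have eqs: "cj (- rfl (b, c)) (rfl (a, b)) = rfl (a, c)" "cj (rfl (a, b)) (rfl (b, c)) = rfl (a, c)"
    using assms by (simp_all add: cj_rfl_rfl swap_pm_other)
  show ?thesis
    unfolding triangle_def
    using add_eq_cj(1)[of "rfl (b, c)" "rfl (a, b)", unfolded eqs]
      add_eq_cj(2)[of "rfl (b, c)" "rfl (a, b)", unfolded eqs] by (rule conjI)
qed

lemma dual_rels_rfl:
  assumes "distinct (map abs xs)" "0 \<notin> set xs"
  shows "dual_rels rfl xs"
  unfolding dual_rels_def
proof (intro conjI allI impI)
  have d: "distinct (map abs ys)" "0 \<notin> set ys" if "subseq ys xs" for ys
  proof -
    from that obtain N where "ys = nths xs N" by (auto simp: subseq_conv_nths)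
    then show "distinct (map abs ys)" "0 \<notin> set ys"
      using assms distinct_nthsI[of "map abs xs" N] set_nths_subset[of xs N] by (auto simp: nths_map)
  qed
  show "triangle rfl a b c" if "subseq [a, b, c] xs" for a b c
    using d[OF that] by (intro triangle_rfl) simp_all
  show "noncrossing rfl a b c d" if "subseq [a, b, c, d] xs" for a b c d
    unfolding noncrossing_def using d[OF that] by (intro conjI commute_rfl; simp; metis)
qed

lemma app_cyc_rfl_other: "\<bar>x\<bar> \<notin> abs ` set xs \<Longrightarrow> app (cyc rfl xs) x = x"
proof (induction xs rule: cycle_word.induct)
  case (1 a b xs)
  then show ?case by (simp add: app_rfl_other)
qed auto

lemma app_cyc_rfl:
  assumes "distinct (map abs xs)" "0 \<notin> set xs"
  shows app_cyc_rfl_nth: "Suc i < length xs \<Longrightarrow> app (cyc rfl xs) (xs ! i) = xs ! Suc i"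
    and app_cyc_rfl_last: "xs \<noteq> [] \<Longrightarrow> app (cyc rfl xs) (last xs) = hd xs"
proof -
  have "(\<forall>i. Suc i < length xs \<longrightarrow> app (cyc rfl xs) (xs ! i) = xs ! Suc i) \<and>
    (xs \<noteq> [] \<longrightarrow> app (cyc rfl xs) (last xs) = hd xs)"
    using assms
  proof (induction xs rule: cycle_word.induct)
    case (1 a b xs)
    have IH: "\<And>i. i < length xs \<Longrightarrow> app (cyc rfl (b # xs)) ((b # xs) ! i) = xs ! i"
      "app (cyc rfl (b # xs)) (last (b # xs)) = b"
      using 1 by simp_all
    have ab: "a \<noteq> 0" "b \<noteq> 0" "\<bar>a\<bar> \<noteq> \<bar>b\<bar>" using 1(2,3) by simp_all
    have xs: "\<bar>xs ! i\<bar> \<noteq> \<bar>a\<bar>" "\<bar>xs ! i\<bar> \<noteq> \<bar>b\<bar>" if "i < length xs" for i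
      using 1(2) imageI[OF nth_mem[OF that], of abs] by (simp_all, metis+)
    show ?case
    proof (intro conjI allI impI)
      fix i assume i: "Suc i < length (a # b # xs)"
      show "app (cyc rfl (a # b # xs)) ((a # b # xs) ! i) = (a # b # xs) ! Suc i"
      proof (cases i)
        case 0
        have "app (cyc rfl (b # xs)) a = a"
          using 1(2) by (intro app_cyc_rfl_other) simp
        then show ?thesis using 0 ab by (simp add: app_rfl)
      next
        case (Suc j)
        then show ?thesis using IH(1)[of j] xs[of j] i by (simp add: app_rfl_other)
      qed
    next
      show "app (cyc rfl (a # b # xs)) (last (a # b # xs)) = hd (a # b # xs)"
        using IH(2) ab by (simp add: app_rfl)
    qed
  qed simp_all
  then show "Suc i < length xs \<Longrightarrow> app (cyc rfl xs) (xs ! i) = xs ! Suc i"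
    "xs \<noteq> [] \<Longrightarrow> app (cyc rfl xs) (last xs) = hd xs" by blast+
qed

section \<open>Counting invariant colourings\<close>

text \<open>Odd functions with values in \<open>\<int>/3\<close> stand in for vectors: the number of invariant ones plays the
  role of the dimension of the fixed space in Carter's lemma on reduced decompositions.\<close>

definition colourings :: "nat \<Rightarrow> (int \<Rightarrow> 3) set" where
  "colourings n = {f. (\<forall>x. f (- x) = - f x) \<and> (\<forall>x. \<bar>x\<bar> > int n \<longrightarrow> f x = 0)}"

definition fixed_colourings :: "nat \<Rightarrow> int perms \<Rightarrow> (int \<Rightarrow> 3) set" where
  "fixed_colourings n v = {f \<in> colourings n. \<forall>x. f (app v x) = f x}"

lemma three_neq [simp]: "(1::3) \<noteq> 0" "(1::3) \<noteq> - 1" "(- 1::3) \<noteq> 0" "(- 1 :: 3) \<noteq> 1" "(0::3) \<noteq> 1" "(0::3) \<noteq> - 1"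
  by simp_all

text \<open>This is where odd characteristic enters; modulo 2 an odd function would not have to
  vanish at 0.\<close>

lemma three_zero: "x = - x \<Longrightarrow> x = (0::3)"
proof -
  assume "x = - x"
  moreover have "x + x + x = (3::3) * x" by (simp add: algebra_simps)
  moreover have "(3::3) = 0" by simp
  ultimately show "x = 0" by (metis add.left_neutral add.right_inverse mult_zero_left)
qed

lemma colouring_0: "f \<in> colourings n \<Longrightarrow> f 0 = 0"
  unfolding colourings_def using three_zero[of "f 0"] by (auto dest: spec[of _ 0])

lemma colouring_eqI:
  assumes "f \<in> colourings n" "g \<in> colourings n" "\<And>x. 1 \<le> x \<Longrightarrow> x \<le> int n \<Longrightarrow> f x = g x"
  shows "f = g"
proof
  fix x :: int
  consider "\<bar>x\<bar> > int n" | "x = 0" | "1 \<le> x" "x \<le> int n" | "1 \<le> - x" "- x \<le> int n" by linarith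
  then show "f x = g x"
  proof cases
    case 4
    then have "f (- x) = g (- x)" using assms(3) by blast
    then show ?thesis using assms(1,2) by (simp add: colourings_def)
  next
    case 2
    then show ?thesis using assms(1,2)[THEN colouring_0] by simp
  qed (use assms in \<open>auto simp: colourings_def\<close>)
qed

lemma card_colourings: "finite (colourings n)" "card (colourings n) = 3 ^ n"
proof -
  let ?A = "{1..int n}"
  have "bij_betw (\<lambda>f. restrict f ?A) (colourings n) (?A \<rightarrow>\<^sub>E UNIV)"
    unfolding bij_betw_def
  proof
    show "inj_on (\<lambda>f. restrict f ?A) (colourings n)"
      by (rule inj_onI, rule colouring_eqI) (auto dest: fun_cong simp: restrict_def split: if_splits)
    show "(\<lambda>f. restrict f ?A) ` colourings n = ?A \<rightarrow>\<^sub>E UNIV"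
    proof
      show "?A \<rightarrow>\<^sub>E UNIV \<subseteq> (\<lambda>f. restrict f ?A) ` colourings n"
      proof
        fix g :: "int \<Rightarrow> 3" assume g: "g \<in> ?A \<rightarrow>\<^sub>E UNIV"
        let ?f = "\<lambda>x. if x \<in> ?A then g x else if - x \<in> ?A then - g (- x) else 0"
        have "?f \<in> colourings n" by (auto simp: colourings_def)
        moreover have "g = restrict ?f ?A" using g by (auto simp: fun_eq_iff PiE_def extensional_def)
        ultimately show "g \<in> (\<lambda>f. restrict f ?A) ` colourings n" by blast
      qed
    qed auto
  qed
  then show "finite (colourings n)" "card (colourings n) = 3 ^ n"
    by (auto simp: bij_betw_finite bij_betw_same_card card_PiE finite_PiE)
qed

text \<open>The fibres of \<open>f a - f b\<close> over the three possible values are empty or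
  translates of subsets of the zero fibre, so one linear condition costs at most a factor 3.\<close>

lemma card_colouring_constraint:
  fixes S :: "(int \<Rightarrow> 3) set"
  assumes fin: "finite S" and diff: "\<And>f g. f \<in> S \<Longrightarrow> g \<in> S \<Longrightarrow> (\<lambda>x. f x - g x) \<in> S"
  shows "card S \<le> 3 * card {f \<in> S. f a = f b}"
proof -
  let ?F = "\<lambda>v. {f \<in> S. f a - f b = v}"
  have "card (?F v) \<le> card (?F 0)" for v
  proof (cases "?F v = {}")
    case False
    then obtain g where g: "g \<in> ?F v" by blast
    show ?thesis
    proof (rule card_inj_on_le)
      show "inj_on (\<lambda>f x. f x - g x) (?F v)" by (auto simp: inj_on_def fun_eq_iff)
      show "(\<lambda>f x. f x - g x) ` ?F v \<subseteq> ?F 0" using g diff by (auto simp: algebra_simps)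
    qed (use fin in auto)
  next
    case True
    show ?thesis unfolding True by simp
  qed
  then have "(\<Sum>v\<in>UNIV. card (?F v)) \<le> (\<Sum>v\<in>(UNIV :: 3 set). card (?F 0))"
    by (intro sum_mono)
  moreover have "card S = (\<Sum>v\<in>UNIV. card (?F v))"
    by (subst card_UN_disjoint[symmetric]) (auto simp: fin intro!: arg_cong[where f = card])
  moreover have "?F 0 = {f \<in> S. f a = f b}" by auto
  ultimately show ?thesis by simp
qed

definition constrained_colourings :: "nat \<Rightarrow> (int \<times> int) list \<Rightarrow> (int \<Rightarrow> 3) set" where
  "constrained_colourings n ps = {f \<in> colourings n. \<forall>(a, b) \<in> set ps. f a = f b}"

lemma card_constrained_colourings: "3 ^ n \<le> 3 ^ length ps * card (constrained_colourings n ps)"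
proof (induction ps)
  case (Cons p ps)
  obtain a b where p: "p = (a, b)" by (cases p)
  have "card (constrained_colourings n ps)
      \<le> 3 * card {f \<in> constrained_colourings n ps. f a = f b}"
  proof (rule card_colouring_constraint)
    show "finite (constrained_colourings n ps)"
      by (rule finite_subset[OF _ card_colourings(1)[of n]]) (auto simp: constrained_colourings_def)
  qed (fastforce simp: constrained_colourings_def colourings_def)
  moreover have "{f \<in> constrained_colourings n ps. f a = f b} = constrained_colourings n (p # ps)"
    by (auto simp: constrained_colourings_def p)
  ultimately have "card (constrained_colourings n ps) \<le> 3 * card (constrained_colourings n (p # ps))"
    by simp
  then have "3 ^ length ps * card (constrained_colourings n ps)
      \<le> 3 ^ length ps * (3 * card (constrained_colourings n (p # ps)))"
    by (rule mult_le_mono2)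
  also have "\<dots> = 3 ^ length (p # ps) * card (constrained_colourings n (p # ps))"
    by simp
  finally show ?case using Cons by (rule order.trans[rotated])
qed (simp add: constrained_colourings_def card_colourings)

lemma constrained_subset_fixed:
  "constrained_colourings n ps \<subseteq> fixed_colourings n (sum_list (map rfl ps))"
proof (induction ps)
  case (Cons p ps)
  obtain a b where p: "p = (a, b)" by (cases p)
  show ?case
  proof
    fix f assume f: "f \<in> constrained_colourings n (p # ps)"
    then have "f \<in> constrained_colourings n ps"
      by (auto simp: constrained_colourings_def)
    with Cons have f': "f \<in> fixed_colourings n (sum_list (map rfl ps))" by blast
    have "f a = f b" "\<And>x. f (- x) = - f x"
      using f by (auto simp: constrained_colourings_def colourings_def p)
    then have "f (app (rfl p) x) = f x" for x
      by (auto simp: p app_rfl swap_pm_def)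
    then show "f \<in> fixed_colourings n (sum_list (map rfl (p # ps)))"
      using f' by (simp add: fixed_colourings_def)
  qed
qed (auto simp: constrained_colourings_def fixed_colourings_def)

lemma finite_fixed_colourings: "finite (fixed_colourings n v)"
  by (rule finite_subset[OF _ card_colourings(1)[of n]]) (auto simp: fixed_colourings_def)

lemma card_fixed_ge:
  "3 ^ n \<le> 3 ^ length ps * card (fixed_colourings n (sum_list (map rfl ps)))"
  using card_constrained_colourings[of n ps]
    card_mono[OF finite_fixed_colourings constrained_subset_fixed[of n ps]]
  by (meson le_trans mult_le_mono2)

text \<open>Carter's lemma in counting form. The colourings constrained by all pairs are invariant,
  and in a factorization this short they are at least as numerous as the invariant ones; hence the
  two sets coincide.\<close>

lemma fixed_colourings_constrained:
  assumes "3 ^ length ps * card (fixed_colourings n (sum_list (map rfl ps))) \<le> 3 ^ n"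
    and "f \<in> fixed_colourings n (sum_list (map rfl ps))" "(a, b) \<in> set ps"
  shows "f a = f b"
proof -
  have "(3::nat) ^ length ps * card (fixed_colourings n (sum_list (map rfl ps)))
      \<le> 3 ^ length ps * card (constrained_colourings n ps)"
    using assms(1) card_constrained_colourings[of n ps] by linarith
  then have "card (fixed_colourings n (sum_list (map rfl ps))) \<le> card (constrained_colourings n ps)"
    by simp
  from card_seteq[OF finite_fixed_colourings constrained_subset_fixed this]
  have "f \<in> constrained_colourings n ps" using assms(2) by simp
  with assms(3) show ?thesis by (auto simp: constrained_colourings_def)
qed

text \<open>An invariant colouring is constant along each list, so its values on the tails are
  redundant. \<open>R\<close> is what is left of the letters after deleting the tails.\<close>

lemma card_fixed_two_cycles:
  assumes d: "distinct (map abs (xs @ ys))" and "0 \<notin> set (xs @ ys)" "abs ` set (xs @ ys) \<subseteq> {1..int n}"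
  shows "card (fixed_colourings n (cyc rfl xs + cyc rfl ys)) \<le> 3 ^ (n - (length xs - 1) - (length ys - 1))"
proof -
  let ?F = "fixed_colourings n (cyc rfl xs + cyc rfl ys)"
  define R where "R = {1..int n} - abs ` set (tl xs) - abs ` set (tl ys)"
  have tls: "set (tl xs) \<subseteq> set xs" "set (tl ys) \<subseteq> set ys" using list.set_sel(2)[of xs] list.set_sel(2)[of ys] by fastforce+
  have step: "f (zs ! Suc i) = f (zs ! i)" if f: "f \<in> ?F" and zs: "zs = xs \<or> zs = ys" and i: "Suc i < length zs" for f zs i
  proof -
    have "app (cyc rfl xs + cyc rfl ys) (zs ! i) = zs ! Suc i"
    proof (cases "zs = xs")
      case True
      have "zs ! Suc i \<in> set xs" using True i by auto
      then have "\<bar>zs ! Suc i\<bar> \<notin> abs ` set ys" using d by auto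
      then show ?thesis using True i assms(1,2) by (simp add: app_cyc_rfl_nth app_cyc_rfl_other)
    next
      case False
      then have zs: "zs = ys" using zs by blast
      then have "zs ! i \<in> set ys" using i by auto
      then have "\<bar>zs ! i\<bar> \<notin> abs ` set xs" using d by fastforce
      then show ?thesis using zs i assms(1,2) by (simp add: app_cyc_rfl_nth app_cyc_rfl_other)
    qed
    then show ?thesis using f by (auto simp: fixed_colourings_def dest!: spec[of _ "zs ! i"])
  qed
  have const: "f z = f (hd zs)" if f: "f \<in> ?F" and zs: "zs = xs \<or> zs = ys" and z: "z \<in> set zs" for f zs z
  proof -
    obtain i where i: "i < length zs" "z = zs ! i" using z by (auto simp: in_set_conv_nth)
    have "f (zs ! i) = f (zs ! 0)" using i(1)
      by (induction i) (use step[OF f zs] in auto)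
    then show ?thesis using i by (cases zs) auto
  qed
  have inj: "inj_on (\<lambda>f. restrict f R) ?F"
  proof (rule inj_onI)
    fix f g assume fg: "f \<in> ?F" "g \<in> ?F" "restrict f R = restrict g R"
    have odd: "f \<in> colourings n" "g \<in> colourings n" "\<And>x. f (- x) = - f x" "\<And>x. g (- x) = - g x"
      using fg by (auto simp: fixed_colourings_def colourings_def)
    have R: "f x = g x" if "x \<in> R" for x using fun_cong[OF fg(3), of x] that by simp
    have hd: "f (hd zs) = g (hd zs)" if zs: "zs = xs \<or> zs = ys" "zs \<noteq> []" for zs
    proof -
      have mem: "hd zs \<in> set zs" using zs(2) by simp
      have dz: "distinct (map abs zs)" using d zs by auto
      have "\<bar>hd zs\<bar> \<notin> abs ` set (tl zs)"
        using dz zs(2) by (cases zs) auto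
      moreover have "\<bar>hd zs\<bar> \<notin> abs ` set ys" if "zs = xs" using d that mem by auto
      moreover have "\<bar>hd zs\<bar> \<notin> abs ` set xs" if "zs = ys" using d that mem by fastforce
      ultimately have "\<bar>hd zs\<bar> \<notin> abs ` set (tl xs)" "\<bar>hd zs\<bar> \<notin> abs ` set (tl ys)"
        using zs tls by blast+
      moreover have "\<bar>hd zs\<bar> \<in> abs ` set (xs @ ys)" using mem zs by auto
      then have "\<bar>hd zs\<bar> \<in> {1..int n}" using assms(3) by blast
      ultimately have "\<bar>hd zs\<bar> \<in> R" by (simp add: R_def)
      from R[OF this] show ?thesis using odd(3,4)[of "hd zs"] by (auto simp: abs_if split: if_splits)
    qed
    have mem: "f z = g z" if z: "z \<in> set xs \<union> set ys" for z
    proof -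
      obtain zs where zs: "zs = xs \<or> zs = ys" "z \<in> set zs" using z by blast
      then have "zs \<noteq> []" by auto
      then show ?thesis using const[OF fg(1) zs] const[OF fg(2) zs] hd[OF zs(1)] by simp
    qed
    show "f = g"
    proof (rule colouring_eqI[OF odd(1,2)])
      fix x assume x: "1 \<le> x" "x \<le> int n"
      show "f x = g x"
      proof (cases "x \<in> R")
        case False
        then obtain z where z: "z \<in> set xs \<union> set ys" "x = \<bar>z\<bar>"
          using x tls by (auto simp: R_def)
        then show ?thesis using mem[OF z(1)] odd(3,4)[of z] by (auto simp: abs_if)
      qed (rule R)
    qed
  qed
  have "card R = n - (length xs - 1) - (length ys - 1)"
  proof -
    have c: "card (abs ` set (tl zs)) = length zs - 1" if "distinct (map abs zs)" for zs :: "int list"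
      using distinct_card[OF distinct_tl[OF that]] by (simp add: map_tl flip: set_map)
    have "abs ` set (tl xs) \<subseteq> {1..int n}" "abs ` set (tl ys) \<subseteq> {1..int n} - abs ` set (tl xs)"
    proof -
      have aux: "A' \<subseteq> I \<and> B' \<subseteq> I - A'"
        if "A' \<subseteq> A" "B' \<subseteq> B" "A \<inter> B = {}" "A \<subseteq> I" "B \<subseteq> I" for A A' B B' I :: "int set"
        using that by blast
      have "abs ` set xs \<inter> abs ` set ys = {}" using d by simp
      moreover have "abs ` set xs \<subseteq> {1..int n}" "abs ` set ys \<subseteq> {1..int n}"
        using assms(3) by (simp_all add: image_Un)
      ultimately show "abs ` set (tl xs) \<subseteq> {1..int n}" "abs ` set (tl ys) \<subseteq> {1..int n} - abs ` set (tl xs)"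
        using aux[OF image_mono[OF tls(1), of abs] image_mono[OF tls(2), of abs]] by simp_all
    qed
    then have "card R = card {1..int n} - card (abs ` set (tl xs)) - card (abs ` set (tl ys))"
      using card_Diff_subset[of "abs ` set (tl ys)" "{1..int n} - abs ` set (tl xs)"]
        card_Diff_subset[of "abs ` set (tl xs)" "{1..int n}"] by (simp add: R_def)
    then show ?thesis using d by (simp add: c)
  qed
  moreover have fin: "finite R" by (simp add: R_def)
  moreover have "card ?F \<le> card (R \<rightarrow>\<^sub>E (UNIV :: 3 set))"
    by (rule card_inj_on_le[OF inj]) (use fin in \<open>auto intro!: finite_PiE\<close>)
  ultimately show ?thesis by (simp add: card_PiE)
qed

definition letters :: "nat \<Rightarrow> int list \<Rightarrow> bool" where
  "letters n xs \<longleftrightarrow> distinct (map abs xs) \<and> 0 \<notin> set xs \<and> abs ` set xs \<subseteq> {1..int n}"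

lemma letters_append:
  "letters n (xs @ ys) \<longleftrightarrow> letters n xs \<and> letters n ys \<and> abs ` set xs \<inter> abs ` set ys = {}"
  by (auto simp: letters_def)

lemma length_letters: "letters n xs \<Longrightarrow> length xs \<le> n"
  using card_mono[of "{1..int n}" "abs ` set xs"] distinct_card[of "map abs xs"]
  by (simp add: letters_def)

lemma card_fixed_cycles:
  "letters n (xs @ ys) \<Longrightarrow>
    card (fixed_colourings n (cyc rfl xs + cyc rfl ys)) \<le> 3 ^ (n - (length xs - 1) - (length ys - 1))"
  by (rule card_fixed_two_cycles) (simp_all add: letters_def)

text \<open>A product of few reflections has many invariant colourings, whereas a long cycle has
  few.\<close>

lemma length_cycle_factorization:
  assumes "letters n xs" "sum_list (map rfl ps) = cyc rfl xs"
  shows "length xs - 1 \<le> length ps"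
proof -
  have "(3::nat) ^ n \<le> 3 ^ length ps * card (fixed_colourings n (cyc rfl xs + cyc rfl []))"
    using card_fixed_ge[of n ps] assms(2) by simp
  also have "\<dots> \<le> 3 ^ length ps * 3 ^ (n - (length xs - 1))"
    using card_fixed_cycles[of n xs "[]"] assms(1) by (intro mult_le_mono2) simp
  also have "\<dots> = 3 ^ (length ps + (n - (length xs - 1)))"
    by (simp add: power_add)
  finally have "n \<le> length ps + (n - (length xs - 1))"
    by (simp add: power_increasing_iff)
  then show ?thesis using length_letters[OF assms(1)] by simp
qed

definition indicator_colouring :: "int set \<Rightarrow> int \<Rightarrow> 3" where
  "indicator_colouring Z x = (if x \<in> Z then 1 else if - x \<in> Z then - 1 else 0)"

lemma indicator_colouring:
  assumes "\<And>x. x \<in> Z \<Longrightarrow> - x \<notin> Z" "abs ` Z \<subseteq> {1..int n}" "\<And>x. x \<in> Z \<Longrightarrow> app v x \<in> Z"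
    and v: "signed n v" and "finite Z"
  shows "indicator_colouring Z \<in> fixed_colourings n v"
proof -
  have "app v ` Z = Z"
    using assms(3,5) by (intro endo_inj_surj) (auto simp: inj_on_def)
  then have mem: "app v x \<in> Z \<longleftrightarrow> x \<in> Z" for x
    using inj_image_mem_iff[of "app v" x Z] by (simp add: inj_def)
  have "indicator_colouring Z (app v x) = indicator_colouring Z x" for x
    using mem[of x] mem[of "- x"] by (simp add: indicator_colouring_def signed_app_uminus[OF v])
  moreover have "indicator_colouring Z \<in> colourings n"
    using assms(1,2) by (force simp: colourings_def indicator_colouring_def)
  ultimately show ?thesis by (simp add: fixed_colourings_def)
qed

lemma cyc_rfl_mem:
  assumes "letters n xs" "x \<in> set xs"
  shows "app (cyc rfl xs) x \<in> set xs"
proof -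
  obtain i where i: "i < length xs" "x = xs ! i"
    using assms(2) by (auto simp: in_set_conv_nth)
  show ?thesis
  proof (cases "Suc i < length xs")
    case True
    then show ?thesis using i assms(1) by (simp add: app_cyc_rfl_nth letters_def)
  next
    case False
    with i have "length xs = Suc i" by simp
    moreover from this have ne: "xs \<noteq> []" by auto
    ultimately have "x = last xs" using i(2) by (simp add: last_conv_nth)
    with ne show ?thesis using assms(1) by (simp add: app_cyc_rfl_last letters_def)
  qed
qed

text \<open>The factorization is as short as the count of colourings permits, so every invariant
  colouring agrees on the two entries of each pair. Testing with the indicator of one list puts both
  entries into that list, up to a common sign; testing with the indicator of a single letter
  excludes letters outside both lists.\<close>

lemma cycle_factorization_letters:
  assumes lt: "letters n (xs @ ys)"
    and ps: "set ps \<subseteq> refl_pairs n" "sum_list (map rfl ps) = cyc rfl xs + cyc rfl ys"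
    and len: "length ps = (length xs - 1) + (length ys - 1)" and ab: "(a, b) \<in> set ps"
  shows "\<exists>zs\<in>{xs, ys}. (a \<in> set zs \<and> b \<in> set zs) \<or> (- a \<in> set zs \<and> - b \<in> set zs)"
proof -
  have "(3::nat) ^ length ps * card (fixed_colourings n (sum_list (map rfl ps)))
      \<le> 3 ^ length ps * 3 ^ (n - (length xs - 1) - (length ys - 1))"
    using card_fixed_cycles[OF lt] ps(2) by (intro mult_le_mono2) simp
  also have "\<dots> = 3 ^ n"
    using length_letters[OF lt] len by (simp flip: power_add)
  finally have eq: "f a = f b" if "f \<in> fixed_colourings n (cyc rfl xs + cyc rfl ys)" for f
    using fixed_colourings_constrained[of ps n f a b] that ps(2) ab by simp
  have v: "signed n (cyc rfl xs + cyc rfl ys)"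
    using signed_sum_rfl[OF ps(1)] ps(2) by simp
  have ref: "a \<noteq> 0" "\<bar>a\<bar> \<le> int n" "\<bar>a\<bar> \<noteq> \<bar>b\<bar>"
    using ps(1) ab by (auto simp: refl_pairs_def)
  have L: "letters n xs" "letters n ys" "abs ` set xs \<inter> abs ` set ys = {}"
    using lt by (simp_all add: letters_append)
  have neg: "- x \<notin> set zs" if "x \<in> set zs" "letters n zs" for x zs
  proof
    assume "- x \<in> set zs"
    then have "x = - x"
      using that inj_onD[of abs "set zs" x "- x"] by (simp add: letters_def distinct_map)
    then have "x = 0" by simp
    then show False using that by (simp add: letters_def)
  qed
  have fx: "app (cyc rfl ys) x = x" if "x \<in> set xs" for x
    using that L(3) by (intro app_cyc_rfl_other) auto
  have fy: "app (cyc rfl xs) x = x" if "x \<in> set ys" for x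
    using that L(3) by (intro app_cyc_rfl_other) auto
  show ?thesis
  proof (cases "\<bar>a\<bar> \<in> abs ` set (xs @ ys)")
    case False
    have "indicator_colouring {a} \<in> fixed_colourings n (cyc rfl xs + cyc rfl ys)"
      using ref False by (intro indicator_colouring v) (auto simp: app_cyc_rfl_other image_Un)
    from eq[OF this] ref have False
      by (cases "b = a"; cases "b = - a") (auto simp: indicator_colouring_def)
    then show ?thesis ..
  next
    case True
    then obtain z where "z \<in> set (xs @ ys)" "\<bar>a\<bar> = \<bar>z\<bar>" by blast
    then have "a \<in> set (xs @ ys) \<or> - a \<in> set (xs @ ys)"
      by (metis abs_eq_iff minus_minus)
    then obtain zs where zs: "zs = xs \<or> zs = ys" "a \<in> set zs \<or> - a \<in> set zs"
      by auto
    have lz: "letters n zs" using zs(1) L by blast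
    have "indicator_colouring (set zs) \<in> fixed_colourings n (cyc rfl xs + cyc rfl ys)"
    proof (rule indicator_colouring)
      show "app (cyc rfl xs + cyc rfl ys) x \<in> set zs" if "x \<in> set zs" for x
        using that zs(1) cyc_rfl_mem[OF lz that] cyc_rfl_mem[OF L(2)] fx fy by auto
    qed (use v lz neg in \<open>auto simp: letters_def\<close>)
    from eq[OF this] have "indicator_colouring (set zs) a = indicator_colouring (set zs) b" .
    with zs(2) neg[OF _ lz, of a] neg[OF _ lz, of "- a"]
    have "(a \<in> set zs \<and> b \<in> set zs) \<or> (- a \<in> set zs \<and> - b \<in> set zs)"
      by (cases "a \<in> set zs"; cases "b \<in> set zs"; cases "- b \<in> set zs") (simp_all add: indicator_colouring_def)
    then show ?thesis using zs(1) by blast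
  qed
qed

section \<open>Factorizations of a cycle\<close>

text \<open>The pairs \<open>(a, b)\<close>, \<open>(b, a)\<close>, \<open>(- a, - b)\<close> and
  \<open>(- b, - a)\<close> name one reflection, and the values must not distinguish them.\<close>

locale even_pairs = symmetric_pairs \<psi> for \<psi> :: "int \<times> int \<Rightarrow> 'g::group_add" +
  assumes pair_uminus: "\<psi> (- a, - b) = \<psi> (a, b)"

interpretation rfl: even_pairs rfl
  by unfold_locales (rule rfl_uminus)

lemma sum_list_partition_commute:
  fixes \<psi> :: "'a \<Rightarrow> 'g::group_add"
  assumes "\<And>x y. x \<in> set xs \<Longrightarrow> y \<in> set xs \<Longrightarrow> P x \<Longrightarrow> \<not> P y \<Longrightarrow> commute (\<psi> y) (\<psi> x)"
  shows "sum_list (map \<psi> xs) = sum_list (map \<psi> (filter P xs)) + sum_list (map \<psi> (filter (\<lambda>x. \<not> P x) xs))"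
  using assms
proof (induction xs)
  case (Cons a xs)
  show ?case
  proof (cases "P a")
    case True
    then show ?thesis using Cons by (simp add: add.assoc)
  next
    case False
    have "commute (\<psi> a) (sum_list (map \<psi> (filter P xs)))"
      by (rule commute_sum_list) (use Cons.prems False in auto)
    then show ?thesis using Cons False by (simp flip: add.assoc)
  qed
qed simp

lemma letters_imp_dual_rels: "letters n xs \<Longrightarrow> dual_rels rfl xs"
  by (rule dual_rels_rfl) (auto simp: letters_def)

lemma letters_rotate: "letters n (xs @ ys) \<longleftrightarrow> letters n (ys @ xs)"
  by (auto simp: letters_append)

lemma subseq_pair_cases:
  assumes "a \<in> set xs" "b \<in> set xs" "a \<noteq> b"
  shows "subseq [a, b] xs \<or> subseq [b, a] xs"
  using assms by (induction xs) (auto simp: subseq_singleton_left)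

lemma app_sum_rfl_other:
  "(\<And>a b. (a, b) \<in> set ps \<Longrightarrow> \<bar>x\<bar> \<noteq> \<bar>a\<bar> \<and> \<bar>x\<bar> \<noteq> \<bar>b\<bar>) \<Longrightarrow> app (sum_list (map rfl ps)) x = x"
proof (induction ps)
  case (Cons p ps)
  obtain a b where p: "p = (a, b)" by (cases p)
  have "\<bar>x\<bar> \<noteq> \<bar>a\<bar> \<and> \<bar>x\<bar> \<noteq> \<bar>b\<bar>" using Cons.prems[of a b] by (simp add: p)
  moreover have "app (sum_list (map rfl ps)) x = x"
    by (rule Cons.IH) (rule Cons.prems, simp)
  ultimately show ?case by (simp add: p app_rfl_other)
qed simp

lemma set_cycle_word_mem: "(a, b) \<in> set (cycle_word xs) \<Longrightarrow> a \<in> set xs \<and> b \<in> set xs"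
  by (induction xs rule: cycle_word.induct) auto

lemma abs_app_rfl_mem: "\<bar>a\<bar> \<in> A \<Longrightarrow> \<bar>b\<bar> \<in> A \<Longrightarrow> \<bar>x\<bar> \<in> A \<Longrightarrow> \<bar>app (rfl (a, b)) x\<bar> \<in> A"
  by (auto simp: app_rfl swap_pm_def)

lemma abs_app_sum_rfl_mem:
  "(\<And>a b. (a, b) \<in> set ps \<Longrightarrow> \<bar>a\<bar> \<in> A \<and> \<bar>b\<bar> \<in> A) \<Longrightarrow> \<bar>x\<bar> \<in> A \<Longrightarrow> \<bar>app (sum_list (map rfl ps)) x\<bar> \<in> A"
proof (induction ps arbitrary: x)
  case (Cons p ps)
  then show ?case by (cases p) (auto intro!: Cons.IH abs_app_rfl_mem)
qed simp

context even_pairs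
begin

lemma pair_commute_of_split:
  assumes "dual_rels \<psi> (xs @ ys)" "a \<in> set xs" "b \<in> set xs" "a \<noteq> b" "c \<in> set ys" "d \<in> set ys" "c \<noteq> d"
  shows "commute (\<psi> (a, b)) (\<psi> (c, d))"
proof -
  have "commute (\<psi> (a', b')) (\<psi> (c', d'))" if "subseq [a', b'] xs" "subseq [c', d'] ys" for a' b' c' d'
  proof -
    have "subseq ([a', b'] @ [c', d']) (xs @ ys)" using that by (rule list_emb_append_mono)
    then have "noncrossing \<psi> a' b' c' d'" using assms(1) by (simp add: dual_rels_def)
    then show ?thesis by (simp add: noncrossing_def)
  qed
  then show ?thesis
    using subseq_pair_cases[OF assms(2-4)] subseq_pair_cases[OF assms(5-7)] pair_sym[of a b] pair_sym[of c d]
    by metis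
qed

text \<open>The first reflection cuts the cycle into two; the remaining ones split accordingly.\<close>

theorem cycle_factorization_sum:
  assumes "letters n xs" "dual_rels \<psi> xs" "set ps \<subseteq> refl_pairs n"
    and "sum_list (map rfl ps) = cyc rfl xs" "length ps = length xs - 1"
  shows "sum_list (map \<psi> ps) = cyc \<psi> xs"
  using assms
proof (induction "length xs" arbitrary: xs ps rule: less_induct)
  case less
  show ?case
  proof (cases ps)
    case Nil
    then have "length xs \<le> 1" using less.prems(5) by simp
    then have "xs = [] \<or> (\<exists>x. xs = [x])" by (cases xs) auto
    with Nil show ?thesis by auto
  next
    case (Cons p ps')
    obtain a b where p: "p = (a, b)" by (cases p)
    have "\<exists>zs\<in>{xs, []}. (a \<in> set zs \<and> b \<in> set zs) \<or> (- a \<in> set zs \<and> - b \<in> set zs)"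
      using less.prems Cons p by (intro cycle_factorization_letters[of n xs "[]" ps]) simp_all
    moreover have "a \<noteq> b" using less.prems(3) Cons p by (auto simp: refl_pairs_def)
    ultimately obtain c d where cd: "c \<in> set xs" "d \<in> set xs" "c \<noteq> d" "\<psi> p = \<psi> (c, d)" "rfl p = rfl (c, d)"
      using pair_uminus[of a b] rfl_uminus[of a b] p by (metis empty_iff empty_set insertE minus_equation_iff)
    have "\<exists>us c' vs d' ws. xs = us @ [c'] @ vs @ [d'] @ ws \<and> {c', d'} = {c, d}"
    proof -
      have "\<exists>us vs ws. xs = us @ [c'] @ vs @ [d'] @ ws" if sub: "subseq [c', d'] xs" for c' d'
      proof -
        obtain us r where "xs = us @ c' # r" "subseq [d'] r"
          using list_emb_ConsD[OF sub] by blast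
        then show ?thesis by (auto simp: subseq_singleton_left dest!: split_list)
      qed
      with subseq_pair_cases[OF cd(1-3)] show ?thesis by blast
    qed
    then obtain us c' vs d' ws where split: "xs = (us @ [c'] @ vs @ [d']) @ ws" "{c', d'} = {c, d}"
      by auto
    \<comment> \<open>Rotated so that the two blocks end in the letters of the first reflection,
      which is the shape required by \<open>cyc_split\<close>.\<close>
    define X where "X = ws @ us @ [c']"
    define Y where "Y = vs @ [d']"
    have ne: "X \<noteq> []" "Y \<noteq> []" and last: "last X = c'" "last Y = d'" by (simp_all add: X_def Y_def)
    have XY: "letters n (X @ Y)"
      using less.prems(1) letters_rotate[of n "us @ [c'] @ vs @ [d']" ws] unfolding split X_def Y_def by simp
    have dXY: "dual_rels \<psi> (X @ Y)"
      using less.prems(2) dual_rels_rotate[of "us @ [c'] @ vs @ [d']" ws] unfolding split X_def Y_def by simp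
    have cyc_eq: "cyc \<psi> xs = cyc \<psi> (X @ Y)"
      using less.prems(2) cyc_rotate[of "us @ [c'] @ vs @ [d']" ws] unfolding split X_def Y_def by simp
    have rcyc_eq: "cyc rfl xs = cyc rfl (X @ Y)"
      using letters_imp_dual_rels[OF less.prems(1)] rfl.cyc_rotate[of "us @ [c'] @ vs @ [d']" ws]
      unfolding split X_def Y_def by simp
    have "(c', d') = (c, d) \<or> (c', d') = (d, c)" using split(2) by (auto simp: doubleton_eq_iff)
    then have p': "\<psi> p = \<psi> (c', d')" "rfl p = rfl (c', d')"
      using cd(4,5) pair_sym[of c d] rfl_sym[of c d] by auto
    have split_rfl: "cyc rfl (X @ Y) = rfl p + cyc rfl X + cyc rfl Y"
      using rfl.cyc_split[OF letters_imp_dual_rels[OF XY] ne] by (simp add: last p')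
    have split_\<psi>: "cyc \<psi> (X @ Y) = \<psi> p + cyc \<psi> X + cyc \<psi> Y"
      using cyc_split[OF dXY ne] by (simp add: last p')
    have ps': "set ps' \<subseteq> refl_pairs n" using less.prems(3) Cons by simp
    have sum': "sum_list (map rfl ps') = cyc rfl X + cyc rfl Y"
    proof -
      have "rfl p + sum_list (map rfl ps') = rfl p + (cyc rfl X + cyc rfl Y)"
        using less.prems(4) split_rfl rcyc_eq Cons by (simp add: add.assoc)
      then show ?thesis by simp
    qed
    have len_xs: "length xs = length X + length Y" by (simp add: split X_def Y_def)
    have posXY: "length X > 0" "length Y > 0" using ne by auto
    have len': "length ps' = (length X - 1) + (length Y - 1)"
      using less.prems(5) Cons len_xs posXY by (simp del: length_greater_0_conv)
    note mem = cycle_factorization_letters[OF XY ps' sum' len']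
    have LX: "letters n X" "letters n Y" and disj: "abs ` set X \<inter> abs ` set Y = {}"
      using XY by (simp_all add: letters_append)
    define P where "P = (\<lambda>(a :: int, b :: int). \<bar>a\<bar> \<in> abs ` set X)"
    define ps1 where "ps1 = filter P ps'"
    define ps2 where "ps2 = filter (\<lambda>q. \<not> P q) ps'"
    have X_pair: "(a \<in> set X \<and> b \<in> set X) \<or> (- a \<in> set X \<and> - b \<in> set X)" if "(a, b) \<in> set ps1" for a b
    proof -
      have "(a, b) \<in> set ps'" "\<bar>a\<bar> \<in> abs ` set X" using that by (auto simp: ps1_def P_def)
      with mem[of a b] have "\<bar>a\<bar> \<notin> abs ` set Y" using disj by blast
      then have "a \<notin> set Y" "- a \<notin> set Y" using imageI[of a "set Y" abs] imageI[of "- a" "set Y" abs] by auto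
      with mem[of a b] \<open>(a, b) \<in> set ps'\<close> show ?thesis by blast
    qed
    have Y_pair: "(a \<in> set Y \<and> b \<in> set Y) \<or> (- a \<in> set Y \<and> - b \<in> set Y)" if "(a, b) \<in> set ps2" for a b
    proof -
      have "(a, b) \<in> set ps'" "\<bar>a\<bar> \<notin> abs ` set X" using that by (auto simp: ps2_def P_def)
      then have "a \<notin> set X" "- a \<notin> set X" using imageI[of a "set X" abs] imageI[of "- a" "set X" abs] by auto
      with mem[of a b] \<open>(a, b) \<in> set ps'\<close> show ?thesis by blast
    qed
    \<comment> \<open>Stated for an arbitrary assignment, since the same separation is applied to
      \<open>rfl\<close> and to \<open>\<psi>\<close>.\<close>
    have part: "sum_list (map \<phi> ps') = sum_list (map \<phi> ps1) + sum_list (map \<phi> ps2)"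
      if \<phi>: "even_pairs \<phi>" and d: "dual_rels \<phi> (X @ Y)" for \<phi> :: "int \<times> int \<Rightarrow> 'h::group_add"
      unfolding ps1_def ps2_def
    proof (rule sum_list_partition_commute)
      fix x y assume xy: "x \<in> set ps'" "y \<in> set ps'" "P x" "\<not> P y"
      interpret \<phi>: even_pairs \<phi> by (rule \<phi>)
      obtain a b c d where eq: "x = (a, b)" "y = (c, d)" by (cases x, cases y)
      have ne: "a \<noteq> b" "c \<noteq> d" using ps' xy eq by (auto simp: refl_pairs_def)
      have "(a, b) \<in> set ps1" "(c, d) \<in> set ps2" using xy eq by (simp_all add: ps1_def ps2_def)
      from X_pair[OF this(1)] Y_pair[OF this(2)] show "commute (\<phi> y) (\<phi> x)"
        using \<phi>.pair_commute_of_split[OF d, of a b c d] \<phi>.pair_commute_of_split[OF d, of a b "- c" "- d"]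
          \<phi>.pair_commute_of_split[OF d, of "- a" "- b" c d] \<phi>.pair_commute_of_split[OF d, of "- a" "- b" "- c" "- d"]
          ne \<phi>.pair_uminus[of a b] \<phi>.pair_uminus[of c d] by (simp add: eq) metis
    qed
    have abs1: "\<bar>a\<bar> \<in> abs ` set X \<and> \<bar>b\<bar> \<in> abs ` set X" if "(a, b) \<in> set ps1" for a b
      using X_pair[OF that] imageI[of _ "set X" abs] by (metis abs_minus_cancel)
    have abs2: "\<bar>a\<bar> \<in> abs ` set Y \<and> \<bar>b\<bar> \<in> abs ` set Y" if "(a, b) \<in> set ps2" for a b
      using Y_pair[OF that] imageI[of _ "set Y" abs] by (metis abs_minus_cancel)
    have part_rfl: "sum_list (map rfl ps1) + sum_list (map rfl ps2) = cyc rfl X + cyc rfl Y"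
      using part[OF rfl.even_pairs_axioms letters_imp_dual_rels[OF XY]] sum' by simp
    \<comment> \<open>The two partial products move disjoint sets of letters, and so do the two
      cycles; equality of the totals can be read off on each set separately.\<close>
    have sum1: "sum_list (map rfl ps1) = cyc rfl X"
    proof (rule perms_eqI)
      fix x
      show "app (sum_list (map rfl ps1)) x = app (cyc rfl X) x"
      proof (cases "\<bar>x\<bar> \<in> abs ` set X")
        case True
        have "\<bar>app (sum_list (map rfl ps1)) x\<bar> \<notin> abs ` set Y"
          using abs_app_sum_rfl_mem[OF abs1 True] disj by blast
        then have 1: "app (sum_list (map rfl ps2)) (app (sum_list (map rfl ps1)) x) = app (sum_list (map rfl ps1)) x"
          using abs2 by (intro app_sum_rfl_other) metis
        have "\<bar>app (cyc rfl X) x\<bar> \<in> abs ` set X"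
          unfolding cyc_def by (rule abs_app_sum_rfl_mem[OF _ True]) (auto dest!: set_cycle_word_mem)
        then have "app (cyc rfl Y) (app (cyc rfl X) x) = app (cyc rfl X) x"
          using disj by (intro app_cyc_rfl_other) blast
        with 1 arg_cong[OF part_rfl, of "\<lambda>f. app f x"] show ?thesis by simp
      next
        case False
        have "app (sum_list (map rfl ps1)) x = x"
          using abs1 False by (intro app_sum_rfl_other) metis
        then show ?thesis using app_cyc_rfl_other[OF False] by simp
      qed
    qed
    then have sum2: "sum_list (map rfl ps2) = cyc rfl Y" using part_rfl by simp
    \<comment> \<open>Neither cycle has a factorization shorter than its number of letters minus
      one, and the total leaves no slack, so both parts are minimal again.\<close>
    have "length ps' = length ps1 + length ps2"
      unfolding ps1_def ps2_def by (rule sum_length_filter_compl[symmetric])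
    with length_cycle_factorization[OF LX(1) sum1] length_cycle_factorization[OF LX(2) sum2] len'
    have len12: "length ps1 = length X - 1" "length ps2 = length Y - 1" by auto
    have sub: "set ps1 \<subseteq> refl_pairs n" "set ps2 \<subseteq> refl_pairs n"
      using ps' by (auto simp: ps1_def ps2_def)
    have "sum_list (map \<psi> ps1) = cyc \<psi> X" "sum_list (map \<psi> ps2) = cyc \<psi> Y"
      using less.hyps[of X ps1] less.hyps[of Y ps2] len_xs posXY LX sub sum1 sum2 len12
        dual_rels_subseq[OF dXY, of X] dual_rels_subseq[OF dXY, of Y] by auto
    then show ?thesis
      using part[OF even_pairs_axioms dXY] split_\<psi> cyc_eq Cons by (simp add: add.assoc)
  qed
qed

end

section \<open>Factorizations of a product of two negative cycles\<close>

text \<open>The two negative cycles of \<open>w\<close> are indexed by all integers, antiperiodically, so that \<open>w\<close> is the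
  shift by one on both.\<close>

locale two_cycles =
  fixes n m l :: nat and p q :: "int \<Rightarrow> int" and w :: "int perms"
  assumes n_eq: "n = m + l" and m_pos: "0 < m" and l_pos: "0 < l"
    and p_shift: "p (i + int m) = - p i" and q_shift: "q (j + int l) = - q j"
    and letters_window: "letters n (map (\<lambda>k. q (j - int l + 1 + int k)) [0..<l] @ map (\<lambda>k. p (i + int k)) [0..<m])"
    and covering: "x \<noteq> 0 \<Longrightarrow> \<bar>x\<bar> \<le> int n \<Longrightarrow> x \<in> range p \<union> range q"
    and signed_w: "signed n w" and w_p: "app w (p i) = p (i + 1)" and w_q: "app w (q j) = q (j + 1)"
begin

text \<open>One antiperiod of \<open>q\<close> ending in \<open>q j\<close>, followed by one
  antiperiod of \<open>p\<close> starting in \<open>p i\<close>. Splitting \<open>(p i, q j)\<close>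
  off \<open>w\<close> leaves the cycle through \<open>window (i + 1) j\<close>.\<close>

definition window :: "int \<Rightarrow> int \<Rightarrow> int list" where
  "window i j = map (\<lambda>k. q (j - int l + 1 + int k)) [0..<l] @ map (\<lambda>k. p (i + int k)) [0..<m]"

lemma length_window [simp]: "length (window i j) = n"
  by (simp add: window_def n_eq)

lemma nth_window_q: "k < l \<Longrightarrow> window i j ! k = q (j - int l + 1 + int k)"
  by (simp add: window_def nth_append)

lemma nth_window_p: "k < m \<Longrightarrow> window i j ! (l + k) = p (i + int k)"
  by (simp add: window_def nth_append)

text \<open>The three windows share the letters \<open>Q\<close> and \<open>P\<close> and differ in
  the place and sign of \<open>p i\<close> and \<open>q j\<close>. Their relations together describe
  conjugation by \<open>(p i, q j)\<close>.\<close>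

lemma window_forms:
  obtains Q P where "window (i + 1) j = Q @ [q j] @ P @ [- p i]"
    "window (i + 1) (j - 1) = [- q j] @ Q @ P @ [- p i]"
    "window i j = Q @ [q j, p i] @ P"
proof -
  define Q where "Q = map (\<lambda>k. q (j - int l + 1 + int k)) [0..<l - 1]"
  define P where "P = map (\<lambda>k. p (i + 1 + int k)) [0..<m - 1]"
  obtain l' m' where l': "l = Suc l'" and m': "m = Suc m'"
    using l_pos m_pos gr0_implies_Suc by blast
  have q: "q (j - int l) = - q j" using q_shift[of "j - int l"] by simp
  have "p (i + 1 + int m') = - p i" using p_shift[of i] by (simp add: m' ac_simps)
  then have 1: "window (i + 1) j = Q @ [q j] @ P @ [- p i]"
    unfolding window_def by (simp add: l' m' Q_def P_def)
  have 2: "map (\<lambda>k. q (j - 1 - int l + 1 + int k)) [0..<l] = [- q j] @ Q"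
    using q unfolding l' upt_conv_Cons[OF zero_less_Suc]
    by (simp add: Q_def l' map_Suc_upt[symmetric] algebra_simps del: upt_Suc)
  have 3: "map (\<lambda>k. p (i + int k)) [0..<m] = [p i] @ P"
    unfolding m' upt_conv_Cons[OF zero_less_Suc]
    by (simp add: P_def m' map_Suc_upt[symmetric] algebra_simps del: upt_Suc)
  have "window (i + 1) (j - 1) = [- q j] @ Q @ P @ [- p i]"
    using 1 2 unfolding window_def by (simp add: l' Q_def)
  moreover have "window i j = Q @ [q j, p i] @ P"
    using 3 unfolding window_def by (simp add: l' Q_def)
  ultimately show thesis using that 1 by blast
qed

lemma letters_window': "letters n (window i j)"
  unfolding window_def by (rule letters_window)

lemma shift_multiple:
  fixes f :: "int \<Rightarrow> int"
  assumes "\<And>i. f (i + c) = - f i"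
  shows "f (i + c * z) = f i \<or> f (i + c * z) = - f i"
proof (induction z rule: int_induct[where k = 0])
  case (step1 z)
  then show ?case using assms[of "i + c * z"] by (auto simp: algebra_simps)
next
  case (step2 z)
  then show ?case using assms[of "i + c * (z - 1)"] by (auto simp: algebra_simps)
qed simp

lemma p_representative: "\<exists>r<m. p k = p (i + int r) \<or> p k = - p (i + int r)"
proof -
  define r where "r = nat ((k - i) mod int m)"
  have r: "int r = (k - i) mod int m" using m_pos by (simp add: r_def)
  have "int r < int m" unfolding r using m_pos by simp
  then have "r < m" by simp
  moreover have "k = (i + int r) + int m * ((k - i) div int m)" unfolding r by simp
  ultimately show ?thesis
    using shift_multiple[of p "int m" "i + int r" "(k - i) div int m"] p_shift by (intro exI[of _ r]) metis
qed

lemma q_representative: "\<exists>r<l. q k = q (j - int l + 1 + int r) \<or> q k = - q (j - int l + 1 + int r)"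
proof -
  define r where "r = nat ((k - (j - int l + 1)) mod int l)"
  have r: "int r = (k - (j - int l + 1)) mod int l" using l_pos by (simp add: r_def)
  have "int r < int l" unfolding r using l_pos by simp
  then have "r < l" by simp
  moreover have "k = (j - int l + 1 + int r) + int l * ((k - (j - int l + 1)) div int l)" unfolding r by simp
  ultimately show ?thesis
    using shift_multiple[of q "int l" "j - int l + 1 + int r" "(k - (j - int l + 1)) div int l"] q_shift
    by (intro exI[of _ r]) metis
qed

lemma window_abs_inj: "a < n \<Longrightarrow> b < n \<Longrightarrow> \<bar>window i j ! a\<bar> = \<bar>window i j ! b\<bar> \<Longrightarrow> a = b"
  using letters_window'[of i j] nth_eq_iff_index_eq[of "map abs (window i j)" a b]
  by (simp add: letters_def)

lemma abs_p_neq_q: "\<bar>p i\<bar> \<noteq> \<bar>q j\<bar>"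
proof
  assume "\<bar>p i\<bar> = \<bar>q j\<bar>"
  moreover have "l - 1 < n" "l < n" using l_pos m_pos by (auto simp: n_eq)
  ultimately have "l = l - 1"
    using window_abs_inj[of l "l - 1" i j] nth_window_p[of 0 i j] nth_window_q[of "l - 1" i j] m_pos l_pos
    by simp
  then show False using l_pos by simp
qed

lemma abs_p_inj: "r < m \<Longrightarrow> s < m \<Longrightarrow> \<bar>p (i + int r)\<bar> = \<bar>p (i + int s)\<bar> \<Longrightarrow> r = s"
  using window_abs_inj[of "l + r" "l + s" i 0] by (simp add: nth_window_p n_eq)

lemma abs_q_inj:
  "r < l \<Longrightarrow> s < l \<Longrightarrow> \<bar>q (j - int l + 1 + int r)\<bar> = \<bar>q (j - int l + 1 + int s)\<bar> \<Longrightarrow> r = s"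
  using window_abs_inj[of r s 0 j] by (simp add: nth_window_q n_eq)

lemma pq_bounds: "p i \<noteq> 0" "q j \<noteq> 0" "\<bar>p i\<bar> \<le> int n" "\<bar>q j\<bar> \<le> int n"
proof -
  have "p i \<in> set (window i j)" "q j \<in> set (window i j)"
    using nth_window_p[of 0 i j] nth_window_q[of "l - 1" i j] m_pos l_pos
      nth_mem[of l "window i j"] nth_mem[of "l - 1" "window i j"] by (simp_all add: n_eq)
  then show "p i \<noteq> 0" "q j \<noteq> 0" "\<bar>p i\<bar> \<le> int n" "\<bar>q j\<bar> \<le> int n"
    using letters_window'[of i j] by (auto simp: letters_def)
qed

lemma pq_refl_pairs: "(p i, q j) \<in> refl_pairs n"
  using abs_p_neq_q[of i j] pq_bounds by (simp add: refl_pairs_def)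

lemma signed_letters_eqI:
  assumes fg: "signed n f" "signed n g"
    and P: "\<And>r. r < m \<Longrightarrow> app f (p (i + int r)) = app g (p (i + int r))"
    and Q: "\<And>r. r < l \<Longrightarrow> app f (q (j - int l + 1 + int r)) = app g (q (j - int l + 1 + int r))"
  shows "f = g"
proof (rule perms_eqI)
  fix x
  consider "x = 0" | "\<bar>x\<bar> > int n" | k where "x = p k" | k where "x = q k"
    using covering[of x] by fastforce
  then show "app f x = app g x"
  proof cases
    case 3
    with p_representative[of k i] P fg show ?thesis by (auto simp: signed_app_uminus)
  next
    case 4
    with q_representative[of k j] Q fg show ?thesis by (auto simp: signed_app_uminus)
  qed (use fg in \<open>auto simp: signed_app_0 signed_def\<close>)
qed

lemma signed_cyc_window: "signed n (cyc rfl (window i j))"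
  unfolding cyc_def
proof (rule signed_sum_rfl, rule subsetI)
  fix x assume "x \<in> set (cycle_word (window i j))"
  moreover obtain a b where "x = (a, b)" by (cases x)
  ultimately have x: "x = (a, b)" "subseq [a, b] (window i j)"
    using set_cycle_word[of a b "window i j"] by simp_all
  then obtain N where N: "[a, b] = nths (window i j) N" by (auto simp: subseq_conv_nths)
  have "distinct (map abs [a, b])"
    using letters_window'[of i j] distinct_nthsI[of "map abs (window i j)" N] unfolding N
    by (simp add: letters_def nths_map)
  moreover have "set [a, b] \<subseteq> set (window i j)" unfolding N by (rule set_nths_subset)
  ultimately show "x \<in> refl_pairs n"
    using letters_window'[of i j] x by (auto simp: refl_pairs_def letters_def)
qed

text \<open>Two negative cycles merged by a mixed reflection form one positive cycle on
  \<open>n\<close> letters. Away from \<open>p i\<close> and \<open>q j\<close> both sides shift the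
  index; at these two letters the reflection switches to the other block.\<close>

lemma w_factorization: "w = rfl (p i, q j) + cyc rfl (window (i + 1) j)"
proof (rule signed_letters_eqI[of _ _ i j])
  let ?X = "window (i + 1) j" and ?r = "rfl (p i, q j)"
  have X: "distinct (map abs ?X)" "0 \<notin> set ?X"
    using letters_window'[of "i + 1" j] by (simp_all add: letters_def)
  have step: "app (cyc rfl ?X) (?X ! k) = ?X ! Suc k" if "Suc k < n" for k
    using app_cyc_rfl_nth[OF X] that by simp
  have r: "app ?r (p i) = q j" "app ?r (q j) = p i"
    using abs_p_neq_q[of i j] pq_bounds by (simp_all add: app_rfl)
  show "app w (p (i + int k)) = app (?r + cyc rfl ?X) (p (i + int k))" if k: "k < m" for k
  proof (cases k)
    case 0
    have "app (cyc rfl ?X) (?X ! (l - 1)) = ?X ! (l + 0)"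
      using step[of "l - 1"] l_pos m_pos by (simp add: n_eq)
    then have "app (cyc rfl ?X) (q j) = p (i + 1)"
      using nth_window_q[of "l - 1" "i + 1" j] nth_window_p[of 0 "i + 1" j] l_pos m_pos by simp
    then show ?thesis using 0 r by (simp add: w_p)
  next
    case (Suc k')
    have "app ?r (p (i + int k)) = p (i + int k)"
      using abs_p_inj[of k 0 i] abs_p_neq_q[of "i + int k" j] k Suc by (intro app_rfl_other) auto
    moreover have "app (cyc rfl ?X) (?X ! (l + k')) = ?X ! (l + k)"
      using step[of "l + k'"] k Suc by (simp add: n_eq)
    then have "app (cyc rfl ?X) (p (i + int k)) = p (i + int k + 1)"
      using nth_window_p[of k' "i + 1" j] nth_window_p[of k "i + 1" j] k Suc by (simp add: ac_simps)
    ultimately show ?thesis by (simp add: w_p)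
  qed
  show "app w (q (j - int l + 1 + int k)) = app (?r + cyc rfl ?X) (q (j - int l + 1 + int k))" if k: "k < l" for k
  proof (cases "Suc k = l")
    case True
    then have j: "j - int l + 1 + int k = j" by auto
    \<comment> \<open>The window ends in \<open>- p i\<close> and begins with
      \<open>- q (j + 1)\<close>, so closing the cycle accounts for the image of \<open>q j\<close>
      with the right sign.\<close>
    have "last ?X = p (i + 1 + int (m - 1))"
      using m_pos by (simp add: window_def last_map)
    also have "\<dots> = - p i" using p_shift[of i] m_pos by (simp add: ac_simps of_nat_diff)
    finally have "last ?X = - p i" .
    moreover have "hd ?X = - q (j + 1)"
      using q_shift[of "j - int l + 1"] l_pos by (simp add: window_def hd_map hd_append)
    moreover have "?X \<noteq> []" using m_pos by (simp add: window_def)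
    ultimately have "app (cyc rfl ?X) (- p i) = - q (j + 1)"
      using app_cyc_rfl_last[OF X] by simp
    then have "app (cyc rfl ?X) (p i) = q (j + 1)"
      using signed_app_uminus[OF signed_cyc_window, of "i + 1" j "p i"] by simp
    then show ?thesis using r by (simp add: w_q j)
  next
    case False
    have "app ?r (q (j - int l + 1 + int k)) = q (j - int l + 1 + int k)"
    proof (rule app_rfl_other)
      show "\<bar>q (j - int l + 1 + int k)\<bar> \<noteq> \<bar>q j\<bar>"
        using abs_q_inj[of k "l - 1" j] k False by auto
    qed (use abs_p_neq_q in metis)
    moreover have "app (cyc rfl ?X) (?X ! k) = ?X ! Suc k"
      using step[of k] k m_pos by (simp add: n_eq)
    then have "app (cyc rfl ?X) (q (j - int l + 1 + int k)) = q (j - int l + 1 + int k + 1)"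
      using nth_window_q[of k "i + 1" j] nth_window_q[of "Suc k" "i + 1" j] k False by (simp add: ac_simps)
    ultimately show ?thesis by (simp add: w_q)
  qed
qed (auto intro: signed_w signed_plus signed_rfl pq_refl_pairs signed_cyc_window)

text \<open>A reflection that does not mix the two blocks changes an even number of signs in the first
  block, whereas \<open>w\<close> changes exactly one.\<close>

lemma prod_unmixed:
  fixes g :: "int \<Rightarrow> int"
  assumes odd: "\<And>x. g (- x) = - g x" and ab: "(a, b) \<in> refl_pairs n"
    and unmixed: "a \<in> range p \<and> b \<in> range p \<or> a \<in> range q \<and> b \<in> range q"
  shows "(\<Prod>k<m. g (app (rfl (a, b)) (p (int k)))) = (\<Prod>k<m. g (p (int k)))"
  using unmixed
proof
  assume "a \<in> range q \<and> b \<in> range q"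
  then have "app (rfl (a, b)) (p k) = p k" for k
    using abs_p_neq_q by (intro app_rfl_other) blast+
  then show ?thesis by simp
next
  assume "a \<in> range p \<and> b \<in> range p"
  then obtain k k' where k: "a = p k" "b = p k'" by blast
  obtain r where r: "r < m" "a = p (int r) \<or> a = - p (int r)"
    using p_representative[of k 0] k by auto
  obtain s where s: "s < m" "b = p (int s) \<or> b = - p (int s)"
    using p_representative[of k' 0] k by auto
  have "\<bar>a\<bar> \<noteq> \<bar>b\<bar>" "a \<noteq> 0" "b \<noteq> 0" using ab by (auto simp: refl_pairs_def)
  then have rs: "r \<noteq> s" using r(2) s(2) by auto
  obtain e where e: "e = 1 \<or> e = - 1" "rfl (a, b) = rfl (p (int r), e * p (int s))"
  proof -
    have "rfl (a, b) = rfl (p (int r), b) \<or> rfl (a, b) = rfl (p (int r), - b)"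
      using r(2) rfl_uminus[of "p (int r)" "- b"] by auto
    then show thesis using s(2) that[of 1] that[of "- 1"] by auto
  qed
  have abs_rs: "\<bar>p (int r)\<bar> \<noteq> \<bar>p (int s)\<bar>" using rs abs_p_inj[of r s 0] r(1) s(1) by auto
  have "app (rfl (a, b)) (p (int r)) = e * p (int s)" "app (rfl (a, b)) (p (int s)) = e * p (int r)"
    using e abs_rs pq_bounds(1) by (auto simp: app_rfl swap_pm_def)
  then have 1: "g (app (rfl (a, b)) (p (int r))) * g (app (rfl (a, b)) (p (int s))) = g (p (int r)) * g (p (int s))"
    using e(1) by (auto simp: odd)
  have 2: "app (rfl (a, b)) (p (int k)) = p (int k)" if "k < m" "k \<noteq> r" "k \<noteq> s" for k
    using that r s abs_p_inj[of k r 0] abs_p_inj[of k s 0] by (intro app_rfl_other) auto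
  have split: "(\<Prod>k<m. h k) = h r * h s * (\<Prod>k\<in>{..<m} - {r, s}. h k)" for h :: "nat \<Rightarrow> int"
    using rs r(1) s(1) prod.subset_diff[of "{r, s}" "{..<m}" h] by simp
  show ?thesis
    unfolding split[of "\<lambda>k. g (app (rfl (a, b)) (p (int k)))"] split[of "\<lambda>k. g (p (int k))"] 1
    using 2 by (auto intro!: arg_cong2[where f = "(*)"] prod.cong)
qed

lemma factorization_mixed:
  assumes ps: "set ps \<subseteq> refl_pairs n" "sum_list (map rfl ps) = w"
  shows "\<exists>(a, b) \<in> set ps. \<exists>i j. (a = p i \<and> b = q j) \<or> (a = q j \<and> b = p i)"
proof (rule ccontr)
  assume neg: "\<not> ?thesis"
  \<comment> \<open>The odd function \<open>g\<close> makes room for the reflections that are still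
    to be applied in the induction.\<close>
  have prod: "(\<Prod>k<m. g (app (sum_list (map rfl ts)) (p (int k)))) = (\<Prod>k<m. g (p (int k)))"
    if "set ts \<subseteq> set ps" "\<And>x. g (- x) = - g x" for ts and g :: "int \<Rightarrow> int"
    using that
  proof (induction ts)
    case (Cons t ts)
    obtain a b where t: "t = (a, b)" by (cases t)
    have ab: "(a, b) \<in> refl_pairs n" "(a, b) \<in> set ps" using Cons.prems(1) ps(1) t by auto
    then have "a \<in> range p \<union> range q" "b \<in> range p \<union> range q"
      using covering by (simp_all add: refl_pairs_def)
    then have unmixed: "a \<in> range p \<and> b \<in> range p \<or> a \<in> range q \<and> b \<in> range q"
      using neg ab(2) by blast
    have "signed n (sum_list (map rfl ts))"
      using Cons.prems(1) ps(1) by (intro signed_sum_rfl) auto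
    then have "(\<Prod>k<m. g (app (sum_list (map rfl ts)) (app (rfl (a, b)) (p (int k)))))
        = (\<Prod>k<m. g (app (sum_list (map rfl ts)) (p (int k))))"
      using Cons.prems(2) ab(1) unmixed
      by (intro prod_unmixed[of "\<lambda>x. g (app (sum_list (map rfl ts)) x)"]) (simp_all add: signed_app_uminus)
    then show ?case using Cons by (simp add: t)
  qed simp
  \<comment> \<open>The case where \<open>g\<close> is the identity. The shift replaces the factor
    \<open>p 0\<close> by \<open>p m = - p 0\<close>, so the product would equal its own
    negative.\<close>
  have "(\<Prod>k<m. p (int k + 1)) = (\<Prod>k<m. p (int k))"
    using prod[of ps "\<lambda>x. x"] ps(2) by (simp add: w_p)
  moreover have "(\<Prod>k<m. p (int k + 1)) * p 0 = (\<Prod>k<m. p (int k)) * p (int m)"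
    using prod.lessThan_Suc_shift[of "\<lambda>k. p (int k)" m] by (simp add: ac_simps)
  moreover have "p (int m) = - p 0" using p_shift[of 0] by simp
  moreover have "(\<Prod>k<m. p (int k)) \<noteq> 0" "p 0 \<noteq> 0" using pq_bounds(1) by (simp_all add: prod_zero_iff)
  ultimately show False by simp
qed

end

text \<open>Besides the relations of type A on every window, two conditions concern mixed
  reflections: \<open>(p i, q j)\<close> and \<open>(p i, - q j)\<close>, which never lie in a
  common window, commute, and splitting off any mixed reflection leads to the same total
  \<open>c\<close>.\<close>

locale dual_braid_rep = two_cycles + even_pairs \<psi> for \<psi> :: "int \<times> int \<Rightarrow> 'g::group_add" +
  fixes c :: 'g
  assumes dual_window: "dual_rels \<psi> (window i j)"
    and commute_signs: "commute (\<psi> (p i, q j)) (\<psi> (p i, - q j))"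
    and cyc_window: "\<psi> (p i, q j) + cyc \<psi> (window (i + 1) j) = c"
begin

text \<open>Pairs avoiding \<open>p i\<close> and \<open>q j\<close> up to sign are chords nested
  inside \<open>(- q j, - p i)\<close> in \<open>window (i + 1) (j - 1)\<close>. Pairs of such a
  letter with \<open>- p i\<close> belong to triangles of that window, those with \<open>q j\<close>
  to triangles of \<open>window i j\<close>, where \<open>q j\<close> and \<open>p i\<close> are
  neighbours. The pair of \<open>q j\<close> and \<open>- p i\<close> is the case of
  \<open>commute_signs\<close>.\<close>

lemma move_mixed:
  assumes x: "x \<in> set (window (i + 1) j)" and y: "y \<in> set (window (i + 1) j)" and xy: "x \<noteq> y"
  shows "\<psi> (p i, q j) + \<psi> (x, y) = \<psi> (map_pair (rfl (p i, q j)) (x, y)) + \<psi> (p i, q j)"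
proof -
  define a where "a = p i"
  define b where "b = q j"
  obtain Q P where X: "window (i + 1) j = Q @ [b] @ P @ [- a]"
    and Y1: "window (i + 1) (j - 1) = [- b] @ Q @ P @ [- a]" and Y2: "window i j = Q @ [b, a] @ P"
    unfolding a_def b_def by (rule window_forms)
  have ab: "a \<noteq> 0" "b \<noteq> 0" "\<bar>a\<bar> \<noteq> \<bar>b\<bar>" using abs_p_neq_q pq_bounds by (simp_all add: a_def b_def)
  let ?r = "rfl (a, b)"
  have r: "app ?r a = b" "app ?r b = a" "app ?r (- a) = - b" "app ?r (- b) = - a"
    using ab by (auto simp: app_rfl swap_pm_def)
  have mid: "app ?r z = z" if z: "z \<in> set (Q @ P)" for z
  proof (rule app_rfl_other)
    have "abs ` set Q \<inter> {\<bar>b\<bar>, \<bar>a\<bar>} = {}" "abs ` set P \<inter> {\<bar>b\<bar>, \<bar>a\<bar>} = {}"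
      using letters_window'[of i j] unfolding Y2 letters_append by auto
    then show "\<bar>z\<bar> \<noteq> \<bar>a\<bar>" "\<bar>z\<bar> \<noteq> \<bar>b\<bar>"
      using z by (simp_all, blast+)
  qed
  have neg: "\<psi> (- b, - a) = \<psi> (a, b)" using pair_uminus[of b a] pair_sym[of b a] by simp
  define good where "good x y \<longleftrightarrow> \<psi> (a, b) + \<psi> (x, y) = \<psi> (app ?r x, app ?r y) + \<psi> (a, b)" for x y
  have good_sym: "good x y \<longleftrightarrow> good y x" for x y
    unfolding good_def using pair_sym[of x y] pair_sym[of "app ?r x" "app ?r y"] by simp
  have good1: "good x y" if "x \<in> set (Q @ P)" "y \<in> set (Q @ P)" "x \<noteq> y" for x y
  proof -
    have *: "good x y" if "subseq [x, y] (Q @ P)" "x \<in> set (Q @ P)" "y \<in> set (Q @ P)" for x y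
    proof -
      have "subseq ([- b] @ [x, y] @ [- a]) ([- b] @ (Q @ P) @ [- a])"
        using that by (intro list_emb_append_mono) auto
      then have "subseq [- b, x, y, - a] (window (i + 1) (j - 1))" unfolding Y1 by simp
      then have "noncrossing \<psi> (- b) x y (- a)" using dual_window by (simp add: dual_rels_def)
      then show ?thesis using mid that by (simp add: good_def noncrossing_def neg)
    qed
    show ?thesis using subseq_pair_cases[OF that] *[of x y] *[of y x] good_sym that by blast
  qed
  have good2: "good x (- a)" if "x \<in> set (Q @ P)" for x
  proof -
    have "subseq ([- b] @ [x] @ [- a]) ([- b] @ (Q @ P) @ [- a])"
      using that by (intro list_emb_append_mono) (auto simp: subseq_singleton_left)
    then have "subseq [- b, x, - a] (window (i + 1) (j - 1))" unfolding Y1 by simp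
    then have "triangle \<psi> (- b) x (- a)" using dual_window by (simp add: dual_rels_def)
    then have "\<psi> (x, - a) + \<psi> (- b, x) = \<psi> (a, b) + \<psi> (x, - a)"
      "\<psi> (x, - a) + \<psi> (- b, x) = \<psi> (- b, x) + \<psi> (a, b)"
      unfolding triangle_def neg by blast+
    then have "\<psi> (a, b) + \<psi> (x, - a) = \<psi> (- b, x) + \<psi> (a, b)" by (rule subst)
    then show ?thesis using mid[OF that] r pair_sym[of x "- b"] by (simp add: good_def)
  qed
  have good3: "good x b" if "x \<in> set (Q @ P)" for x
  proof (cases "x \<in> set Q")
    case True
    have "subseq ([x] @ [b, a] @ []) (Q @ [b, a] @ P)"
      using True by (intro list_emb_append_mono) (auto simp: subseq_singleton_left)
    then have "subseq [x, b, a] (window i j)" unfolding Y2 by simp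
    then have "triangle \<psi> x b a" using dual_window by (simp add: dual_rels_def)
    then have "\<psi> (b, a) + \<psi> (x, b) = \<psi> (x, a) + \<psi> (b, a)" unfolding triangle_def by blast
    then show ?thesis using mid[OF that] r pair_sym[of b a] by (simp add: good_def)
  next
    case False
    then have "x \<in> set P" using that by simp
    then have "subseq ([] @ [b, a] @ [x]) (Q @ [b, a] @ P)"
      by (intro list_emb_append_mono) (auto simp: subseq_singleton_left)
    then have "subseq [b, a, x] (window i j)" unfolding Y2 by simp
    then have "triangle \<psi> b a x" using dual_window by (simp add: dual_rels_def)
    then have "\<psi> (a, x) + \<psi> (b, a) = \<psi> (b, x) + \<psi> (a, x)" "\<psi> (a, x) + \<psi> (b, a) = \<psi> (b, a) + \<psi> (b, x)"
      unfolding triangle_def by blast+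
    then have "\<psi> (b, a) + \<psi> (b, x) = \<psi> (a, x) + \<psi> (b, a)" by simp
    then show ?thesis using mid[OF that] r pair_sym[of b a] pair_sym[of x b] pair_sym[of x a]
      by (simp add: good_def)
  qed
  have good4: "good b (- a)"
    using commute_signs[of i j] pair_sym[of b "- a"] pair_uminus[of a "- b"] r
    unfolding a_def[symmetric] b_def[symmetric] by (simp add: good_def)
  have "x \<in> set (Q @ P) \<or> x = b \<or> x = - a" "y \<in> set (Q @ P) \<or> y = b \<or> y = - a"
    using x y unfolding X by auto
  then have "good x y"
    using good1 good2 good3 good4 good_sym xy by blast
  then show ?thesis by (simp add: good_def map_pair_def flip: a_def b_def)
qed

theorem factorization_sum:
  assumes ps: "set ps \<subseteq> refl_pairs n" "sum_list (map rfl ps) = w" "length ps = n"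
  shows "sum_list (map \<psi> ps) = c"
proof -
  obtain a b i j where ab: "(a, b) \<in> set ps" "(a = p i \<and> b = q j) \<or> (a = q j \<and> b = p i)"
    using factorization_mixed[OF ps(1,2)] by blast
  then have eq: "rfl (a, b) = rfl (p i, q j)" "\<psi> (a, b) = \<psi> (p i, q j)"
    using rfl_sym pair_sym by auto
  obtain us vs where split: "ps = us @ (a, b) # vs"
    using split_list[OF ab(1)] by blast
  define r where "r = rfl (p i, q j)"
  \<comment> \<open>The reflections preceding the mixed one are conjugated by it when it passes to
    the front.\<close>
  define us' where "us' = map (map_pair r) us"
  have sr: "signed n r" unfolding r_def by (rule signed_rfl[OF pq_refl_pairs])
  have us: "set us \<subseteq> refl_pairs n" "set vs \<subseteq> refl_pairs n" using ps(1) split by auto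
  have us': "set us' \<subseteq> refl_pairs n"
    using us(1) map_pair_refl_pairs[OF sr] by (auto simp: us'_def)
  have "sum_list (map rfl us') = cj r (sum_list (map rfl us))"
    unfolding cj_sum_list us'_def by (simp add: o_def rfl_map_pair[OF sr])
  then have "r + sum_list (map rfl us') = sum_list (map rfl us) + r"
    by (simp add: cj_def add.assoc)
  then have "w = r + sum_list (map rfl (us' @ vs))"
    using ps(2) eq(1) by (simp add: split r_def flip: add.assoc)
  then have sum': "sum_list (map rfl (us' @ vs)) = cyc rfl (window (i + 1) j)"
    using w_factorization[of i j] by (simp add: r_def)
  have len': "length (us' @ vs) = length (window (i + 1) j) - 1"
    using ps(3) split by (simp add: us'_def)
  \<comment> \<open>What remains is a minimal factorization of the cycle of the window, so each pair
    lies in the window up to a common sign, which is the hypothesis of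
    \<open>move_mixed\<close>.\<close>
  have mem: "\<exists>x y. {x, y} \<subseteq> set (window (i + 1) j) \<and> x \<noteq> y \<and> ((x, y) = t \<or> (- x, - y) = t)"
    if t: "t \<in> set us'" for t
  proof -
    obtain x y where xy: "t = (x, y)" by (cases t)
    have "\<exists>zs\<in>{window (i + 1) j, []}. (x \<in> set zs \<and> y \<in> set zs) \<or> (- x \<in> set zs \<and> - y \<in> set zs)"
      using letters_window' us us' sum' len' t xy
      by (intro cycle_factorization_letters[of n _ "[]" "us' @ vs"]) auto
    moreover have "x \<noteq> y" using us' t xy by (auto simp: refl_pairs_def)
    ultimately show ?thesis unfolding xy by (simp, metis minus_minus neg_equal_iff_equal)
  qed
  have move: "\<psi> (p i, q j) + \<psi> t = \<psi> (map_pair r t) + \<psi> (p i, q j)" if "t \<in> set us'" for t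
  proof -
    from mem[OF that] obtain x y where xy: "x \<in> set (window (i + 1) j)" "y \<in> set (window (i + 1) j)" "x \<noteq> y"
      and t: "(x, y) = t \<or> (- x, - y) = t" by auto
    then have "\<psi> t = \<psi> (x, y)" "\<psi> (map_pair r t) = \<psi> (map_pair r (x, y))"
      using pair_uminus by (auto simp: map_pair_def signed_app_uminus[OF sr])
    with move_mixed[OF xy] show ?thesis by (simp add: r_def)
  qed
  have inv: "map_pair r (map_pair r t) = t" for t
  proof -
    have "r + r = 0" by (simp add: r_def)
    then have "app r (app r x) = x" for x by (metis app_plus app_zero)
    then show ?thesis by (cases t) (simp add: map_pair_def)
  qed
  have "\<psi> (p i, q j) + sum_list (map \<psi> ts) = sum_list (map (\<lambda>t. \<psi> (map_pair r t)) ts) + \<psi> (p i, q j)"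
    if "set ts \<subseteq> set us'" for ts
    using that
  proof (induction ts)
    case (Cons t ts)
    have "\<psi> (p i, q j) + (\<psi> t + sum_list (map \<psi> ts)) = \<psi> (map_pair r t) + (\<psi> (p i, q j) + sum_list (map \<psi> ts))"
      using move[of t] Cons.prems by (simp flip: add.assoc)
    then show ?case using Cons by (simp add: add.assoc)
  qed simp
  from this[of us'] have "\<psi> (p i, q j) + sum_list (map \<psi> us') = sum_list (map \<psi> us) + \<psi> (p i, q j)"
    by (simp add: us'_def o_def inv)
  then have "sum_list (map \<psi> ps) = \<psi> (p i, q j) + sum_list (map \<psi> (us' @ vs))"
    by (simp add: split eq flip: add.assoc)
  also have "sum_list (map \<psi> (us' @ vs)) = cyc \<psi> (window (i + 1) j)"
    using letters_window'[of "i + 1" j] dual_window[of "i + 1" j] us us' sum' len'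
    by (intro cycle_factorization_sum) auto
  finally show ?thesis using cyc_window by simp
qed

end

section \<open>Twisted chains of braid generators\<close>

definition zmul :: "int \<Rightarrow> 'g::group_add \<Rightarrow> 'g" where
  "zmul i g = (if 0 \<le> i then sum_list (replicate (nat i) g) else - sum_list (replicate (nat (- i)) g))"

lemma zmul_0 [simp]: "zmul 0 g = 0"
  by (simp add: zmul_def)

lemma zmul_Suc: "zmul (i + 1) g = zmul i g + g"
proof (cases "0 \<le> i")
  case True
  then have "nat (i + 1) = Suc (nat i)" by simp
  moreover have "sum_list (replicate (Suc k) g) = sum_list (replicate k g) + g" for k
    using arg_cong[OF replicate_append_same[of k g], of sum_list] by simp
  ultimately show ?thesis using True by (simp add: zmul_def)
next
  case False
  define k where "k = nat (- (i + 1))"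
  have k: "nat (- i) = Suc k" "i + 1 = - int k" using False by (simp_all add: k_def)
  have "zmul (i + 1) g = - sum_list (replicate k g)"
    unfolding k(2) by (simp add: zmul_def)
  moreover have "zmul i g + g = - sum_list (replicate k g)"
    using False by (simp add: zmul_def k(1) minus_add add.assoc diff_conv_add_uminus del: add_uminus_conv_diff)
  ultimately show ?thesis by simp
qed

lemma zmul_1 [simp]: "zmul 1 g = g"
  using zmul_Suc[of 0 g] by simp

lemma zmul_pred: "zmul (i - 1) g = zmul i g - g"
  using zmul_Suc[of "i - 1" g] by (simp add: eq_diff_eq)

lemma zmul_add: "zmul (i + j) g = zmul i g + zmul j g"
proof (induction j rule: int_induct[where k = 0])
  case (step1 j)
  have "i + (j + 1) = (i + j) + 1" by simp
  then show ?case using step1 by (simp only: zmul_Suc) (simp add: add.assoc)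
next
  case (step2 j)
  have "i + (j - 1) = (i + j) - 1" by simp
  then show ?case using step2 by (simp only: zmul_pred) (simp add: add_diff_eq)
qed simp

lemma zmul_minus_1 [simp]: "zmul (- 1) g = - g"
  using zmul_add[of "- 1" 1 g] by (simp add: eq_neg_iff_add_eq_0)

lemma commute_zmul: "commute x g \<Longrightarrow> commute x (zmul i g)"
  unfolding zmul_def
  by (cases "0 \<le> i"; simp only: if_True if_False; intro commute_uminus commute_sum_list; simp)

lemma braid_uminus: "braid x y \<Longrightarrow> braid (- x) (- y)"
proof -
  assume "braid x y"
  then have "- (x + y + x) = - (y + x + y)" by (simp add: braid_def)
  then show ?thesis
    unfolding braid_def by (simp only: minus_add add.assoc)
qed

lemma uminus_sum_list_rev: "- sum_list (map f xs) = sum_list (map (\<lambda>x. - f x) (rev xs))"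
  for f :: "'a \<Rightarrow> 'g::group_add"
  by (induction xs) (simp_all add: minus_add)

lemma braid_chain_mono: "braid_chain N a \<Longrightarrow> M \<le> N \<Longrightarrow> braid_chain M a"
  unfolding braid_chain_def by (meson order.strict_trans2)

lemma cj_fixed_zmul: "cj g x = x \<Longrightarrow> cj (zmul i g) x = x"
  unfolding cj_eq_self_iff using commute_zmul[of x g i] by simp

lemma cj_plus: "cj (g + h) x = cj h (cj g x)"
  by (simp add: cj_cj)

lemma cj_commute: "commute g h \<Longrightarrow> cj g (cj h x) = cj h (cj g x)"
  by (simp add: cj_cj)

lemma cj_fixed: "commute g x \<Longrightarrow> cj g x = x"
  by (simp add: cj_eq_self_iff)

lemma cj_fixed_uminus: "commute g x \<Longrightarrow> cj (- g) x = x"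
  unfolding cj_eq_self_iff using commute_uminus[of x g] by simp

text \<open>The product of all generators is the Coxeter element of the braid group. Of its factors
  only \<open>a (i + 1)\<close> and \<open>a i\<close> act: they turn \<open>a i\<close> into
  \<open>a (i + 1)\<close>, and the others commute with what they meet.\<close>

lemma cj_chain_shift:
  "braid_chain N a \<Longrightarrow> Suc i < N \<Longrightarrow> cj (sum_list (map a (rev [0..<N]))) (a i) = a (Suc i)"
proof (induction N)
  case (Suc N)
  have chain: "braid_chain N a" using Suc.prems(1) by (rule braid_chain_mono) simp
  show ?case
  proof (cases "Suc i < N")
    case True
    then have "cj (a N) (a i) = a i"
      using chain_commute[OF Suc.prems(1), of i N] by (intro cj_fixed) simp
    then show ?thesis using Suc.IH[OF chain True] by (simp add: cj_plus)
  next
    case False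
    then have N: "N = Suc i" using Suc.prems by simp
    have "braid (a N) (a i)"
      using chain_braid[OF Suc.prems(1), of i] N by (simp add: braid_sym)
    then have "cj (a i) (cj (a N) (a i)) = a N" by (simp add: braid_iff_cj)
    moreover have "commute (a N) (sum_list (map a (rev [0..<i])))"
      by (rule commute_sum_list) (use chain_commute[OF Suc.prems(1)] N in auto)
    then have "cj (sum_list (map a (rev [0..<i]))) (a N) = a N" by (intro cj_fixed) simp
    ultimately show ?thesis by (simp add: N cj_plus)
  qed
qed simp

text \<open>\<open>a\<close> and \<open>b\<close> are the generators along the two arms of the diagram and \<open>t\<close> belongs to the vertex
  \<open>m + 1\<close>; conjugation by \<open>\<sigma>\<close> exchanges it with the vertex \<open>1\<close>. The elements \<open>\<delta>\<close> and \<open>\<epsilon>\<close> below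
  play the roles of the two negative cycles.\<close>

locale twisted_chain =
  fixes m l :: nat and a b :: "nat \<Rightarrow> 'g::group_add" and \<sigma> \<tau> t :: 'g
  assumes m_pos: "0 < m" and l_pos: "0 < l"
    and chain_a: "braid_chain (m - 1) a" and chain_b: "braid_chain (l - 1) b"
    and ab: "i < m - 1 \<Longrightarrow> j < l - 1 \<Longrightarrow> commute (a i) (b j)"
    and \<sigma>_a: "0 < i \<Longrightarrow> i < m - 1 \<Longrightarrow> commute \<sigma> (a i)" and \<sigma>_b: "j < l - 1 \<Longrightarrow> commute \<sigma> (b j)"
    and \<tau>_a: "i < m - 1 \<Longrightarrow> commute \<tau> (a i)" and \<tau>_b: "0 < j \<Longrightarrow> j < l - 1 \<Longrightarrow> commute \<tau> (b j)"
    and \<sigma>\<tau>: "commute \<sigma> \<tau>"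
    and t_a0: "1 < m \<Longrightarrow> braid t (a 0)" and t_b0: "1 < l \<Longrightarrow> braid t (b 0)"
    and t_a: "0 < i \<Longrightarrow> i < m - 1 \<Longrightarrow> commute t (a i)" and t_b: "0 < j \<Longrightarrow> j < l - 1 \<Longrightarrow> commute t (b j)"
    and twist: "t - \<sigma> + t = \<tau>" and \<sigma>\<sigma>: "commute (\<sigma> + \<sigma>) t"
begin

text \<open>\<open>u\<close> and \<open>v\<close> stand for the positive cycles through
  \<open>p 0, ..., p (m - 1)\<close> and \<open>q (1 - l), ..., q 0\<close>. The letter whose sign
  changes is the first of the one list and the last of the other, hence \<open>\<sigma>\<close>
  follows \<open>u\<close> while \<open>\<tau>\<close> precedes \<open>v\<close>.\<close>

definition u :: 'g where "u = sum_list (map a (rev [0..<m - 1]))"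
definition v :: 'g where "v = sum_list (map b [0..<l - 1])"
definition \<delta> :: 'g where "\<delta> = u + \<sigma>"
definition \<epsilon> :: 'g where "\<epsilon> = \<tau> + v"

lemma commute_u: "(\<And>i. i < m - 1 \<Longrightarrow> commute x (a i)) \<Longrightarrow> commute x u"
  unfolding u_def by (rule commute_sum_list) auto

lemma commute_v: "(\<And>j. j < l - 1 \<Longrightarrow> commute x (b j)) \<Longrightarrow> commute x v"
  unfolding v_def by (rule commute_sum_list) auto

lemma b_u: "j < l - 1 \<Longrightarrow> commute (b j) u"
  by (rule commute_u) (simp add: ab)

lemma b_\<delta>: "j < l - 1 \<Longrightarrow> commute (b j) \<delta>"
  unfolding \<delta>_def by (intro commute_add b_u) (simp_all add: \<sigma>_b)

lemma a_\<epsilon>: "i < m - 1 \<Longrightarrow> commute (a i) \<epsilon>"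
  unfolding \<epsilon>_def by (intro commute_add commute_v ab) (simp_all add: \<tau>_a)

lemma u_v: "commute u v" by (rule commute_v) (simp add: b_u)
lemma u_\<tau>: "commute \<tau> u" by (rule commute_u) (rule \<tau>_a)
lemma \<sigma>_v: "commute \<sigma> v" by (rule commute_v) (rule \<sigma>_b)

lemma \<delta>\<epsilon>: "commute \<delta> \<epsilon>"
  unfolding \<epsilon>_def
proof (rule commute_add)
  show "commute \<delta> v" by (rule commute_v) (simp add: b_\<delta>)
  have "commute \<tau> \<delta>" unfolding \<delta>_def by (rule commute_add[OF u_\<tau>]) (simp add: \<sigma>\<tau>)
  then show "commute \<delta> \<tau>" by simp
qed

lemma \<tau>_\<delta>: "commute \<tau> \<delta>"
  unfolding \<delta>_def by (rule commute_add[OF u_\<tau>]) (simp add: \<sigma>\<tau>)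

lemma cj_\<delta>_a: "Suc i < m - 1 \<Longrightarrow> cj \<delta> (a i) = a (Suc i)"
  using cj_chain_shift[OF chain_a, of i] \<sigma>_a[of "Suc i"]
  by (simp add: \<delta>_def cj_plus cj_fixed u_def)

lemma cj_\<epsilon>_b: "Suc j < l - 1 \<Longrightarrow> cj (- \<epsilon>) (b j) = b (Suc j)"
proof -
  assume j: "Suc j < l - 1"
  have "braid_chain (l - 1) (\<lambda>i. - b i)"
    using chain_b unfolding braid_chain_def
    by (blast intro: braid_uminus commute_uminus commute_uminus[symmetric] HOL.sym)
  from cj_chain_shift[OF this j] have "cj (- v) (b j) = b (Suc j)"
    by (simp add: cj_uminus v_def uminus_sum_list_rev)
  moreover have "cj (- \<tau>) (b (Suc j)) = b (Suc j)"
    using \<tau>_b[of "Suc j"] j by (intro cj_fixed_uminus) simp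
  ultimately show ?thesis by (simp add: \<epsilon>_def minus_add cj_plus diff_conv_add_uminus del: add_uminus_conv_diff)
qed

lemma twist': "- t + \<sigma> = - \<tau> + t" "t - \<tau> = \<sigma> - t"
proof -
  have "\<tau> = t + (- \<sigma> + t)" using twist by (simp add: add.assoc diff_conv_add_uminus del: add_uminus_conv_diff)
  then have "- t + \<tau> = - \<sigma> + t" by simp
  then have "- (- t + \<tau>) = - (- \<sigma> + t)" by simp
  then show "- t + \<sigma> = - \<tau> + t" by (simp add: minus_add)
  have "\<tau> - t = t - \<sigma>" using twist by (metis add_diff_cancel)
  then have "- (\<tau> - t) = - (t - \<sigma>)" by simp
  then show "t - \<tau> = \<sigma> - t" by simp
qed

text \<open>Both sides stand for \<open>(p 1, q 0)\<close>. The braid relation turns the conjugate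
  of \<open>t\<close> by \<open>u\<close> into a conjugate of \<open>a 0\<close>; the twist then
  trades \<open>\<sigma>\<close> for \<open>\<tau>\<close>, which commutes with
  \<open>a 0\<close>.\<close>

lemma cj_\<delta>_t: "1 < m \<Longrightarrow> cj \<delta> t = cj (- a 0) t"
proof -
  assume m: "1 < m"
  have u: "u = sum_list (map a (rev [1..<m - 1])) + a 0"
    unfolding u_def using m by (subst upt_conv_Cons) simp_all
  have "commute t (sum_list (map a (rev [1..<m - 1])))"
    by (rule commute_sum_list) (auto simp: t_a)
  then have "cj u t = cj (a 0) t" unfolding u by (simp add: cj_plus cj_fixed)
  also have "\<dots> = cj (- t) (a 0)"
    using braid_sym[THEN iffD1, OF t_a0[OF m]] by (simp add: braid_iff_cj)
  finally have "cj \<delta> t = cj (- t + \<sigma>) (a 0)" by (simp add: \<delta>_def cj_plus)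
  also have "\<dots> = cj t (a 0)"
    unfolding twist'(1) using \<tau>_a[of 0] m by (simp add: cj_plus cj_fixed_uminus)
  also have "\<dots> = cj (- a 0) t" using t_a0[OF m] by (simp add: braid_iff_cj)
  finally show ?thesis .
qed

lemma cj_\<epsilon>_t: "1 < l \<Longrightarrow> cj (- \<epsilon>) t = cj (b 0) t"
proof -
  assume l: "1 < l"
  have v: "v = b 0 + sum_list (map b [1..<l - 1])"
    unfolding v_def using l by (subst upt_conv_Cons) simp_all
  have "commute t (sum_list (map b [1..<l - 1]))"
    by (rule commute_sum_list) (auto simp: t_b)
  then have "cj (- v) t = cj (- b 0) t"
    unfolding v minus_add by (simp add: cj_plus cj_fixed_uminus diff_conv_add_uminus del: add_uminus_conv_diff)
  also have "\<dots> = cj t (b 0)" using t_b0[OF l] by (simp add: braid_iff_cj)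
  finally have "cj (- \<epsilon>) t = cj (t - \<tau>) (b 0)"
    by (simp add: \<epsilon>_def minus_add cj_plus diff_conv_add_uminus del: add_uminus_conv_diff)
  also have "\<dots> = cj (- t) (b 0)"
    unfolding twist'(2) using \<sigma>_b[of 0] l
    by (simp add: cj_plus cj_fixed diff_conv_add_uminus del: add_uminus_conv_diff)
  also have "\<dots> = cj (b 0) t"
    using braid_sym[THEN iffD1, OF t_b0[OF l]] by (simp add: braid_iff_cj)
  finally show ?thesis .
qed

definition C :: "int \<Rightarrow> int \<Rightarrow> 'g" where
  "C i j = cj (zmul i \<delta> + zmul j \<epsilon>) t"

lemma commute_zmul_\<delta>\<epsilon>: "commute (zmul i \<delta>) (zmul j \<epsilon>)"
  by (rule commute_zmul) (rule commute_zmul[OF \<delta>\<epsilon>[symmetric], symmetric])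

lemma C_shift: "cj (zmul i \<delta> + zmul j \<epsilon>) (C i' j') = C (i' + i) (j' + j)"
proof -
  have "zmul i' \<delta> + zmul j' \<epsilon> + (zmul i \<delta> + zmul j \<epsilon>) = zmul i' \<delta> + (zmul j' \<epsilon> + zmul i \<delta>) + zmul j \<epsilon>"
    by (simp add: add.assoc)
  also have "\<dots> = zmul (i' + i) \<delta> + zmul (j' + j) \<epsilon>"
    unfolding commute_zmul_\<delta>\<epsilon>[symmetric] by (simp add: zmul_add add.assoc)
  finally show ?thesis by (simp add: C_def cj_cj)
qed

lemma C_shift_\<delta>: "cj (zmul i \<delta>) (C i' j) = C (i' + i) j" and C_shift_\<epsilon>: "cj (zmul i \<epsilon>) (C j i') = C j (i' + i)"
  using C_shift[of i 0 i' j] C_shift[of 0 i j i'] by simp_all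

lemma C_0 [simp]: "C 0 0 = t" by (simp add: C_def)

text \<open>The step at 0 is \<open>cj_\<delta>_t\<close>; conjugation by \<open>\<delta>\<close>
  shifts the chain \<open>a\<close> and so turns each step into the next.\<close>

lemma C_step_a: "Suc r < m \<Longrightarrow> C (int (Suc r)) 0 = cj (- a r) (C (int r) 0)"
proof (induction r)
  case 0
  then show ?case using C_shift_\<delta>[of 1 0 0] by (simp add: cj_\<delta>_t)
next
  case (Suc r)
  then have "C (int (Suc (Suc r))) 0 = cj \<delta> (cj (- a r) (C (int r) 0))"
    using C_shift_\<delta>[of 1 "int (Suc r)" 0] by (simp add: ac_simps)
  also have "\<dots> = cj (- a (Suc r)) (cj \<delta> (C (int r) 0))"
    using Suc.prems cj_\<delta>_a[of r] by (subst cj_cj_distrib) (simp add: cj_uminus)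
  finally show ?case using C_shift_\<delta>[of 1 "int r" 0] by (simp add: ac_simps)
qed

lemma C_step_b0: "Suc r < l \<Longrightarrow> C 0 (- int (Suc r)) = cj (b r) (C 0 (- int r))"
proof (induction r)
  case 0
  then show ?case using C_shift_\<epsilon>[of "- 1" 0 0] by (simp add: cj_\<epsilon>_t)
next
  case (Suc r)
  have "- int (Suc (Suc r)) = - int (Suc r) + - 1" by simp
  then have "C 0 (- int (Suc (Suc r))) = cj (- \<epsilon>) (cj (b r) (C 0 (- int r)))"
    using C_shift_\<epsilon>[of "- 1" 0 "- int (Suc r)"] Suc by (simp only: zmul_minus_1)
  also have "\<dots> = cj (b (Suc r)) (cj (- \<epsilon>) (C 0 (- int r)))"
    using Suc.prems cj_\<epsilon>_b[of r] by (subst cj_cj_distrib) simp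
  also have "cj (- \<epsilon>) (C 0 (- int r)) = C 0 (- int (Suc r))"
    using C_shift_\<epsilon>[of "- 1" 0 "- int r"] by (simp add: algebra_simps)
  finally show ?case .
qed

lemma C_step_b: "Suc r < l \<Longrightarrow> C i (- int (Suc r)) = cj (b r) (C i (- int r))"
proof -
  assume r: "Suc r < l"
  have "cj (zmul i \<delta>) (b r) = b r"
    using b_\<delta>[of r] r by (intro cj_fixed_zmul cj_fixed) simp
  then have "cj (zmul i \<delta>) (C 0 (- int (Suc r))) = cj (b r) (cj (zmul i \<delta>) (C 0 (- int r)))"
    unfolding C_step_b0[OF r] by (subst cj_cj_distrib) simp
  then show ?thesis by (simp only: C_shift_\<delta>) simp
qed

lemma C_last_a: "r < m \<Longrightarrow> C (int r) 0 = cj (- sum_list (map a (rev [0..<r]))) t"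
proof (induction r)
  case (Suc r)
  then show ?case using C_step_a[of r]
    by (simp add: cj_cj minus_add diff_conv_add_uminus del: add_uminus_conv_diff of_nat_Suc)
qed simp

lemma C_last_b: "r < l \<Longrightarrow> C 0 (- int r) = cj (sum_list (map b [0..<r])) t"
proof (induction r)
  case (Suc r)
  then show ?case using C_step_b[of r 0] by (simp add: cj_cj del: of_nat_Suc)
qed simp

text \<open>After \<open>m - 1\<close> steps the accumulated conjugation is by \<open>- u\<close>,
  which cancels the \<open>u\<close> in the last \<open>\<delta>\<close> and leaves
  \<open>\<sigma>\<close> alone.\<close>

lemma C_m: "C (int m) 0 = cj \<sigma> t"
proof -
  have "C (int m) 0 = cj \<delta> (C (int (m - 1)) 0)"
    using C_shift_\<delta>[of 1 "int (m - 1)" 0] m_pos by (simp add: of_nat_diff)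
  also have "\<dots> = cj (- u + \<delta>) t"
    using C_last_a[of "m - 1"] m_pos by (simp add: cj_cj u_def)
  finally show ?thesis by (simp add: \<delta>_def)
qed

lemma C_l: "C 0 (- int l) = cj (- \<tau>) t"
proof -
  have "C 0 (- int l) = cj (- \<epsilon>) (C 0 (- int (l - 1)))"
    using C_shift_\<epsilon>[of "- 1" 0 "- int (l - 1)"] l_pos by (simp add: of_nat_diff)
  also have "\<dots> = cj (v - \<epsilon>) t"
    using C_last_b[of "l - 1"] l_pos by (simp add: cj_cj v_def)
  finally show ?thesis
    by (simp add: \<epsilon>_def minus_add diff_conv_add_uminus del: add_uminus_conv_diff)
qed

lemma cj_\<sigma>\<sigma>: "cj \<sigma> (cj \<sigma> t) = t"
  using \<sigma>\<sigma> by (simp add: cj_cj cj_eq_self_iff)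

text \<open>For reflections: \<open>(p 0, q 0)\<close> times \<open>(p 0, - q 0)\<close> changes the
  signs of \<open>p 0\<close> and \<open>q 0\<close>. The first order is the twist rearranged;
  conjugating by \<open>\<sigma>\<close>, which exchanges the two factors, gives the other.\<close>

lemma t_s: "t + cj \<sigma> t = \<tau> + \<sigma>" "cj \<sigma> t + t = \<tau> + \<sigma>"
proof -
  show 1: "t + cj \<sigma> t = \<tau> + \<sigma>"
    using twist by (simp add: cj_def flip: add.assoc)
  have "cj \<sigma> (t + cj \<sigma> t) = cj \<sigma> (\<tau> + \<sigma>)" unfolding 1 ..
  then show "cj \<sigma> t + t = \<tau> + \<sigma>"
    using \<sigma>\<tau> by (simp add: cj_add cj_\<sigma>\<sigma> cj_fixed)
qed

lemma cj_\<sigma>_\<tau>: "cj \<sigma> t = cj (- \<tau>) t"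
proof -
  have "commute (\<tau> + \<sigma>) t"
    using t_s by (metis add.assoc)
  then have "cj \<tau> (cj \<sigma> t) = t"
    using \<sigma>\<tau> by (simp add: cj_cj cj_eq_self_iff)
  then show ?thesis by (metis cj_minus_cancel)
qed

text \<open>The new indices reverse the signs of both letters and thus name the same reflection. It
  comes down to \<open>cj_\<sigma>_\<tau>\<close>: reversing \<open>p 0\<close> or reversing
  \<open>q 0\<close> has the same effect on \<open>t\<close>.\<close>

lemma C_period: "C (i + int m) (j + int l) = C i j"
proof -
  have "C (int m) 0 = C 0 (- int l)" by (simp add: C_m C_l cj_\<sigma>_\<tau>)
  then have "cj (zmul i \<delta> + zmul (j + int l) \<epsilon>) (C (int m) 0) = cj (zmul i \<delta> + zmul (j + int l) \<epsilon>) (C 0 (- int l))"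
    by simp
  then show ?thesis unfolding C_shift by (simp add: ac_simps)
qed

text \<open>Two full turns restore every sign; here \<open>\<sigma>\<close> acts on \<open>t\<close>
  twice.\<close>

lemma C_period2: "C (i + 2 * int m) j = C i j"
proof -
  have "C (2 * int m) 0 = cj (zmul (int m) \<delta>) (cj (- \<tau>) t)"
    using C_shift_\<delta>[of "int m" "int m" 0] by (simp add: C_m cj_\<sigma>_\<tau>)
  also have "\<dots> = cj (- \<tau>) (cj (zmul (int m) \<delta>) t)"
    using commute_zmul[OF \<tau>_\<delta>] by (intro cj_commute commute_uminus) simp
  also have "cj (zmul (int m) \<delta>) t = cj \<sigma> t" using C_m by (simp add: C_def)
  also have "cj (- \<tau>) (cj \<sigma> t) = cj \<sigma> (cj (- \<tau>) t)"
    using \<sigma>\<tau> by (intro cj_commute commute_uminus[symmetric]) simp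
  also have "\<dots> = t" using cj_\<sigma>\<sigma> by (simp add: cj_\<sigma>_\<tau>)
  finally have "cj (zmul i \<delta> + zmul j \<epsilon>) (C (2 * int m) 0) = cj (zmul i \<delta> + zmul j \<epsilon>) (C 0 0)" by simp
  then show ?thesis unfolding C_shift by (simp add: ac_simps)
qed

end

section \<open>Elements for the pairs inside one block, their periodicity, and the total
  product\<close>

context twisted_chain
begin

text \<open>The triangle relation of \<open>q 0\<close>, \<open>p i\<close>, \<open>p j\<close>,
  solved for the pair \<open>(p i, p j)\<close>. Likewise \<open>B i j\<close> solves the triangle
  of \<open>q i\<close>, \<open>q j\<close>, \<open>p 0\<close> for
  \<open>(q i, q j)\<close>.\<close>

definition A :: "int \<Rightarrow> int \<Rightarrow> 'g" where "A i j = cj (- C i 0) (C j 0)"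
definition B :: "int \<Rightarrow> int \<Rightarrow> 'g" where "B i j = cj (C 0 j) (C 0 i)"

text \<open>The braid generators of neighbouring letters in the list
  \<open>q (1 - l), ..., q 0, p 0, ..., p (m - 1)\<close>: the arm \<open>b\<close> reversed, the
  link \<open>t\<close>, the arm \<open>a\<close>.\<close>

definition g :: "nat \<Rightarrow> 'g" where
  "g k = (if k < l - 1 then b (l - 2 - k) else if k = l - 1 then t else a (k - l))"

lemma g_less: "k < l - 1 \<Longrightarrow> g k = b (l - 2 - k)" and g_mid: "g (l - 1) = t"
  and g_ge: "l \<le> k \<Longrightarrow> g k = a (k - l)"
  using l_pos by (auto simp: g_def)

lemma chain_g: "braid_chain (m + l - 1) g"
  unfolding braid_chain_def
proof (intro conjI allI impI)
  fix i assume i: "Suc i < m + l - 1"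
  consider "Suc i < l - 1" | "Suc i = l - 1" | "i = l - 1" | "l \<le> i" by linarith
  then show "braid (g i) (g (Suc i))"
  proof cases
    case 1
    then have "l - 2 - i = Suc (l - 2 - Suc i)" "l - 2 - i < l - 1" by auto
    then show ?thesis
      using 1 chain_braid[OF chain_b, of "l - 2 - Suc i"] by (simp add: g_def braid_sym)
  next
    case 2
    then show ?thesis using t_b0 by (auto simp: g_def braid_sym)
  next
    case 3
    then show ?thesis using t_a0 i l_pos by (auto simp: g_def)
  next
    case 4
    then have "Suc i - l = Suc (i - l)" "Suc (i - l) < m - 1" using i by auto
    then show ?thesis using 4 chain_braid[OF chain_a, of "i - l"] by (simp add: g_ge)
  qed
next
  fix i j assume ij: "Suc i < j" "j < m + l - 1"
  consider "j < l - 1" | "j = l - 1" | "i < l - 1" "l \<le> j" | "i = l - 1" "l \<le> j" | "l \<le> i" using ij by linarith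
  then show "commute (g i) (g j)"
  proof cases
    case 1
    then have "l - 2 - i < l - 1" "Suc (l - 2 - j) < l - 2 - i" using ij by auto
    then show ?thesis using chain_commute[OF chain_b, of "l - 2 - i" "l - 2 - j"] 1 ij by (simp add: g_def)
  next
    case 2
    then show ?thesis using t_b[of "l - 2 - i"] ij by (simp add: g_def)
  next
    case 3
    then show ?thesis using ab[of "j - l" "l - 2 - i"] ij by (simp add: g_less g_ge)
  next
    case 4
    then show ?thesis using t_a[of "j - l"] ij by (simp add: g_def)
  next
    case 5
    then have "i - l < m - 1" "j - l < m - 1" "Suc (i - l) < j - l" using ij by auto
    then show ?thesis using chain_commute[OF chain_a, of "i - l" "j - l"] 5 ij by (simp add: g_ge)
  qed
qed

text \<open>In the first window position \<open>l - 1 - s\<close> holds \<open>q (- s)\<close> and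
  position \<open>l + r\<close> holds \<open>p r\<close>; this and the next two lemmas identify its
  Birman-Ko-Lee generators.\<close>

lemma bkl_C:
  assumes "s < l" "r < m"
  shows "bkl g (l - 1 - s) (l + r) = C (int r) (- int s)"
  using assms(1)
proof (induction s)
  case 0
  show ?case using assms(2)
  proof (induction r)
    case 0
    have "bkl g (l - 1) (Suc (l - 1)) = t" using g_mid by simp
    then show ?case using l_pos by simp
  next
    case (Suc r)
    have "bkl g (l - 1) (Suc (l + r)) = cj (- g (l + r)) (bkl g (l - 1) (l + r))"
      using l_pos by auto
    also have "\<dots> = cj (- a r) (C (int r) 0)"
      using Suc by (simp add: g_ge)
    finally have "bkl g (l - 1 - 0) (l + Suc r) = cj (- a r) (C (int r) 0)" by simp
    then show ?case using C_step_a[of r] Suc.prems by simp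
  qed
next
  case (Suc s)
  define k where "k = l - 1 - Suc s"
  have k: "Suc k = l - 1 - s" "l - 2 - k = s" "k < l - 1" using Suc.prems by (auto simp: k_def)
  have "bkl g k (l + r) = cj (bkl g k (Suc k)) (bkl g (Suc k) (l + r))"
    using k assms(2) by (intro bkl_triangle(2)[OF chain_g]) auto
  also have "bkl g k (Suc k) = b s" using k(2) g_less[OF k(3)] by simp
  also have "bkl g (Suc k) (l + r) = C (int r) (- int s)" using Suc k by simp
  finally show ?case using C_step_b[of s "int r"] Suc.prems by (simp add: k_def)
qed

lemma bkl_A:
  assumes "r < r'" "r' < m"
  shows "bkl g (l + r) (l + r') = A (int r) (int r')"
proof -
  have "bkl g (l - 1) (l + r') = cj (bkl g (l - 1) (l + r)) (bkl g (l + r) (l + r'))"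
    using assms l_pos by (intro bkl_triangle(2)[OF chain_g]) auto
  then have "C (int r') 0 = cj (C (int r) 0) (bkl g (l + r) (l + r'))"
    using bkl_C[of 0 r] bkl_C[of 0 r'] assms l_pos by simp
  then show ?thesis by (simp add: A_def)
qed

lemma bkl_B:
  assumes "s < s'" "s' < l"
  shows "bkl g (l - 1 - s') (l - 1 - s) = B (- int s') (- int s)"
proof -
  have "bkl g (l - 1 - s') l = cj (- bkl g (l - 1 - s) l) (bkl g (l - 1 - s') (l - 1 - s))"
    using assms m_pos by (intro bkl_triangle(1)[OF chain_g]) auto
  then have "C 0 (- int s') = cj (- C 0 (- int s)) (bkl g (l - 1 - s') (l - 1 - s))"
    using bkl_C[of s 0] bkl_C[of s' 0] assms m_pos by simp
  then show ?thesis by (simp add: B_def)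
qed

lemma A_shift: "cj (zmul k \<delta>) (A i j) = A (i + k) (j + k)"
  unfolding A_def by (subst cj_cj_distrib) (simp add: cj_uminus C_shift_\<delta>)

lemma B_shift: "cj (zmul k \<epsilon>) (B i j) = B (i + k) (j + k)"
  unfolding B_def by (subst cj_cj_distrib) (simp add: C_shift_\<epsilon>)

text \<open>Such a pair is a \<open>\<delta>\<close>-translate of an element built from the
  generators \<open>a\<close> alone. These commute with \<open>\<epsilon>\<close>, and so does
  \<open>\<delta>\<close>.\<close>

lemma A_\<epsilon>:
  assumes "i < j" "j < i + int m"
  shows "cj (zmul k \<epsilon>) (A i j) = A i j"
proof -
  define d where "d = nat (j - i)"
  have d: "0 < d" "d < m" "j = i + int d" using assms by (auto simp: d_def)
  have "commute \<epsilon> (bkl g l (l + d))"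
  proof (rule commute_bkl)
    show "commute \<epsilon> (g r)" if "l \<le> r" "r < l + d" for r
    proof -
      have "g r = a (r - l)" "r - l < m - 1" using that d l_pos by (auto simp: g_def)
      then show ?thesis using a_\<epsilon>[of "r - l"] by simp
    qed
  qed (use d in simp)
  then have "commute \<epsilon> (A 0 (int d))" using bkl_A[of 0 d] d by simp
  then have "cj (zmul k \<epsilon>) (A 0 (int d)) = A 0 (int d)" by (intro cj_fixed_zmul cj_fixed)
  then have "cj (zmul i \<delta>) (cj (zmul k \<epsilon>) (A 0 (int d))) = cj (zmul i \<delta>) (A 0 (int d))" by simp
  then have "cj (zmul k \<epsilon>) (cj (zmul i \<delta>) (A 0 (int d))) = cj (zmul i \<delta>) (A 0 (int d))"
    using cj_commute[OF commute_zmul_\<delta>\<epsilon>] by metis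
  then show ?thesis by (simp add: A_shift d(3) add.commute)
qed

lemma B_\<delta>:
  assumes "i < j" "j < i + int l"
  shows "cj (zmul k \<delta>) (B i j) = B i j"
proof -
  define d where "d = nat (j - i)"
  have d: "0 < d" "d < l" "i = j - int d" using assms by (auto simp: d_def)
  have "commute \<delta> (bkl g (l - 1 - d) (l - 1 - 0))"
  proof (rule commute_bkl)
    show "commute \<delta> (g r)" if "l - 1 - d \<le> r" "r < l - 1 - 0" for r
      using b_\<delta>[of "l - 2 - r"] that d by (simp add: g_def)
  qed (use d in simp)
  then have "commute \<delta> (B (- int d) 0)" using bkl_B[of 0 d] d by simp
  then have "cj (zmul k \<delta>) (B (- int d) 0) = B (- int d) 0" by (intro cj_fixed_zmul cj_fixed)
  then have "cj (zmul j \<epsilon>) (cj (zmul k \<delta>) (B (- int d) 0)) = cj (zmul j \<epsilon>) (B (- int d) 0)" by simp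
  then have "cj (zmul k \<delta>) (cj (zmul j \<epsilon>) (B (- int d) 0)) = cj (zmul j \<epsilon>) (B (- int d) 0)"
    using cj_commute[OF commute_zmul_\<delta>\<epsilon>] by metis
  then show ?thesis by (simp add: B_shift d(3) add.commute)
qed

lemma C_period_\<delta>: "C (i + int m) j = C i (j - int l)"
  using C_period[of i "j - int l"] by simp

lemma C_period_\<epsilon>: "C i (j + int l) = C (i - int m) j"
  using C_period[of "i - int m" j] by simp

lemma A_period: "i < j \<Longrightarrow> j < i + int m \<Longrightarrow> A (i + int m) (j + int m) = A i j"
proof -
  assume ij: "i < j" "j < i + int m"
  have "A (i + int m) (j + int m) = cj (zmul (- int l) \<epsilon>) (A i j)"
    unfolding A_def by (subst cj_cj_distrib) (simp add: cj_uminus C_shift_\<epsilon> C_period_\<delta>)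
  then show ?thesis using A_\<epsilon>[OF ij] by simp
qed

lemma B_period: "i < j \<Longrightarrow> j < i + int l \<Longrightarrow> B (i + int l) (j + int l) = B i j"
proof -
  assume ij: "i < j" "j < i + int l"
  have "B (i + int l) (j + int l) = cj (zmul (- int m) \<delta>) (B i j)"
    unfolding B_def by (subst cj_cj_distrib) (simp add: C_shift_\<delta> C_period_\<epsilon>)
  then show ?thesis using B_\<delta>[OF ij] by simp
qed

lemma C_period2': "C i (j + 2 * int l) = C i j"
proof -
  have "C i (j + 2 * int l) = C (i - 2 * int m) j"
    using C_period_\<epsilon>[of i "j + int l"] C_period_\<epsilon>[of "i - int m" j] by (simp add: algebra_simps)
  then show ?thesis using C_period2[of "i - 2 * int m" j] by simp
qed

lemma C_multiple: "C (i + 2 * int m * z) j = C i j"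
proof (induction z rule: int_induct[where k = 0])
  case (step1 z)
  then show ?case using C_period2[of "i + 2 * int m * z" j] by (simp add: algebra_simps)
next
  case (step2 z)
  then show ?case using C_period2[of "i + 2 * int m * (z - 1)" j] by (simp add: algebra_simps)
qed simp

lemma C_multiple': "C i (j + 2 * int l * z) = C i j"
proof (induction z rule: int_induct[where k = 0])
  case (step1 z)
  then show ?case using C_period2'[of i "j + 2 * int l * z"] by (simp add: algebra_simps)
next
  case (step2 z)
  then show ?case using C_period2'[of i "j + 2 * int l * (z - 1)"] by (simp add: algebra_simps)
qed simp

lemma commute_C_signs: "commute (C i j) (C i (j + int l))"
proof -
  have "C 0 (int l) = cj \<sigma> t"
    using C_period_\<epsilon>[of 0 0] C_period2[of "- int m" 0] C_m by simp
  then have "commute (C 0 0) (C 0 (int l))" using t_s by simp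
  then have "commute (cj (zmul i \<delta> + zmul j \<epsilon>) (C 0 0)) (cj (zmul i \<delta> + zmul j \<epsilon>) (C 0 (int l)))"
    by (simp only: commute_cj_cj)
  then show ?thesis unfolding C_shift by (simp add: ac_simps)
qed

lemma sum_g: "sum_list (map g (rev [0..<m + l - 1])) = u + t + v"
proof -
  have "[0..<m + l - 1] = [0..<l - 1] @ [l - 1] @ map (\<lambda>k. l + k) [0..<m - 1]"
  proof -
    have "[0..<m + l - 1] = [0..<l - 1] @ [l - 1..<m + l - 1]"
      using upt_add_eq_append[of 0 "l - 1" m] l_pos by (simp add: ac_simps)
    moreover have "[l - 1..<m + l - 1] = (l - 1) # [l..<l + (m - 1)]"
      using m_pos l_pos by (subst upt_conv_Cons) (auto simp: ac_simps)
    moreover have "[l..<l + (m - 1)] = map (\<lambda>k. l + k) [0..<m - 1]"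
      using map_add_upt[of l "m - 1"] by (simp add: ac_simps)
    ultimately show ?thesis by simp
  qed
  then have "sum_list (map g (rev [0..<m + l - 1]))
      = sum_list (map (\<lambda>k. g (l + k)) (rev [0..<m - 1])) + g (l - 1) + sum_list (map g (rev [0..<l - 1]))"
    by (simp add: rev_map o_def add.assoc)
  also have "map (\<lambda>k. g (l + k)) (rev [0..<m - 1]) = map a (rev [0..<m - 1])"
    using l_pos by (auto simp: g_def)
  also have "map g (rev [0..<l - 1]) = map b [0..<l - 1]"
    by (rule nth_equalityI) (auto simp: g_less rev_nth rev_map intro!: arg_cong[where f = b])
  finally show ?thesis by (simp only: u_def v_def g_mid)
qed

text \<open>The counterpart of \<open>w_factorization\<close> at \<open>i = j = 0\<close>:
  \<open>u + t + v\<close> is the value of the cycle of \<open>window 0 0\<close>, conjugation by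
  \<open>\<delta>\<close> moves it to \<open>window 1 0\<close>, and
  \<open>\<delta> + \<epsilon>\<close> stands for \<open>w\<close>.\<close>

lemma coxeter_identity: "t + cj \<delta> (u + t + v) = \<delta> + \<epsilon>"
proof -
  have "commute v (u + \<sigma>)"
    by (rule commute_add) (simp_all add: u_v \<sigma>_v)
  then have "cj \<delta> (u + t + v) = - \<sigma> + t + (u + \<sigma>) + v"
    by (simp add: cj_def \<delta>_def minus_add add.assoc diff_conv_add_uminus del: add_uminus_conv_diff)
  moreover have "t + (- \<sigma> + t) = \<tau>" using twist by (simp add: add.assoc diff_conv_add_uminus del: add_uminus_conv_diff)
  ultimately have "t + cj \<delta> (u + t + v) = \<tau> + \<delta> + v"
    by (simp add: \<delta>_def flip: add.assoc)
  then show ?thesis using \<tau>_\<delta> by (simp add: \<epsilon>_def add.assoc)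
qed

end

lemma cyc_map_upt: "cyc \<psi> (map y [0..<Suc M]) = sum_list (map (\<lambda>k. \<psi> (y k, y (Suc k))) (rev [0..<M]))"
proof (induction M)
  case (Suc M)
  have "cyc \<psi> (map y [0..<Suc M] @ [y (Suc M)]) = \<psi> (y M, y (Suc M)) + cyc \<psi> (map y [0..<Suc M])"
    by (subst cyc_snoc) simp_all
  then show ?case using Suc by simp
qed simp

lemma int_multiple_bound: "0 < c \<Longrightarrow> - c < 2 * c * z \<Longrightarrow> 2 * c * z < 2 * c \<Longrightarrow> z = (0 :: int)"
  by (smt (verit) mult_le_cancel_left1 mult_minus_right mult_less_cancel_left_pos mult.right_neutral)

section \<open>Representing all reflections\<close>

locale antiperiodic =
  fixes c :: nat and f :: "int \<Rightarrow> int"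
  assumes c_pos: "0 < c" and shift: "f (i + int c) = - f i"
    and nonzero: "f i \<noteq> 0" and inj: "r < c \<Longrightarrow> \<bar>f i\<bar> = \<bar>f (i + int r)\<bar> \<Longrightarrow> r = 0"
begin

lemma multiple: "f (i + int c * z) = (if even z then f i else - f i)"
proof (induction z rule: int_induct[where k = 0])
  case (step1 z)
  then show ?case using shift[of "i + int c * z"] by (simp add: algebra_simps split: if_splits)
next
  case (step2 z)
  then show ?case using shift[of "i + int c * (z - 1)"] by (auto simp: algebra_simps split: if_splits)
qed simp

lemma eqD: "f i = f i' \<Longrightarrow> \<exists>z. i' = i + 2 * int c * z"
proof -
  assume eq: "f i = f i'"
  define r where "r = nat ((i' - i) mod int c)"
  define z where "z = (i' - i) div int c"
  have r: "int r = (i' - i) mod int c" using c_pos by (simp add: r_def)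
  have "int r < int c" unfolding r using c_pos by simp
  moreover have i': "i' = (i + int r) + int c * z" unfolding r z_def by simp
  then have "\<bar>f i'\<bar> = \<bar>f (i + int r)\<bar>" using multiple[of "i + int r" z] by (simp split: if_splits)
  ultimately have "r = 0" using inj[of r i] eq by simp
  then have "f i' = (if even z then f i else - f i)" using i' multiple[of i z] by simp
  then have "even z" using eq nonzero[of i] by (auto split: if_splits)
  then show ?thesis using i' \<open>r = 0\<close> by (auto elim!: evenE)
qed

lemma pair_eqD:
  assumes "i < j" "j < i + int c" "i' < j'" "j' < i' + int c"
    and "f i = f i' \<and> f j = f j' \<or> f i = f j' \<and> f j = f i'"
  shows "\<exists>z. i' = i + 2 * int c * z \<and> j' = j + 2 * int c * z"
  using assms(5)
proof
  assume "f i = f i' \<and> f j = f j'"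
  then obtain z z' where z: "i' = i + 2 * int c * z" "j' = j + 2 * int c * z'"
    using eqD[of i i'] eqD[of j j'] by blast
  have "z' - z = 0"
    by (rule int_multiple_bound[of "int c"]) (use assms c_pos z in \<open>auto simp: algebra_simps\<close>)
  with z show ?thesis by auto
next
  assume "f i = f j' \<and> f j = f i'"
  then obtain z z' where z: "j' = i + 2 * int c * z" "i' = j + 2 * int c * z'"
    using eqD[of i j'] eqD[of j i'] by blast
  \<comment> \<open>If the letters were interchanged, the two index differences would add up to a
    multiple of \<open>2 * c\<close> strictly between 0 and \<open>2 * c\<close>.\<close>
  have "2 * int c * (z - z') = (j' - i') + (j - i)" by (simp add: z algebra_simps)
  then have pos: "0 < 2 * int c * (z - z')" and "2 * int c * (z - z') < 2 * int c"
    using assms(1-4) by linarith+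
  then have "z - z' = 0"
    using c_pos by (intro int_multiple_bound[of "int c"]) linarith+
  with pos show ?thesis by simp
qed

end

context two_cycles
begin

lemma antiperiodic_p: "antiperiodic m p"
  using m_pos p_shift pq_bounds(1) abs_p_inj[of 0] by unfold_locales auto

lemma antiperiodic_q: "antiperiodic l q"
proof
  fix r i assume "r < l" "\<bar>q i\<bar> = \<bar>q (i + int r)\<bar>"
  then show "r = 0"
    using abs_q_inj[of 0 r "i + int l - 1"] l_pos by simp
qed (use l_pos q_shift pq_bounds(2) in auto)

end

locale letter_rep = two_cycles n m l p q w + twisted_chain m l a b \<sigma> \<tau> t
  for n m l p q w and a b :: "nat \<Rightarrow> 'g::group_add" and \<sigma> \<tau> t :: 'g
begin

sublocale p: antiperiodic m p by (rule antiperiodic_p)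
sublocale q: antiperiodic l q by (rule antiperiodic_q)

text \<open>A reflection has many names by indices, so the assignment is first a relation; that it
  is single-valued is where all the periodicities are used.\<close>

inductive rep :: "int \<Rightarrow> int \<Rightarrow> 'g \<Rightarrow> bool" where
  rep_C: "rep (p i) (q j) (C i j)"
| rep_A: "i < j \<Longrightarrow> j < i + int m \<Longrightarrow> rep (p i) (p j) (A i j)"
| rep_B: "i < j \<Longrightarrow> j < i + int l \<Longrightarrow> rep (q i) (q j) (B i j)"
| rep_sym: "rep x y z \<Longrightarrow> rep y x z"

lemma p_neq_q: "p i \<noteq> q j" "q j \<noteq> p i"
  using abs_p_neq_q[of i j] by auto

lemma C_eqI: "p i = p i' \<Longrightarrow> q j = q j' \<Longrightarrow> C i j = C i' j'"
  by (auto dest!: p.eqD q.eqD simp: C_multiple C_multiple')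

lemma A_eqI:
  assumes "i < j" "j < i + int m" "i' < j'" "j' < i' + int m" "p i = p i' \<and> p j = p j' \<or> p i = p j' \<and> p j = p i'"
  shows "A i j = A i' j'"
  using p.pair_eqD[OF assms] by (auto simp: A_def C_multiple)

lemma B_eqI:
  assumes "i < j" "j < i + int l" "i' < j'" "j' < i' + int l" "q i = q i' \<and> q j = q j' \<or> q i = q j' \<and> q j = q i'"
  shows "B i j = B i' j'"
  using q.pair_eqD[OF assms] by (auto simp: B_def C_multiple')

lemma rep_cases:
  "rep x y z \<Longrightarrow>
    (\<exists>i j. (x = p i \<and> y = q j \<or> x = q j \<and> y = p i) \<and> z = C i j) \<or>
    (\<exists>i j. i < j \<and> j < i + int m \<and> (x = p i \<and> y = p j \<or> x = p j \<and> y = p i) \<and> z = A i j) \<or>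
    (\<exists>i j. i < j \<and> j < i + int l \<and> (x = q i \<and> y = q j \<or> x = q j \<and> y = q i) \<and> z = B i j)"
  by (induction rule: rep.induct) blast+

lemma rep_unique:
  assumes "rep x y z" "rep x y z'"
  shows "z = z'"
proof -
  note c' = rep_cases[OF assms(2)]
  from rep_cases[OF assms(1)] consider
    (C) i j where "x = p i \<and> y = q j \<or> x = q j \<and> y = p i" "z = C i j"
  | (A) i j where "i < j" "j < i + int m" "x = p i \<and> y = p j \<or> x = p j \<and> y = p i" "z = A i j"
  | (B) i j where "i < j" "j < i + int l" "x = q i \<and> y = q j \<or> x = q j \<and> y = q i" "z = B i j"
    by blast
  then show ?thesis
  proof cases
    case C
    then have "\<not> (x \<in> range p \<and> y \<in> range p)" "\<not> (x \<in> range q \<and> y \<in> range q)"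
      using p_neq_q by auto
    with c' obtain i' j' where "x = p i' \<and> y = q j' \<or> x = q j' \<and> y = p i'" "z' = C i' j'"
      by blast
    with C show ?thesis using C_eqI[of i i' j j'] p_neq_q by auto
  next
    case A
    then have "\<not> (x \<in> range q)" "\<not> (y \<in> range q)"
      using p_neq_q by auto
    with c' obtain i' j' where "i' < j'" "j' < i' + int m" "x = p i' \<and> y = p j' \<or> x = p j' \<and> y = p i'" "z' = A i' j'"
      by blast
    with A show ?thesis using A_eqI[of i j i' j'] by auto
  next
    case B
    then have "\<not> (x \<in> range p)" "\<not> (y \<in> range p)"
      using p_neq_q by auto
    with c' obtain i' j' where "i' < j'" "j' < i' + int l" "x = q i' \<and> y = q j' \<or> x = q j' \<and> y = q i'" "z' = B i' j'"
      by blast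
    with B show ?thesis using B_eqI[of i j i' j'] by auto
  qed
qed

lemma rep_uminus: "rep x y z \<Longrightarrow> rep (- x) (- y) z"
proof (induction rule: rep.induct)
  case (rep_C i j)
  then show ?case using rep.rep_C[of "i + int m" "j + int l"] by (simp add: p_shift q_shift C_period)
next
  case (rep_A i j)
  then show ?case using rep.rep_A[of "i + int m" "j + int m"] by (simp add: p_shift A_period)
next
  case (rep_B i j)
  then show ?case using rep.rep_B[of "i + int l" "j + int l"] by (simp add: q_shift B_period)
qed (rule rep_sym)

definition \<psi> :: "int \<times> int \<Rightarrow> 'g" where
  "\<psi> = (\<lambda>(x, y). SOME z. rep x y z)"

lemma \<psi>_eq: "rep x y z \<Longrightarrow> \<psi> (x, y) = z"
  unfolding \<psi>_def by (auto intro: some_equality rep_unique)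

lemma \<psi>_C: "\<psi> (p i, q j) = C i j" and \<psi>_A: "i < j \<Longrightarrow> j < i + int m \<Longrightarrow> \<psi> (p i, p j) = A i j"
  and \<psi>_B: "i < j \<Longrightarrow> j < i + int l \<Longrightarrow> \<psi> (q i, q j) = B i j"
  by (simp_all add: \<psi>_eq rep.intros)

sublocale even_pairs \<psi>
proof
  fix x y
  \<comment> \<open>Equality of the predicates makes the chosen values agree even at degenerate
    pairs, which represent nothing.\<close>
  have "rep x y = rep y x" using rep_sym by blast
  then show "\<psi> (x, y) = \<psi> (y, x)" by (simp add: \<psi>_def)
  have "rep (- x) (- y) = rep x y" using rep_uminus[of x y] rep_uminus[of "- x" "- y"] by auto
  then show "\<psi> (- x, - y) = \<psi> (x, y)" by (simp add: \<psi>_def)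
qed

definition shift :: "int \<Rightarrow> int \<Rightarrow> 'g" where
  "shift i j = zmul i \<delta> + zmul j \<epsilon>"

text \<open>Conjugation by \<open>shift i j\<close> moves \<open>window 0 0\<close> to
  \<open>window i j\<close>. For a pair inside one block the shift belonging to the other block acts
  trivially, so both shifts may be applied throughout.\<close>

lemma \<psi>_window:
  assumes k: "k < k'" "k' < n"
  shows "\<psi> (window i j ! k, window i j ! k') = cj (shift i j) (bkl g k k')"
proof -
  consider "k' < l" | "k < l" "l \<le> k'" | "l \<le> k" by linarith
  then show ?thesis
  proof cases
    case 1
    define s s' where "s = l - 1 - k'" and "s' = l - 1 - k"
    have s: "s < s'" "s' < l" "k = l - 1 - s'" "k' = l - 1 - s" using 1 k by (auto simp: s_def s'_def)
    have "\<psi> (window i j ! k, window i j ! k') = B (- int s' + j) (- int s + j)"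
      using s 1 k by (simp add: nth_window_q \<psi>_B of_nat_diff algebra_simps)
    also have "\<dots> = cj (zmul j \<epsilon>) (cj (zmul i \<delta>) (B (- int s') (- int s)))"
      using B_\<delta>[of "- int s'" "- int s" i] s by (simp add: B_shift)
    finally show ?thesis using bkl_B[OF s(1,2)] s by (simp add: shift_def cj_plus)
  next
    case 2
    define s r where "s = l - 1 - k" and "r = k' - l"
    have s: "s < l" "r < m" "k = l - 1 - s" "k' = l + r" using 2 k n_eq by (auto simp: s_def r_def)
    have "\<psi> (window i j ! k, window i j ! k') = C (int r + i) (- int s + j)"
      using s 2 nth_window_p[OF s(2), of i j] pair_sym[of "window i j ! k" "window i j ! k'"]
      by (simp add: nth_window_q \<psi>_C of_nat_diff algebra_simps)
    then show ?thesis using bkl_C[OF s(1,2)] s by (simp add: shift_def C_shift)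
  next
    case 3
    define r r' where "r = k - l" and "r' = k' - l"
    have r: "r < r'" "r' < m" "k = l + r" "k' = l + r'" using 3 k n_eq by (auto simp: r_def r'_def)
    have "\<psi> (window i j ! k, window i j ! k') = A (int r + i) (int r' + i)"
      using r nth_window_p[of r i j] nth_window_p[of r' i j] by (simp add: \<psi>_A algebra_simps)
    also have "\<dots> = cj (zmul j \<epsilon>) (cj (zmul i \<delta>) (A (int r) (int r')))"
      using A_\<epsilon>[of "int r + i" "int r' + i" j] r by (simp add: A_shift)
    finally show ?thesis using bkl_A[OF r(1,2)] r by (simp add: shift_def cj_plus)
  qed
qed

lemma n_conv: "n = Suc (m + l - 1)" using n_eq m_pos by simp

lemma window_conv: "window i j = map (\<lambda>k. window i j ! k) [0..<Suc (m + l - 1)]"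
  using map_nth[of "window i j"] n_conv by simp

lemma bkl_cj: "bkl (\<lambda>k. cj h (f k)) i k = cj h (bkl f i k)" for h :: 'g
  by (induction k) (simp_all add: cj_uminus[symmetric] cj_cj_distrib[symmetric])

lemma braid_chain_cj: "braid_chain N f \<Longrightarrow> braid_chain N (\<lambda>k. cj h (f k))" for h :: 'g
  by (auto simp: braid_chain_def)

lemma cyc_\<psi>_window: "cyc \<psi> (window i j) = cj (shift i j) (u + t + v)"
proof -
  have "cyc \<psi> (window i j) = sum_list (map (\<lambda>k. \<psi> (window i j ! k, window i j ! Suc k)) (rev [0..<m + l - 1]))"
    by (subst window_conv) (rule cyc_map_upt)
  also have "\<dots> = sum_list (map (\<lambda>k. cj (shift i j) (g k)) (rev [0..<m + l - 1]))"
    by (rule arg_cong[where f = sum_list]) (auto simp: \<psi>_window n_conv)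
  also have "\<dots> = cj (shift i j) (sum_list (map g (rev [0..<m + l - 1])))"
    by (simp add: cj_sum_list o_def)
  finally show ?thesis unfolding sum_g .
qed

sublocale dual_braid_rep n m l p q w \<psi> "\<delta> + \<epsilon>"
proof
  fix i j
  show "dual_rels \<psi> (window i j)"
    by (subst window_conv, rule dual_rels_bkl[OF braid_chain_cj[OF chain_g, of "shift i j"]])
      (simp add: bkl_cj \<psi>_window n_conv)
  show "commute (\<psi> (p i, q j)) (\<psi> (p i, - q j))"
    using commute_C_signs[of i j] \<psi>_C[of i j] \<psi>_C[of i "j + int l"] by (simp add: q_shift)
  have "shift (i + 1) j = \<delta> + shift i j"
    unfolding shift_def using zmul_add[of 1 i \<delta>] by (simp add: add.assoc add.commute[of i])
  then have "\<psi> (p i, q j) + cyc \<psi> (window (i + 1) j) = cj (shift i j) (t + cj \<delta> (u + t + v))"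
    using C_shift[of i j 0 0] by (simp add: \<psi>_C cyc_\<psi>_window shift_def cj_add cj_plus)
  also have "\<dots> = cj (shift i j) (\<delta> + \<epsilon>)" by (simp add: coxeter_identity)
  also have "\<dots> = \<delta> + \<epsilon>"
  proof (rule cj_fixed)
    have "commute (\<delta> + \<epsilon>) \<delta>" "commute (\<delta> + \<epsilon>) \<epsilon>"
      using commute_add[of \<delta> \<delta> \<epsilon>] commute_add[of \<epsilon> \<delta> \<epsilon>] \<delta>\<epsilon> by simp_all
    then have "commute (\<delta> + \<epsilon>) (shift i j)"
      unfolding shift_def by (intro commute_add commute_zmul)
    then show "commute (shift i j) (\<delta> + \<epsilon>)" by simp
  qed
  finally show "\<psi> (p i, q j) + cyc \<psi> (window (i + 1) j) = \<delta> + \<epsilon>" .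
qed

lemma \<psi>_a: "i < m - 1 \<Longrightarrow> \<psi> (p (int i), p (int (Suc i))) = a i"
  using \<psi>_A[of "int i" "int (Suc i)"] bkl_A[of i "Suc i"] g_ge[of "l + i"] by simp

lemma \<psi>_b: "j < l - 1 \<Longrightarrow> \<psi> (q (- int (Suc j)), q (- int j)) = b j"
proof -
  assume j: "j < l - 1"
  then have "Suc (l - 1 - Suc j) = l - 1 - j" by simp
  then have "bkl g (l - 1 - Suc j) (l - 1 - j) = g (l - 1 - Suc j)"
    by (metis bkl.simps(2) order_refl)
  moreover have "l - 2 - (l - 1 - Suc j) = j" using j by simp
  then have "g (l - 1 - Suc j) = b j" using j g_less[of "l - 1 - Suc j"] by simp
  ultimately show ?thesis using \<psi>_B[of "- int (Suc j)" "- int j"] bkl_B[of j "Suc j"] j by simp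
qed

lemma \<psi>_t: "\<psi> (p 0, q 0) = t"
  by (simp add: \<psi>_C)

lemma \<psi>_s: "\<psi> (p 0, - q 0) = cj \<sigma> t"
proof -
  have "\<psi> (p 0, - q 0) = \<psi> (p (int m), q 0)"
    using pair_uminus[of "p (int m)" "q 0"] p_shift[of 0] by simp
  then show ?thesis by (simp add: \<psi>_C C_m)
qed

end

section \<open>Matrices of signed permutations\<close>

text \<open>Row \<open>i\<close> records the image of \<open>i + 1\<close>, so that matrix
  multiplication matches composition from left to right.\<close>

definition smat :: "nat \<Rightarrow> int perms \<Rightarrow> int mat" where
  "smat n f = mat n n (\<lambda>(i, j). if \<bar>app f (int (i + 1))\<bar> = int (j + 1) then sgn (app f (int (i + 1))) else 0)"

lemma smat_carrier [simp]: "smat n f \<in> carrier_mat n n" "dim_row (smat n f) = n" "dim_col (smat n f) = n"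
  by (simp_all add: smat_def)

lemma smat_index: "i < n \<Longrightarrow> j < n \<Longrightarrow>
    smat n f $$ (i, j) = (if \<bar>app f (int (i + 1))\<bar> = int (j + 1) then sgn (app f (int (i + 1))) else 0)"
  by (simp add: smat_def)

lemma signed_column:
  assumes "signed n f" "i < n"
  obtains k where "k < n" "\<bar>app f (int (i + 1))\<bar> = int (k + 1)"
proof -
  have "\<bar>app f (int (i + 1))\<bar> \<le> int n" using assms by (simp add: signed_app_bound)
  moreover have "app f (int (i + 1)) \<noteq> 0"
    using app_eq_iff[of f "int (i + 1)" 0] signed_app_0[OF assms(1)] by simp
  ultimately have "nat \<bar>app f (int (i + 1))\<bar> - 1 < n" "\<bar>app f (int (i + 1))\<bar> = int (nat \<bar>app f (int (i + 1))\<bar> - 1 + 1)"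
    by auto
  then show thesis by (rule that)
qed

lemma sgn_app_abs:
  assumes "signed n g" "y \<noteq> 0"
  shows "\<bar>app g \<bar>y\<bar>\<bar> = \<bar>app g y\<bar>" "sgn y * sgn (app g \<bar>y\<bar>) = sgn (app g y)"
  using assms signed_app_uminus[OF assms(1), of y] by (cases "y > 0"; simp add: abs_if sgn_if)+

lemma smat_mult:
  assumes f: "signed n f" and g: "signed n g"
  shows "smat n f * smat n g = smat n (f + g)"
proof (rule eq_matI)
  fix i j assume "i < dim_row (smat n (f + g))" "j < dim_col (smat n (f + g))"
  then have ij: "i < n" "j < n" by simp_all
  let ?y = "app f (int (i + 1))"
  obtain k where k: "k < n" "\<bar>?y\<bar> = int (k + 1)" using f ij(1) by (rule signed_column)
  have y: "?y \<noteq> 0" using k by auto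
  have "(smat n f * smat n g) $$ (i, j) = (\<Sum>r<n. smat n f $$ (i, r) * smat n g $$ (r, j))"
    using ij by (simp add: scalar_prod_def lessThan_atLeast0)
  also have "\<dots> = (\<Sum>r<n. if r = k then smat n f $$ (i, k) * smat n g $$ (k, j) else 0)"
    by (rule sum.cong) (use ij k in \<open>auto simp: smat_index\<close>)
  also have "\<dots> = sgn ?y * smat n g $$ (k, j)"
    using k ij by (simp add: smat_index)
  also have "\<dots> = smat n (f + g) $$ (i, j)"
    using k ij sgn_app_abs[OF g y] by (simp add: smat_index)
  finally show "(smat n f * smat n g) $$ (i, j) = smat n (f + g) $$ (i, j)" .
qed simp_all

lemma smat_zero: "smat n 0 = 1\<^sub>m n"
  by (rule eq_matI) (auto simp: smat_def)

lemma smat_inj: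
  assumes f: "signed n f" and g: "signed n g" and eq: "smat n f = smat n g"
  shows "f = g"
proof -
  have pos: "app f (int (i + 1)) = app g (int (i + 1))" if i: "i < n" for i
  proof -
    obtain k where k: "k < n" "\<bar>app f (int (i + 1))\<bar> = int (k + 1)" using f i by (rule signed_column)
    then have "smat n g $$ (i, k) = sgn (app f (int (i + 1)))" "app f (int (i + 1)) \<noteq> 0"
      using i by (auto simp: smat_index simp flip: eq)
    then have "\<bar>app g (int (i + 1))\<bar> = int (k + 1)" "sgn (app g (int (i + 1))) = sgn (app f (int (i + 1)))"
      using i k by (auto simp: smat_index sgn_0_0 split: if_splits)
    then show ?thesis using k(2) by (metis mult_sgn_abs)
  qed
  show ?thesis
  proof (rule perms_eqI)
    fix x
    have nat: "app f y = app g y" if "1 \<le> y" "y \<le> int n" for y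
      using pos[of "nat y - 1"] that by simp
    consider "\<bar>x\<bar> > int n" | "x = 0" | "1 \<le> x" "x \<le> int n" | "1 \<le> - x" "- x \<le> int n" by linarith
    then show "app f x = app g x"
    proof cases
      case 4
      then show ?thesis using nat[of "- x"] f g by (simp add: signed_app_uminus)
    qed (use f g nat in \<open>auto simp: signed_app_0 signed_def\<close>)
  qed
qed

lemma Collect_unique:
  "P a \<Longrightarrow> (\<And>a'. P a' \<Longrightarrow> a' = a) \<Longrightarrow> {a'. P a' \<and> R a'} = (if R a then {a} else {})"
  unfolding if_split[where P = "\<lambda>S. _ = S"] by blast

lemma marked_cycle_eq_smat:
  assumes d: "distinct (map abs xs)" "0 \<notin> set xs"
    and f: "\<And>a. a < length xs \<Longrightarrow> app f \<bar>xs ! a\<bar> = sgn (xs ! a) * \<bar>xs ! ((a + 1) mod length xs)\<bar>"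
    and fix': "\<And>x. 1 \<le> x \<Longrightarrow> x \<le> int n \<Longrightarrow> x \<notin> abs ` set xs \<Longrightarrow> app f x = x"
  shows "marked_cycle n xs = smat n f"
proof (rule eq_matI)
  fix i j assume "i < dim_row (smat n f)" "j < dim_col (smat n f)"
  then have ij: "i < n" "j < n" by simp_all
  have mc: "marked_cycle n xs $$ (i, j) =
      (if \<exists>a<length xs. \<bar>xs ! a\<bar> = int (i + 1)
       then (\<Sum>a | a < length xs \<and> \<bar>xs ! a\<bar> = int (i + 1) \<and>
               \<bar>xs ! ((a + 1) mod length xs)\<bar> = int (j + 1). sgn (xs ! a))
       else if i = j then 1 else 0)"
    using ij by (simp add: marked_cycle_def)
  show "marked_cycle n xs $$ (i, j) = smat n f $$ (i, j)"
  proof (cases "\<exists>a<length xs. \<bar>xs ! a\<bar> = int (i + 1)")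
    case True
    then obtain a where a: "a < length xs" "\<bar>xs ! a\<bar> = int (i + 1)" by blast
    have uniq: "a' = a" if "a' < length xs" "\<bar>xs ! a'\<bar> = int (i + 1)" for a'
      using nth_eq_iff_index_eq[OF d(1), of a' a] a that by simp
    let ?s = "(a + 1) mod length xs"
    have s: "?s < length xs" using a(1) by (intro mod_less_divisor) linarith
    have ne: "xs ! a \<noteq> 0" "xs ! ?s \<noteq> 0" using d(2) nth_mem[OF a(1)] nth_mem[OF s] by metis+
    \<comment> \<open>The entries have distinct absolute values, so the sum in
      \<open>marked_cycle\<close> has at most one term.\<close>
    have eq: "{a'. a' < length xs \<and> \<bar>xs ! a'\<bar> = int (i + 1) \<and> \<bar>xs ! ((a' + 1) mod length xs)\<bar> = int (j + 1)}
        = (if \<bar>xs ! ?s\<bar> = int (j + 1) then {a} else {})"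
      using Collect_unique[of "\<lambda>a'. a' < length xs \<and> \<bar>xs ! a'\<bar> = int (i + 1)" a
          "\<lambda>a'. \<bar>xs ! ((a' + 1) mod length xs)\<bar> = int (j + 1)", OF conjI[OF a] uniq]
      unfolding conj_assoc by blast
    have "marked_cycle n xs $$ (i, j) = (if \<bar>xs ! ?s\<bar> = int (j + 1) then sgn (xs ! a) else 0)"
      unfolding mc eq using True by simp
    moreover have "\<bar>app f (int (i + 1))\<bar> = \<bar>xs ! ?s\<bar>" "sgn (app f (int (i + 1))) = sgn (xs ! a)"
      using f[OF a(1)] a(2) ne by (simp_all add: abs_mult sgn_mult abs_sgn_eq)
    ultimately show ?thesis using ij by (simp add: smat_index)
  next
    case False
    then have "int (i + 1) \<notin> abs ` set xs" by (auto simp: in_set_conv_nth)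
    then have "app f (int (i + 1)) = int (i + 1)" using ij by (intro fix') auto
    moreover have "marked_cycle n xs $$ (i, j) = (if i = j then 1 else 0)"
      unfolding mc by (simp only: False if_False)
    ultimately show ?thesis using ij by (cases "i = j") (simp_all add: smat_index)
  qed
qed (simp_all add: marked_cycle_def)

lemma marked_transposition:
  assumes "0 < i" "0 < j" "i \<noteq> j"
  shows "marked_cycle n [int i, int j] = smat n (rfl (int i, int j))"
    and "marked_cycle n [- int i, - int j] = smat n (rfl (int i, - int j))"
proof -
  show "marked_cycle n [int i, int j] = smat n (rfl (int i, int j))"
    by (rule marked_cycle_eq_smat) (use assms in \<open>auto simp: app_rfl swap_pm_def less_Suc_eq\<close>)
  show "marked_cycle n [- int i, - int j] = smat n (rfl (int i, - int j))"
    by (rule marked_cycle_eq_smat) (use assms in \<open>auto simp: app_rfl swap_pm_def less_Suc_eq\<close>)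
qed

lemma D_reflections_eq: "D_reflections n = (\<lambda>p. smat n (rfl p)) ` refl_pairs n"
proof
  show "D_reflections n \<subseteq> (\<lambda>p. smat n (rfl p)) ` refl_pairs n"
    by (auto simp: D_reflections_def marked_transposition refl_pairs_def intro!: imageI)
  show "(\<lambda>p. smat n (rfl p)) ` refl_pairs n \<subseteq> D_reflections n"
  proof (clarsimp)
    fix a b assume ab: "(a, b) \<in> refl_pairs n"
    have main: "smat n (rfl (a, b)) \<in> D_reflections n" if "0 < a" "a < \<bar>b\<bar>" "\<bar>b\<bar> \<le> int n" for a b
    proof (cases "b > 0")
      case True
      then show ?thesis
        using that marked_transposition(1)[of "nat a" "nat b" n] unfolding D_reflections_def
        by (intro UnI1 CollectI exI[of _ "nat a"] exI[of _ "nat b"]) auto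
    next
      case False
      then show ?thesis
        using that marked_transposition(2)[of "nat a" "nat (- b)" n] unfolding D_reflections_def
        by (intro UnI2 CollectI exI[of _ "nat a"] exI[of _ "nat (- b)"]) auto
    qed
    have main': "smat n (rfl (a, b)) \<in> D_reflections n" if "\<bar>a\<bar> < \<bar>b\<bar>" "a \<noteq> 0" "\<bar>b\<bar> \<le> int n" for a b
      using main[of a b] main[of "- a" "- b"] that rfl_uminus[of a b] by (cases "a > 0") auto
    show "smat n (rfl (a, b)) \<in> D_reflections n"
      using main'[of a b] main'[of b a] ab rfl_sym[of a b] by (cases "\<bar>a\<bar> < \<bar>b\<bar>") (auto simp: refl_pairs_def)
  qed
qed

lemma smat_rfl_D_group:
  assumes ab: "(a, b) \<in> refl_pairs n"
  shows "smat n (rfl (a, b)) \<in> carrier (D_group n)"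
proof -
  let ?f = "rfl (a, b)"
  have s: "signed n ?f" by (rule signed_rfl[OF ab])
  have ne: "app ?f (int (i + 1)) \<noteq> 0" for i
    using app_eq_iff[of ?f "int (i + 1)" 0] signed_app_0[OF s] by simp
  have nz: "smat n ?f $$ (i, j) \<noteq> 0 \<longleftrightarrow> \<bar>app ?f (int (i + 1))\<bar> = int (j + 1)" if "i < n" "j < n" for i j
    using that ne[of i] by (simp add: smat_index sgn_0_0)
  have inv: "app ?f (app ?f x) = x" for x
    by (metis app_plus app_zero rfl_rfl)
  have symm: "\<bar>app ?f (int (i + 1))\<bar> = int (j + 1) \<longleftrightarrow> \<bar>app ?f (int (j + 1))\<bar> = int (i + 1)" for i j
    using signed_app_abs_eq_iff[OF s, of "app ?f (int (i + 1))" "int (j + 1)"] inv[of "int (i + 1)"] by auto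
  have row: "\<exists>!j. j < n \<and> \<bar>app ?f (int (i + 1))\<bar> = int (j + 1)" if i: "i < n" for i
  proof -
    obtain k where "k < n" "\<bar>app ?f (int (i + 1))\<bar> = int (k + 1)" using s i by (rule signed_column)
    then show ?thesis by (intro ex1I[of _ k]) auto
  qed
  have 1: "\<exists>!j. j < n \<and> smat n ?f $$ (i, j) \<noteq> 0" if "i < n" for i
    using row[OF that] nz[OF that] by metis
  have 2: "\<exists>!i. i < n \<and> smat n ?f $$ (i, j) \<noteq> 0" if "j < n" for j
    using row[OF that] nz[OF _ that] symm by metis
  have 3: "smat n ?f $$ (i, j) \<in> {1, - 1}" if "i < n" "j < n" "smat n ?f $$ (i, j) \<noteq> 0" for i j
    using that by (auto simp: smat_index sgn_if split: if_splits)
  have "(\<Prod>p\<in>{(i, j). i < n \<and> j < n \<and> smat n ?f $$ (i, j) \<noteq> 0}. smat n ?f $$ p) = (\<Prod>i<n. sgn (app ?f (int (i + 1))))"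
  proof (rule prod.reindex_bij_witness[where i = "\<lambda>i. (i, nat \<bar>app ?f (int (i + 1))\<bar> - 1)" and j = fst])
    fix i assume i: "i \<in> {..<n}"
    then have "i < n" by simp
    with s obtain k where k: "k < n" "\<bar>app ?f (int (i + 1))\<bar> = int (k + 1)" by (rule signed_column)
    have "nat \<bar>app ?f (int (i + 1))\<bar> - 1 = k" unfolding k(2) nat_int by simp
    then show "(i, nat \<bar>app ?f (int (i + 1))\<bar> - 1) \<in> {(i, j). i < n \<and> j < n \<and> smat n ?f $$ (i, j) \<noteq> 0}"
      using \<open>i < n\<close> k nz[of i k] by simp
  qed (auto simp: smat_index split: if_splits)
  also have "\<dots> = 1"
  proof -
    have "\<exists>A<n. \<bar>x\<bar> = int (A + 1)" if "x \<noteq> 0" "\<bar>x\<bar> \<le> int n" for x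
      using that by (intro exI[of _ "nat \<bar>x\<bar> - 1"]) auto
    moreover have bnd: "a \<noteq> 0" "b \<noteq> 0" "\<bar>a\<bar> \<noteq> \<bar>b\<bar>" "\<bar>a\<bar> \<le> int n" "\<bar>b\<bar> \<le> int n"
      using ab by (simp_all add: refl_pairs_def)
    ultimately obtain A B where AB: "A < n" "B < n" "\<bar>a\<bar> = int (A + 1)" "\<bar>b\<bar> = int (B + 1)" by metis
    \<comment> \<open>Only the two rows of the letters \<open>a\<close> and \<open>b\<close> can
      carry a minus sign, and both carry \<open>sgn a * sgn b\<close>; hence the entries multiply to
      1.\<close>
    define P where "P = {A, B}"
    define e where "e = sgn a * sgn b"
    have P: "P \<subseteq> {..<n}" "card P = 2" using AB bnd by (auto simp: P_def)
    have out: "app ?f (int (i + 1)) = int (i + 1)" if "i \<notin> P" for i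
      using that AB by (intro app_rfl_other) (auto simp: P_def)
    have "app ?f \<bar>a\<bar> = sgn a * b" "app ?f \<bar>b\<bar> = sgn b * a"
      using bnd(1-3) by (cases "a > 0"; cases "b > 0"; simp add: app_rfl swap_pm_def; linarith)+
    then have inP: "sgn (app ?f (int (i + 1))) = e" if "i \<in> P" for i
      using that AB(3,4) by (auto simp: P_def e_def sgn_mult)
    have "(\<Prod>i<n. sgn (app ?f (int (i + 1)))) = (\<Prod>i\<in>P. sgn (app ?f (int (i + 1))))"
      using P(1) out by (intro prod.mono_neutral_right) auto
    also have "\<dots> = e ^ card P" using inP by simp
    also have "\<dots> = 1" using bnd(1,2) P(2) by (auto simp: e_def sgn_if)
    finally show ?thesis .
  qed
  finally show ?thesis using 1 2 3 by (simp add: D_group_def)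
qed

section \<open>Carter's representatives\<close>

text \<open>The negative cycle \<open>e \<mapsto> e - 1 \<mapsto> \<cdots> \<mapsto> s + 1 \<mapsto> - e\<close>.\<close>

definition neg_cycle_fun :: "int \<Rightarrow> int \<Rightarrow> int \<Rightarrow> int" where
  "neg_cycle_fun s e x =
    (if s + 2 \<le> x \<and> x \<le> e then x - 1 else if x = s + 1 then - e
     else if s + 2 \<le> - x \<and> - x \<le> e then x + 1 else if x = - (s + 1) then e else x)"

definition neg_cycle_inv :: "int \<Rightarrow> int \<Rightarrow> int \<Rightarrow> int" where
  "neg_cycle_inv s e x =
    (if s + 1 \<le> x \<and> x < e then x + 1 else if x = - e then s + 1
     else if s + 1 \<le> - x \<and> - x < e then x - 1 else if x = e then - (s + 1) else x)"

definition neg_cycle :: "nat \<Rightarrow> nat \<Rightarrow> int perms" where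
  "neg_cycle s e = Perm (neg_cycle_fun (int s) (int e))"

lemma app_neg_cycle: "s < e \<Longrightarrow> app (neg_cycle s e) = neg_cycle_fun (int s) (int e)"
proof -
  assume "s < e"
  then have "bij (neg_cycle_fun (int s) (int e))"
    by (intro o_bij[of "neg_cycle_inv (int s) (int e)"])
      (auto simp: fun_eq_iff neg_cycle_fun_def neg_cycle_inv_def)
  then show ?thesis by (simp add: neg_cycle_def app_Perm)
qed

lemma signed_neg_cycle: "s < e \<Longrightarrow> e \<le> n \<Longrightarrow> signed n (neg_cycle s e)"
  by (auto simp: signed_def app_neg_cycle neg_cycle_fun_def)

lemma marked_neg_cycle:
  assumes se: "s < e"
  shows "marked_cycle n (map int (rev [s + 2..<e + 1]) @ [- int (s + 1)]) = smat n (neg_cycle s e)"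
proof -
  define xs where "xs = map int (rev [s + 2..<e + 1]) @ [- int (s + 1)]"
  have len: "length xs = e - s" using se by (simp add: xs_def del: upt_Suc)
  have nth: "xs ! a = (if a = e - s - 1 then - int (s + 1) else int (e - a))" if a: "a < e - s" for a
  proof (cases "a = e - s - 1")
    case False
    then have a': "a < length (rev [s + 2..<e + 1])" using a by (simp del: upt_Suc)
    then have "rev [s + 2..<e + 1] ! a = e - a" by (simp add: rev_nth del: upt_Suc)
    then show ?thesis using False a' by (simp add: xs_def nth_append del: upt_Suc)
  qed (simp add: xs_def nth_append del: upt_Suc)
  have abs_nth: "\<bar>xs ! a\<bar> = int (e - a)" if "a < e - s" for a
    unfolding nth[OF that] using that by auto
  have map_abs: "map abs xs = map (\<lambda>a. int (e - a)) [0..<e - s]"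
    by (rule nth_equalityI) (use len abs_nth in simp_all)
  have "marked_cycle n xs = smat n (neg_cycle s e)"
  proof (rule marked_cycle_eq_smat)
    show "distinct (map abs xs)"
      unfolding map_abs by (auto simp: distinct_map inj_on_def)
    show "0 \<notin> set xs" by (auto simp: xs_def)
    have "abs ` set xs = set (map abs xs)" by simp
    also have "\<dots> = (\<lambda>a. int (e - a)) ` {0..<e - s}" unfolding map_abs by simp
    also have "\<dots> = {int s + 1..int e}"
    proof (intro equalityI subsetI)
      fix x assume "x \<in> {int s + 1..int e}"
      then show "x \<in> (\<lambda>a. int (e - a)) ` {0..<e - s}"
        by (intro image_eqI[of _ _ "e - nat x"]) auto
    qed auto
    finally have set_abs: "abs ` set xs = {int s + 1..int e}" .
    show "app (neg_cycle s e) x = x" if "1 \<le> x" "x \<le> int n" "x \<notin> abs ` set xs" for x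
      using that se unfolding set_abs by (auto simp: app_neg_cycle neg_cycle_fun_def)
    show "app (neg_cycle s e) \<bar>xs ! a\<bar> = sgn (xs ! a) * \<bar>xs ! ((a + 1) mod length xs)\<bar>" if "a < length xs" for a
    proof -
      have a: "a < e - s" using that len by simp
      show ?thesis
      proof (cases "a = e - s - 1")
        case True
        then have "a + 1 = e - s" using a by linarith
        then have "(a + 1) mod length xs = 0" unfolding len by simp
        then have 1: "\<bar>xs ! ((a + 1) mod length xs)\<bar> = int e" using abs_nth[of 0] a by simp
        have 2: "xs ! a = - int (s + 1)" using nth[OF a] True by simp
        show ?thesis unfolding 1 2 app_neg_cycle[OF se] by (simp add: neg_cycle_fun_def)
      next
        case False
        then have a1: "a + 1 < e - s" using a by linarith
        then have "(a + 1) mod length xs = a + 1" unfolding len by (rule mod_less)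
        then have 1: "\<bar>xs ! ((a + 1) mod length xs)\<bar> = int (e - (a + 1))" using abs_nth[OF a1] by (simp only:)
        have 2: "xs ! a = int (e - a)" using nth[OF a] False by simp
        have "int (e - (a + 1)) = int (e - a) - 1" "int s + 2 \<le> int (e - a)" "int (e - a) \<le> int e"
          using a1 by linarith+
        moreover from this have "sgn (int (e - a)) = 1" by simp
        moreover have "neg_cycle_fun (int s) (int e) x = x - 1" if "int s + 2 \<le> x" "x \<le> int e" for x
          using that by (simp add: neg_cycle_fun_def)
        ultimately show ?thesis unfolding 1 2 app_neg_cycle[OF se] by (simp only: abs_of_nat mult_1_left)
      qed
    qed
  qed
  then show ?thesis by (simp only: xs_def)
qed

lemma carter_rep_eq:
  assumes "1 \<le> m" "m < n"
  shows "carter_rep m n = smat n (neg_cycle 0 m + neg_cycle m n)"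
proof -
  have "carter_rep m n = smat n (neg_cycle 0 m) * smat n (neg_cycle m n)"
    unfolding carter_rep_def using marked_neg_cycle[of 0 m n] marked_neg_cycle[of m n n] assms
    by (simp del: upt_Suc add: numeral_2_eq_2)
  then show ?thesis
    using assms by (simp add: smat_mult signed_neg_cycle)
qed

text \<open>The letter reached from \<open>e\<close> after \<open>i\<close> steps of the negative
  cycle on \<open>e, e - 1, ..., e - c + 1\<close>, each full turn reversing the sign.\<close>

definition cycle_letter :: "nat \<Rightarrow> nat \<Rightarrow> int \<Rightarrow> int" where
  "cycle_letter c e i = (if even (i div int c) then 1 else - 1) * (int e - i mod int c)"

lemma cycle_letter_shift: "0 < c \<Longrightarrow> cycle_letter c e (i + int c) = - cycle_letter c e i"
  by (simp add: cycle_letter_def)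

lemma abs_cycle_letter:
  assumes "0 < c" "c \<le> e"
  shows "\<bar>cycle_letter c e i\<bar> = int e - i mod int c" "int (e - c) < \<bar>cycle_letter c e i\<bar>" "\<bar>cycle_letter c e i\<bar> \<le> int e"
proof -
  have eq: "\<bar>cycle_letter c e i\<bar> = \<bar>int e - i mod int c\<bar>" by (simp add: cycle_letter_def abs_mult)
  have "i mod int c < int c" "0 \<le> i mod int c" "int c \<le> int e" "int (e - c) = int e - int c"
    using assms by simp_all
  then show "\<bar>cycle_letter c e i\<bar> = int e - i mod int c" "int (e - c) < \<bar>cycle_letter c e i\<bar>" "\<bar>cycle_letter c e i\<bar> \<le> int e"
    unfolding eq by linarith+
qed

lemma cycle_letter_surj:
  assumes "int (e - c) < \<bar>x\<bar>" "\<bar>x\<bar> \<le> int e" "c \<le> e"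
  shows "\<exists>i. x = cycle_letter c e i"
proof -
  have b: "0 \<le> int e - \<bar>x\<bar>" "int e - \<bar>x\<bar> < int c" using assms by auto
  show ?thesis
  proof (cases "x > 0")
    case True
    then show ?thesis using b
      by (intro exI[of _ "int e - \<bar>x\<bar>"]) (simp add: cycle_letter_def)
  next
    case False
    then show ?thesis using b cycle_letter_shift[of c e "int e - \<bar>x\<bar>"]
      by (intro exI[of _ "int e - \<bar>x\<bar> + int c"]) (auto simp: cycle_letter_def)
  qed
qed

lemma neg_cycle_letter:
  assumes "0 < c" "c \<le> e"
  shows "app (neg_cycle (e - c) e) (cycle_letter c e i) = cycle_letter c e (i + 1)"
proof -
  define r where "r = i mod int c"
  define z where "z = i div int c"
  have i: "i = r + int c * z" by (simp add: r_def z_def)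
  have r: "0 \<le> r" "r < int c" using assms by (simp_all add: r_def)
  have divmod: "(r + 1 + int c * z) div int c = (if r + 1 = int c then z + 1 else z)"
    "(r + 1 + int c * z) mod int c = (if r + 1 = int c then 0 else r + 1)"
  proof -
    have 1: "r + 1 + int c * z = int c * (z + 1)" if "r + 1 = int c" using that by (simp add: algebra_simps)
    have 2: "(r + 1) div int c = 0" "(r + 1) mod int c = r + 1" if "r + 1 \<noteq> int c"
      using that r by (auto intro: div_pos_pos_trivial mod_pos_pos_trivial)
    show "(r + 1 + int c * z) div int c = (if r + 1 = int c then z + 1 else z)"
      using 1 2 assms by (cases "r + 1 = int c") simp_all
    show "(r + 1 + int c * z) mod int c = (if r + 1 = int c then 0 else r + 1)"
      using 1 2 assms by (cases "r + 1 = int c") simp_all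
  qed
  have "cycle_letter c e (i + 1) = (if r + 1 = int c then (if even z then - 1 else 1) * int e
      else (if even z then 1 else - 1) * (int e - (r + 1)))"
  proof -
    have i1: "i + 1 = r + 1 + int c * z" using i by linarith
    show ?thesis unfolding cycle_letter_def i1 divmod by simp
  qed
  moreover have "cycle_letter c e i = (if even z then 1 else - 1) * (int e - r)"
    by (simp add: cycle_letter_def r_def z_def)
  ultimately show ?thesis
    using r assms by (cases "even z") (auto simp: app_neg_cycle neg_cycle_fun_def of_nat_diff)
qed

lemma neg_cycle_other:
  assumes "s < e" "\<bar>x\<bar> \<le> int s \<or> int e < \<bar>x\<bar>" "x \<noteq> 0"
  shows "app (neg_cycle s e) x = x"
  using assms by (auto simp: app_neg_cycle neg_cycle_fun_def)

lemma letters_map_signed: "signed n f \<Longrightarrow> letters n xs \<Longrightarrow> letters n (map (app f) xs)"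
proof -
  assume f: "signed n f" and xs: "letters n xs"
  have "distinct (map abs (map (app f) xs))"
    using xs signed_app_abs_eq_iff[OF f] by (simp add: letters_def distinct_map inj_on_def)
  moreover have "0 \<notin> set (map (app f) xs)"
    using xs signed_app_0[OF f] app_eq_iff[of f _ 0] by (auto simp: letters_def)
  moreover have "\<bar>app f x\<bar> \<in> {1..int n}" if "x \<in> set xs" for x
  proof -
    have "x \<noteq> 0" "\<bar>x\<bar> \<le> int n" using xs that by (auto simp: letters_def)
    then have "app f x \<noteq> 0" "\<bar>app f x\<bar> \<le> int n"
      using app_eq_iff[of f x 0] signed_app_0[OF f] signed_app_bound[OF f] by simp_all
    then show ?thesis by simp
  qed
  ultimately show ?thesis unfolding letters_def by auto
qed

text \<open>Sign and index shift in \<open>q\<close> are normalized: for trivial \<open>h\<close>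
  they give \<open>p 0 = m\<close> and \<open>q 0 = m + 1\<close>, so that the reflections attached
  below to the vertices \<open>k \<ge> 2\<close> become the transpositions of \<open>k - 1\<close>
  and \<open>k\<close>.\<close>

lemma two_cycles_carter:
  assumes m: "1 \<le> m" "m < n" and h: "signed n h"
  defines "p \<equiv> \<lambda>i. app h (cycle_letter m m i)"
    and "q \<equiv> \<lambda>j. - app h (cycle_letter (n - m) n (j - 1))"
  shows "two_cycles n m (n - m) p q (- h + (neg_cycle 0 m + neg_cycle m n) + h)"
proof
  define l where "l = n - m"
  have l: "0 < l" "l \<le> n" "n - l = m" using m by (auto simp: l_def)
  let ?v = "neg_cycle 0 m + neg_cycle m n"
  have v: "signed n ?v" using m by (intro signed_plus signed_neg_cycle) auto
  show "n = m + (n - m)" "0 < m" "0 < n - m" using m by auto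
  show "p (i + int m) = - p i" for i
    using m h by (simp add: p_def cycle_letter_shift signed_app_uminus)
  show "q (j + int (n - m)) = - q j" for j
  proof -
    have "j + int l - 1 = (j - 1) + int l" by simp
    then have "cycle_letter l n (j + int l - 1) = - cycle_letter l n (j - 1)"
      using cycle_letter_shift[OF l(1)] by metis
    then show ?thesis unfolding q_def l_def[symmetric] using h by (simp add: signed_app_uminus)
  qed
  show "signed n (- h + ?v + h)" by (intro signed_plus signed_uminus h v)
  have vp: "app ?v (cycle_letter m m i) = cycle_letter m m (i + 1)" for i
    using abs_cycle_letter(2,3)[of m m "i + 1"] neg_cycle_letter[of m m i] m
      neg_cycle_other[of m n "cycle_letter m m (i + 1)"] by simp
  have vq: "app ?v (cycle_letter l n j) = cycle_letter l n (j + 1)" for j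
    using abs_cycle_letter(2,3)[of l n j] neg_cycle_letter[of l n j] m l
      neg_cycle_other[of 0 m "cycle_letter l n j"] by simp
  show "app (- h + ?v + h) (p i) = p (i + 1)" for i
    using vp[of i] by (simp add: p_def)
  show "app (- h + ?v + h) (q j) = q (j + 1)" for j
    using vq[of "j - 1"] signed_app_uminus[OF signed_uminus[OF h]] signed_app_uminus[OF v] signed_app_uminus[OF h]
    by (simp add: q_def flip: l_def)
  show "x \<in> range p \<union> range q" if x: "x \<noteq> 0" "\<bar>x\<bar> \<le> int n" for x
  proof -
    define y where "y = app (- h) x"
    have hy: "x = app h y" by (simp add: y_def)
    have y: "y \<noteq> 0" "\<bar>y\<bar> \<le> int n"
      using x signed_app_0[OF h] signed_app_bound[OF h, of y] by (auto simp: hy)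
    show ?thesis
    proof (cases "\<bar>y\<bar> \<le> int m")
      case True
      then obtain i where "y = cycle_letter m m i"
        using cycle_letter_surj[of m m y] y by auto
      then show ?thesis by (auto simp: hy p_def)
    next
      case False
      then obtain j where "- y = cycle_letter l n j"
        using cycle_letter_surj[of n l "- y"] y l by auto
      then have "x = q (j + 1)"
        using signed_app_uminus[OF h, of y] by (simp add: hy q_def flip: l_def)
      then show ?thesis by blast
    qed
  qed
  show "letters n (map (\<lambda>k. q (j - int (n - m) + 1 + int k)) [0..<n - m] @ map (\<lambda>k. p (i + int k)) [0..<m])" for i j
  proof -
    let ?Q = "map (\<lambda>k. - cycle_letter l n (j - int l + int k)) [0..<l]"
    let ?P = "map (\<lambda>k. cycle_letter m m (i + int k)) [0..<m]"
    have inj: "k = k'" if "(z + int k) mod int c = (z + int k') mod int c" "k < c" "k' < c" for k k' c :: nat and z :: int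
    proof -
      have "int c dvd int k - int k'" using that(1) by (simp add: mod_eq_dvd_iff)
      then show ?thesis using that(2,3) zdvd_imp_le[of "int c" "\<bar>int k - int k'\<bar>"] by (cases "k = k'") auto
    qed
    have block: "letters n (map (\<lambda>k. f (z + int k)) [0..<c])"
      if f: "\<And>x. \<bar>f x\<bar> = \<bar>cycle_letter c e x\<bar>" and c: "0 < c" "c \<le> e" "e \<le> n" for f z c e
      unfolding letters_def
    proof (intro conjI)
      have "inj_on (\<lambda>k. \<bar>f (z + int k)\<bar>) {0..<c}"
        using inj[of z _ c] by (intro inj_onI) (simp add: f abs_cycle_letter(1)[OF c(1,2)])
      then show "distinct (map abs (map (\<lambda>k. f (z + int k)) [0..<c]))"
        by (simp add: distinct_map o_def)
      have "1 \<le> \<bar>f x\<bar>" "\<bar>f x\<bar> \<le> int n" for x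
        using abs_cycle_letter(2,3)[OF c(1,2), of x] c(3) unfolding f by linarith+
      then show "abs ` set (map (\<lambda>k. f (z + int k)) [0..<c]) \<subseteq> {1..int n}"
        by auto
      then show "0 \<notin> set (map (\<lambda>k. f (z + int k)) [0..<c])" by force
    qed
    have "letters n ?Q" using l by (intro block[of _ l n]) simp_all
    moreover have "letters n ?P" using m by (intro block[of _ m m]) simp_all
    moreover have "\<bar>- cycle_letter l n x\<bar> \<noteq> \<bar>cycle_letter m m y\<bar>" for x y
      using abs_cycle_letter(2)[of l n x] abs_cycle_letter(3)[of m m y] l m by simp
    then have "abs ` set ?Q \<inter> abs ` set ?P = {}" by auto
    ultimately have "letters n (map (app h) (?Q @ ?P))"
      by (intro letters_map_signed[OF h]) (simp add: letters_append)
    moreover have "app h (- cycle_letter l n (j - int l + int k)) = q (j - int l + 1 + int k)" for k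
    proof -
      have "j - int l + int k = j - int l + 1 + int k - 1" by simp
      then show ?thesis unfolding q_def l_def[symmetric] signed_app_uminus[OF h] by (simp only:)
    qed
    then have "map (app h) (?Q @ ?P) = map (\<lambda>k. q (j - int l + 1 + int k)) [0..<l] @ map (\<lambda>k. p (i + int k)) [0..<m]"
      by (simp add: p_def)
    ultimately show ?thesis by (simp only: l_def)
  qed
qed

section \<open>The interval group\<close>

abbreviation rsum :: "(int \<times> int) list \<Rightarrow> int perms" where
  "rsum ps \<equiv> sum_list (map rfl ps)"

lemma D_group_mult [simp]: "x \<otimes>\<^bsub>D_group n\<^esub> y = x * y"
  and D_group_one [simp]: "\<one>\<^bsub>D_group n\<^esub> = 1\<^sub>m n"
  by (simp_all add: D_group_def)

lemma D_group_carrier_mat: "x \<in> carrier (D_group n) \<Longrightarrow> x \<in> carrier_mat n n"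
  by (simp add: D_group_def)

lemma smat_rsum_mult:
  "set ps \<subseteq> refl_pairs n \<Longrightarrow> set qs \<subseteq> refl_pairs n \<Longrightarrow>
    smat n (rsum ps) * smat n (rsum qs) = smat n (rsum (ps @ qs))"
  by (simp add: smat_mult signed_sum_rfl)

text \<open>Generation by reflections is part of the quasi-Coxeter hypothesis; it replaces a direct proof that
  the matrices in the carrier form a group.\<close>

lemma D_group_generated:
  assumes gen: "generate (D_group n) S = carrier (D_group n)" and S: "S \<subseteq> D_reflections n"
  shows "v \<in> carrier (D_group n) \<longleftrightarrow> (\<exists>ps. set ps \<subseteq> refl_pairs n \<and> v = smat n (rsum ps))"
proof
  assume "v \<in> carrier (D_group n)"
  then have "v \<in> generate (D_group n) S" by (simp add: gen)
  then show "\<exists>ps. set ps \<subseteq> refl_pairs n \<and> v = smat n (rsum ps)"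
  proof (induction rule: generate.induct)
    case one
    show ?case by (intro exI[of _ "[]"]) (simp add: smat_zero)
  next
    case (incl h)
    then obtain p where "p \<in> refl_pairs n" "h = smat n (rfl p)" using S by (auto simp: D_reflections_eq)
    then show ?case by (intro exI[of _ "[p]"]) simp
  next
    case (inv h)
    then obtain p where p: "p \<in> refl_pairs n" "h = smat n (rfl p)" using S by (auto simp: D_reflections_eq)
    have hh: "h * h = 1\<^sub>m n" using p by (simp add: smat_mult signed_rfl smat_zero)
    have h: "h \<in> carrier (D_group n)" using p by (cases p) (simp add: smat_rfl_D_group)
    have "inv\<^bsub>D_group n\<^esub> h = h"
      unfolding m_inv_def
    proof (rule the_equality)
      fix y assume y: "y \<in> carrier (D_group n) \<and> h \<otimes>\<^bsub>D_group n\<^esub> y = \<one>\<^bsub>D_group n\<^esub> \<and> y \<otimes>\<^bsub>D_group n\<^esub> h = \<one>\<^bsub>D_group n\<^esub>"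
      note m = D_group_carrier_mat[OF h] D_group_carrier_mat[OF conjunct1[OF y]]
      have "y = (h * h) * y" using m by (simp add: hh)
      also have "\<dots> = h * (h * y)" using m by (simp add: assoc_mult_mat[of _ n n _ n _ n])
      also have "\<dots> = h" using y m by simp
      finally show "y = h" .
    qed (use h hh in simp)
    with p show ?case by (intro exI[of _ "[p]"]) simp
  next
    case (eng h1 h2)
    then obtain ps qs where "set ps \<subseteq> refl_pairs n" "h1 = smat n (rsum ps)"
      "set qs \<subseteq> refl_pairs n" "h2 = smat n (rsum qs)" by blast
    then show ?case by (intro exI[of _ "ps @ qs"]) (simp add: smat_mult signed_sum_rfl)
  qed
next
  assume "\<exists>ps. set ps \<subseteq> refl_pairs n \<and> v = smat n (rsum ps)"
  then obtain ps where "set ps \<subseteq> refl_pairs n" "v = smat n (rsum ps)" by blast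
  then show "v \<in> carrier (D_group n)"
  proof (induction ps arbitrary: v)
    case Nil
    then show ?case using generate.one[of "D_group n" S] by (simp add: gen smat_zero)
  next
    case (Cons p ps)
    then have "smat n (rfl p) \<in> carrier (D_group n)" "smat n (rsum ps) \<in> carrier (D_group n)"
      by (cases p; simp add: smat_rfl_D_group)+
    from generate.eng[of _ "D_group n" S, unfolded gen, OF this]
    show ?case using Cons.prems by (simp add: smat_mult signed_rfl signed_sum_rfl)
  qed
qed

lemma rsum_uminus: "- rsum ps = rsum (rev ps)"
  by (induction ps) (simp_all add: minus_add)

lemma cj_rsum: "signed n f \<Longrightarrow> cj f (rsum ps) = rsum (map (map_pair f) ps)"
  by (simp add: cj_sum_list o_def rfl_map_pair)

lemma D_group_group:
  assumes D_rep: "\<And>v. v \<in> carrier (D_group n) \<longleftrightarrow> (\<exists>ps. set ps \<subseteq> refl_pairs n \<and> v = smat n (rsum ps))"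
  shows "group (D_group n)"
proof (rule groupI)
  fix x y z assume xyz: "x \<in> carrier (D_group n)" "y \<in> carrier (D_group n)" "z \<in> carrier (D_group n)"
  then show "x \<otimes>\<^bsub>D_group n\<^esub> y \<otimes>\<^bsub>D_group n\<^esub> z = x \<otimes>\<^bsub>D_group n\<^esub> (y \<otimes>\<^bsub>D_group n\<^esub> z)"
    by (simp add: assoc_mult_mat[of _ n n _ n _ n] D_group_carrier_mat)
next
  fix x y assume "x \<in> carrier (D_group n)" "y \<in> carrier (D_group n)"
  then obtain ps qs where "set ps \<subseteq> refl_pairs n" "x = smat n (rsum ps)"
      "set qs \<subseteq> refl_pairs n" "y = smat n (rsum qs)" unfolding D_rep by blast
  then show "x \<otimes>\<^bsub>D_group n\<^esub> y \<in> carrier (D_group n)"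
    unfolding D_rep by (intro exI[of _ "ps @ qs"]) (simp add: smat_mult signed_sum_rfl)
next
  show "\<one>\<^bsub>D_group n\<^esub> \<in> carrier (D_group n)"
    unfolding D_rep by (intro exI[of _ "[]"]) (simp add: smat_zero)
next
  fix x assume x: "x \<in> carrier (D_group n)"
  then show "\<one>\<^bsub>D_group n\<^esub> \<otimes>\<^bsub>D_group n\<^esub> x = x"
    using left_mult_one_mat[OF D_group_carrier_mat[OF x]] by simp
  obtain ps where ps: "set ps \<subseteq> refl_pairs n" "x = smat n (rsum ps)" using x D_rep by blast
  then have "smat n (rsum (rev ps)) \<otimes>\<^bsub>D_group n\<^esub> x = \<one>\<^bsub>D_group n\<^esub>"
    using smat_rsum_mult[of "rev ps" n ps] by (simp add: rsum_uminus[symmetric] rev_map smat_zero)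
  moreover have "smat n (rsum (rev ps)) \<in> carrier (D_group n)"
    unfolding D_rep by (rule exI[of _ "rev ps"]) (simp add: ps)
  ultimately show "\<exists>y\<in>carrier (D_group n). y \<otimes>\<^bsub>D_group n\<^esub> x = \<one>\<^bsub>D_group n\<^esub>" by blast
qed

section \<open>Reduced factorizations of \<open>w\<close> and the generators of its interval
  group\<close>

locale D_interval = two_cycles +
  assumes D_rep: "v \<in> carrier (D_group n) \<longleftrightarrow> (\<exists>ps. set ps \<subseteq> refl_pairs n \<and> v = smat n (rsum ps))"
    and w_length: "refl_length (D_group n) (D_reflections n) (smat n w) = n"
    and w_carrier: "smat n w \<in> carrier (D_group n)"
begin

abbreviation "W \<equiv> D_group n"
abbreviation "T \<equiv> D_reflections n"
abbreviation "len \<equiv> refl_length W T"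
abbreviation "X \<equiv> abs_interval W T (smat n w)"
abbreviation "I \<equiv> interval_group W T (smat n w)"

sublocale W: group W by (rule D_group_group) (rule D_rep)

lemma rsum_carrier: "set ps \<subseteq> refl_pairs n \<Longrightarrow> smat n (rsum ps) \<in> carrier W"
  unfolding D_rep by blast

lemma W_inv: "set ps \<subseteq> refl_pairs n \<Longrightarrow> inv\<^bsub>W\<^esub> (smat n (rsum ps)) = smat n (- rsum ps)"
  using smat_rsum_mult[of "rev ps" n ps] rsum_carrier[of ps] rsum_carrier[of "rev ps"]
  by (intro W.inv_equality) (simp_all add: rsum_uminus[symmetric] rev_map smat_zero)

lemma list_prod_T:
  "set xs \<subseteq> T \<Longrightarrow> \<exists>ps. set ps \<subseteq> refl_pairs n \<and> length ps = length xs \<and> list_prod W xs = smat n (rsum ps)"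
proof (induction xs)
  case Nil
  then show ?case by (intro exI[of _ "[]"]) (simp add: list_prod_def smat_zero)
next
  case (Cons x xs)
  then obtain ps p where "set ps \<subseteq> refl_pairs n" "length ps = length xs" "list_prod W xs = smat n (rsum ps)"
    "p \<in> refl_pairs n" "x = smat n (rfl p)" by (auto simp: D_reflections_eq)
  then show ?case
    by (intro exI[of _ "p # ps"]) (simp add: list_prod_def smat_mult signed_rfl signed_sum_rfl)
qed

lemma list_prod_rfl:
  "set ps \<subseteq> refl_pairs n \<Longrightarrow> list_prod W (map (\<lambda>p. smat n (rfl p)) ps) = smat n (rsum ps)"
  by (induction ps) (simp_all add: list_prod_def smat_mult signed_rfl signed_sum_rfl smat_zero)

lemma len_le: "set ps \<subseteq> refl_pairs n \<Longrightarrow> len (smat n (rsum ps)) \<le> length ps"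
  unfolding refl_length_def
  by (rule Least_le, rule exI[of _ "map (\<lambda>p. smat n (rfl p)) ps"])
    (auto simp: list_prod_rfl D_reflections_eq)

lemma len_attained:
  assumes "v \<in> carrier W"
  shows "\<exists>ps. set ps \<subseteq> refl_pairs n \<and> v = smat n (rsum ps) \<and> length ps = len v"
proof -
  obtain ps where ps: "set ps \<subseteq> refl_pairs n" "v = smat n (rsum ps)" using assms D_rep by blast
  then have "\<exists>ts. length ts = length ps \<and> set ts \<subseteq> T \<and> v = list_prod W ts"
    by (intro exI[of _ "map (\<lambda>p. smat n (rfl p)) ps"]) (auto simp: list_prod_rfl D_reflections_eq)
  then have "\<exists>k ts. length ts = k \<and> set ts \<subseteq> T \<and> v = list_prod W ts" by blast
  from LeastI_ex[OF this] obtain ts where "length ts = len v" "set ts \<subseteq> T" "v = list_prod W ts"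
    unfolding refl_length_def by blast
  then show ?thesis using list_prod_T[of ts] by auto
qed

definition factors :: "(int \<times> int) list \<Rightarrow> bool" where
  "factors ps \<longleftrightarrow> set ps \<subseteq> refl_pairs n \<and> rsum ps = w \<and> length ps = n"

text \<open>Prefix and remainder have at most the displayed lengths, and these add up to the length
  \<open>n\<close> of \<open>w\<close>; shortening either would shorten \<open>w\<close>.\<close>

lemma factors_prefix:
  assumes "factors (ps @ zs)"
  shows "smat n (rsum ps) \<in> X" "len (smat n (rsum ps)) = length ps"
proof -
  have ps: "set ps \<subseteq> refl_pairs n" "set zs \<subseteq> refl_pairs n" "rsum ps + rsum zs = w" "length ps + length zs = n"
    using assms by (auto simp: factors_def)
  have inv: "inv\<^bsub>W\<^esub> (smat n (rsum ps)) \<otimes>\<^bsub>W\<^esub> smat n w = smat n (rsum zs)"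
    using ps by (simp add: W_inv smat_mult signed_uminus signed_sum_rfl signed_plus flip: ps(3))
  obtain ps' where ps': "set ps' \<subseteq> refl_pairs n" "smat n (rsum ps) = smat n (rsum ps')" "length ps' = len (smat n (rsum ps))"
    using len_attained[OF rsum_carrier[OF ps(1)]] by blast
  obtain zs' where zs': "set zs' \<subseteq> refl_pairs n" "smat n (rsum zs) = smat n (rsum zs')" "length zs' = len (smat n (rsum zs))"
    using len_attained[OF rsum_carrier[OF ps(2)]] by blast
  have "rsum ps = rsum ps'" "rsum zs = rsum zs'"
    using ps' zs' ps by (auto intro!: smat_inj[of n] signed_sum_rfl)
  then have "n \<le> length (ps' @ zs')"
    using len_le[of "ps' @ zs'"] ps' zs' w_length by (simp add: ps(3)[symmetric])
  then have eq: "len (smat n (rsum ps)) = length ps" "len (smat n (rsum zs)) = length zs"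
    using len_le[OF ps(1)] len_le[OF ps(2)] ps(4) ps'(3) zs'(3) by simp_all
  then show "len (smat n (rsum ps)) = length ps" by simp
  show "smat n (rsum ps) \<in> X"
    using rsum_carrier[OF ps(1)] eq ps(4) inv w_length by (simp add: abs_interval_def abs_le_def)
qed

lemma interval_factors:
  assumes "v \<in> X"
  shows "\<exists>ps zs. factors (ps @ zs) \<and> v = smat n (rsum ps) \<and> length ps = len v"
proof -
  have v: "v \<in> carrier W" "n = len v + len (inv\<^bsub>W\<^esub> v \<otimes>\<^bsub>W\<^esub> smat n w)"
    using assms w_length by (auto simp: abs_interval_def abs_le_def)
  obtain ps where ps: "set ps \<subseteq> refl_pairs n" "v = smat n (rsum ps)" "length ps = len v"
    using len_attained[OF v(1)] by blast
  have "inv\<^bsub>W\<^esub> v \<otimes>\<^bsub>W\<^esub> smat n w \<in> carrier W" using v(1) w_carrier by blast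
  then obtain zs where zs: "set zs \<subseteq> refl_pairs n" "inv\<^bsub>W\<^esub> v \<otimes>\<^bsub>W\<^esub> smat n w = smat n (rsum zs)"
    "length zs = len (inv\<^bsub>W\<^esub> v \<otimes>\<^bsub>W\<^esub> smat n w)" using len_attained by blast
  have "smat n (rsum (ps @ zs)) = v \<otimes>\<^bsub>W\<^esub> (inv\<^bsub>W\<^esub> v \<otimes>\<^bsub>W\<^esub> smat n w)"
    using ps zs by (simp add: smat_mult signed_sum_rfl del: sum_list_append map_append) (simp add: smat_rsum_mult)
  also have "\<dots> = smat n w" using v(1) w_carrier by (metis W.m_assoc W.r_inv W.l_one W.inv_closed)
  finally have "rsum (ps @ zs) = w"
    using ps zs by (intro smat_inj[of n] signed_sum_rfl signed_w) auto
  then show ?thesis using ps zs v by (intro exI[of _ ps] exI[of _ zs]) (auto simp: factors_def)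
qed

text \<open>Moving a prefix to the end conjugates it by what it passes. Any inner stretch of a
  factorization thus becomes a prefix of another one.\<close>

lemma factors_rotate:
  assumes "factors (ps @ qs)"
  shows "factors (qs @ map (map_pair (rsum qs)) ps)"
proof -
  have qs: "signed n (rsum qs)" using assms by (auto simp: factors_def intro: signed_sum_rfl)
  have "set (map (map_pair (rsum qs)) ps) \<subseteq> refl_pairs n"
    using assms map_pair_refl_pairs[OF qs] by (auto simp: factors_def)
  moreover have "rsum qs + cj (rsum qs) (rsum ps) = rsum ps + rsum qs" by (simp add: cj_def add.assoc)
  ultimately show ?thesis using assms cj_rsum[OF qs, of ps] by (simp add: factors_def)
qed

definition gen :: "int perms \<Rightarrow> int mat word set" where
  "gen f = pres_gen X {([(u, True), (v, True)], [(r, True)]) | u v r.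
          u \<in> X \<and> v \<in> X \<and> r \<in> X \<and> u \<otimes>\<^bsub>W\<^esub> v = r \<and> len r = len u + len v} (smat n f)"

sublocale I: group I
  unfolding interval_group_def by (rule group_presented_group)

lemma gen_carrier: "factors (ps @ zs) \<Longrightarrow> gen (rsum ps) \<in> carrier I"
  unfolding interval_group_def gen_def by (intro pres_gen_carrier factors_prefix)

lemma gen_mult:
  assumes "factors (ps @ qs @ zs)"
  shows "gen (rsum ps) \<otimes>\<^bsub>I\<^esub> gen (rsum qs) = gen (rsum (ps @ qs))"
proof -
  let ?R = "{([(u, True), (v, True)], [(r, True)]) | u v r.
          u \<in> X \<and> v \<in> X \<and> r \<in> X \<and> u \<otimes>\<^bsub>W\<^esub> v = r \<and> len r = len u + len v}"
  have sets: "set ps \<subseteq> refl_pairs n" "set qs \<subseteq> refl_pairs n" using assms by (auto simp: factors_def)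
  have f: "factors (qs @ (zs @ map (map_pair (rsum (qs @ zs))) ps))"
    using factors_rotate[OF assms] by simp
  have f': "factors ((ps @ qs) @ zs)" using assms by simp
  note mem = factors_prefix[OF assms] factors_prefix[OF f] factors_prefix[OF f']
  have "([(smat n (rsum ps), True), (smat n (rsum qs), True)], [(smat n (rsum (ps @ qs)), True)]) \<in> ?R"
    using mem smat_rsum_mult[OF sets] by simp
  from pres_gen_relation[OF this] mem
  have "gen (rsum ps) \<otimes>\<^bsub>I\<^esub> (gen (rsum qs) \<otimes>\<^bsub>I\<^esub> \<one>\<^bsub>I\<^esub>) = gen (rsum (ps @ qs)) \<otimes>\<^bsub>I\<^esub> \<one>\<^bsub>I\<^esub>"
    by (simp add: interval_group_def gen_def)
  then show ?thesis using gen_carrier[OF f] gen_carrier[OF f'] by simp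
qed

definition \<phi> :: "int \<times> int \<Rightarrow> int mat word set perms" where
  "\<phi> = (\<lambda>x. right_mult I (gen (rfl x)))"

lemma gen_sum: "factors (ps @ zs) \<Longrightarrow> right_mult I (gen (rsum ps)) = sum_list (map \<phi> ps)"
proof (induction ps arbitrary: zs)
  case Nil
  have "gen 0 \<in> carrier I" using gen_carrier[of "[]" zs] Nil by simp
  moreover have "gen 0 \<otimes>\<^bsub>I\<^esub> gen 0 = gen 0" using gen_mult[of "[]" "[]" zs] Nil by simp
  ultimately have "gen 0 = \<one>\<^bsub>I\<^esub>" by simp
  then show ?case by simp
next
  case (Cons p ps)
  have f: "factors ([p] @ ps @ zs)" using Cons.prems by simp
  have f': "factors (ps @ (zs @ map (map_pair (rsum (ps @ zs))) [p]))" using factors_rotate[OF f] by simp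
  have "gen (rfl p) \<otimes>\<^bsub>I\<^esub> gen (rsum ps) = gen (rsum (p # ps))" using gen_mult[OF f] by simp
  moreover have "gen (rfl p) \<in> carrier I" "gen (rsum ps) \<in> carrier I"
    using gen_carrier[OF f] gen_carrier[OF f'] by simp_all
  ultimately have "right_mult I (gen (rsum (p # ps))) = \<phi> p + right_mult I (gen (rsum ps))"
    using I.right_mult_mult[of "gen (rfl p)" "gen (rsum ps)"] by (simp add: \<phi>_def)
  then show ?case using Cons.IH[OF f'] by simp
qed

sublocale \<phi>: even_pairs \<phi>
  by unfold_locales (simp_all add: \<phi>_def rfl_uminus rfl_sym)

lemma factors_replace:
  assumes "factors (ps @ zs)" "set qs \<subseteq> refl_pairs n" "length qs = length ps" "rsum qs = rsum ps"
  shows "factors (qs @ zs)" "sum_list (map \<phi> qs) = sum_list (map \<phi> ps)"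
proof -
  show f: "factors (qs @ zs)" using assms by (simp add: factors_def)
  show "sum_list (map \<phi> qs) = sum_list (map \<phi> ps)"
    using gen_sum[OF f] gen_sum[OF assms(1)] assms(4) by simp
qed

text \<open>A Hurwitz move: each factor not selected is carried to the right past the selected ones,
  being conjugated by them.\<close>

lemma factors_subseq:
  "set zs \<subseteq> refl_pairs n \<Longrightarrow> subseq ys zs \<Longrightarrow>
    \<exists>xs. set xs \<subseteq> refl_pairs n \<and> rsum (ys @ xs) = rsum zs \<and> length (ys @ xs) = length zs"
proof (induction zs arbitrary: ys)
  case Nil
  then have "ys = []" by (auto dest: list_emb_Nil2)
  then show ?case by auto
next
  case (Cons z zs)
  show ?case
  proof (cases "\<exists>ys'. ys = z # ys' \<and> subseq ys' zs")
    case True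
    then obtain ys' where ys': "ys = z # ys'" "subseq ys' zs" by blast
    from Cons.IH[OF _ ys'(2)] Cons.prems(1) obtain xs where
      "set xs \<subseteq> refl_pairs n" "rsum (ys' @ xs) = rsum zs" "length (ys' @ xs) = length zs" by auto
    then show ?thesis using ys' by (intro exI[of _ xs]) (simp add: add.assoc)
  next
    case False
    then have sub: "subseq ys zs" using Cons.prems(2) by (cases ys) (auto split: if_splits)
    from Cons.IH[OF _ sub] Cons.prems(1) obtain xs where
      xs: "set xs \<subseteq> refl_pairs n" "rsum (ys @ xs) = rsum zs" "length (ys @ xs) = length zs" by auto
    have "set ys \<subseteq> refl_pairs n" using sub Cons.prems(1) by (auto simp: subseq_conv_nths dest: in_set_nthsD)
    then have s: "signed n (rsum ys)" by (rule signed_sum_rfl)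
    have "rsum ys + cj (rsum ys) (rfl z) = rfl z + rsum ys" by (simp add: cj_def add.assoc)
    then have "rsum (ys @ map_pair (rsum ys) z # xs) = rfl z + rsum (ys @ xs)"
      by (simp add: rfl_map_pair[OF s] flip: add.assoc)
    then show ?thesis using xs map_pair_refl_pairs[OF s, of z] Cons.prems(1)
      by (intro exI[of _ "map_pair (rsum ys) z # xs"]) simp
  qed
qed

end

lemma cycle_word_split: "cycle_word (xs @ x # ys) = cycle_word (x # ys) @ cycle_word (xs @ [x])"
  by (cases ys) (simp_all add: cycle_word_append)

lemma letters_subseq:
  assumes "letters n xs" "subseq ys xs"
  shows "letters n ys"
proof -
  obtain N where ys: "ys = nths xs N" using assms(2) by (auto simp: subseq_conv_nths)
  then have "set ys \<subseteq> set xs" by (simp add: set_nths_subset)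
  moreover have "distinct (map abs ys)"
    using assms(1) distinct_nthsI[of "map abs xs" N] by (simp add: letters_def ys nths_map)
  ultimately show ?thesis using assms(1) unfolding letters_def by blast
qed

lemma letters_pair: "letters n xs \<Longrightarrow> subseq [x, y] xs \<Longrightarrow> (x, y) \<in> refl_pairs n"
  using letters_subseq[of n xs "[x, y]"] by (simp add: letters_def refl_pairs_def)

section \<open>Dual braid relations inside the interval group, and generation by the
  vertices\<close>

context D_interval
begin

lemma n_pos: "0 < n" using n_eq m_pos by simp

text \<open>Rotate the factorization of \<open>w\<close> so that the cycle of the window leads. Its
  part from \<open>x\<close> onwards is itself a cycle, which \<open>cyc_star\<close> rewrites as a
  star at \<open>x\<close>, and \<open>factors_subseq\<close> brings the selected rays to the
  front.\<close>

lemma window_star: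
  assumes "subseq (x # ys) (window i j)"
  shows "\<exists>zs. factors (map (Pair x) ys @ zs)"
proof -
  let ?X = "window i j"
  have L: "letters n ?X" by (rule letters_window')
  obtain pre rest where X: "?X = pre @ x # rest" and ys: "subseq ys rest"
    using list_emb_ConsD[OF assms] by blast
  have cw: "set (cycle_word ?X) \<subseteq> refl_pairs n"
    using letters_pair[OF L] set_cycle_word[of _ _ ?X] by auto
  have "factors ([(p (i - 1), q j)] @ cycle_word ?X)"
    using cw w_factorization[of "i - 1" j, symmetric] pq_refl_pairs n_pos
    by (simp add: factors_def cyc_def)
  from factors_rotate[OF this]
  obtain c where "factors (cycle_word ?X @ [c])" by auto
  then have f: "factors (cycle_word (x # rest) @ (cycle_word (pre @ [x]) @ [c]))"
  proof -
    have "cycle_word ?X = cycle_word (x # rest) @ cycle_word (pre @ [x])"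
      unfolding X by (rule cycle_word_split)
    then show ?thesis using \<open>factors (cycle_word ?X @ [c])\<close> by simp
  qed
  have Lr: "letters n (x # rest)" using L unfolding X by (rule letters_subseq) auto
  have star: "rsum (map (Pair x) rest) = rsum (cycle_word (x # rest))"
    using rfl.cyc_star[OF letters_imp_dual_rels[OF Lr]] by (simp add: cyc_def o_def)
  have pairs: "set (map (Pair x) rest) \<subseteq> refl_pairs n"
    using letters_pair[OF Lr] by (auto simp: subseq_singleton_left)
  have "subseq (map (Pair x) ys) (map (Pair x) rest)" using ys by (rule subseq_map)
  from factors_subseq[OF pairs this] obtain xs where xs: "set xs \<subseteq> refl_pairs n"
    "rsum (map (Pair x) ys @ xs) = rsum (map (Pair x) rest)"
    "length (map (Pair x) ys @ xs) = length (map (Pair x) rest)" by blast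
  have "set (map (Pair x) ys @ xs) \<subseteq> refl_pairs n"
    using xs(1) pairs ys by (auto simp: subseq_conv_nths dest!: in_set_nthsD)
  then have "factors ((map (Pair x) ys @ xs) @ (cycle_word (pre @ [x]) @ [c]))"
    using factors_replace(1)[OF f, of "map (Pair x) ys @ xs"] xs(2,3) star by simp
  then show ?thesis by auto
qed

lemma \<phi>_swap:
  assumes "factors ([s, t] @ zs)" "s' \<in> refl_pairs n" "t' \<in> refl_pairs n" "rfl s' + rfl t' = rfl s + rfl t"
  shows "factors ([s', t'] @ zs)" "\<phi> s' + \<phi> t' = \<phi> s + \<phi> t"
  using factors_replace[OF assms(1), of "[s', t']"] assms(2-4) by auto

lemma triangle_\<phi>:
  assumes "subseq [a, b, c] (window i j)"
  shows "triangle \<phi> a b c"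
proof -
  have L: "letters n [a, b, c]" using letters_window' assms by (rule letters_subseq)
  then have pairs: "(a, b) \<in> refl_pairs n" "(a, c) \<in> refl_pairs n" "(b, c) \<in> refl_pairs n"
    by (auto intro!: letters_pair[OF L])
  have tri: "triangle rfl a b c" using letters_imp_dual_rels[OF L] by (simp add: dual_rels_def)
  obtain zs where f: "factors ([(a, b), (a, c)] @ zs)" using window_star[OF assms] by auto
  have "rfl (b, c) + rfl (a, b) = rfl (a, b) + rfl (a, c)" "rfl (a, c) + rfl (b, c) = rfl (a, b) + rfl (a, c)"
    using tri unfolding triangle_def by metis+
  from \<phi>_swap(2)[OF f _ _ this(1)] \<phi>_swap(2)[OF f _ _ this(2)] pairs show ?thesis
    by (simp add: triangle_def)
qed

text \<open>From the star at \<open>a\<close>, triangle relations of reflections bring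
  \<open>(a, b), (c, d)\<close>, and likewise \<open>(b, c), (a, d)\<close>, to the two leading
  places. Equal products of two leading reflections have equal values, so commuting reflections
  there have commuting values.\<close>

lemma noncrossing_\<phi>:
  assumes "subseq [a, b, c, d] (window i j)"
  shows "noncrossing \<phi> a b c d"
proof -
  have L: "letters n [a, b, c, d]" using letters_window' assms by (rule letters_subseq)
  then have pairs: "(a, b) \<in> refl_pairs n" "(a, c) \<in> refl_pairs n" "(a, d) \<in> refl_pairs n"
      "(b, c) \<in> refl_pairs n" "(b, d) \<in> refl_pairs n" "(c, d) \<in> refl_pairs n"
    by (auto intro!: letters_pair[OF L])
  have rels: "triangle rfl a b c" "triangle rfl a c d" "triangle rfl a b d" "noncrossing rfl a b c d"
    using letters_imp_dual_rels[OF L] by (simp_all add: dual_rels_def)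
  obtain zs where f: "factors ([(a, b), (a, c), (a, d)] @ zs)" using window_star[OF assms] by auto
  have "rfl (c, d) + rfl (a, c) = rfl (a, c) + rfl (a, d)"
    using rels(2) unfolding triangle_def by blast
  then have "factors ([(a, b), (c, d), (a, c)] @ zs)"
    using factors_replace(1)[OF f, of "[(a, b), (c, d), (a, c)]"] pairs by simp
  then have f1: "factors ([(a, b), (c, d)] @ ((a, c) # zs))" by simp
  have 1: "commute (\<phi> (a, b)) (\<phi> (c, d))"
    using \<phi>_swap(2)[OF f1, of "(c, d)" "(a, b)"] pairs rels(4) by (simp add: noncrossing_def)
  have eq1: "rfl (a, b) + rfl (a, c) = rfl (b, c) + rfl (a, b)"
    and eq2: "rfl (a, b) + rfl (a, d) = rfl (a, d) + rfl (b, d)"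
    using rels(1,3) unfolding triangle_def by metis+
  have "rfl (b, c) + (rfl (a, d) + rfl (b, d)) = rfl (b, c) + rfl (a, b) + rfl (a, d)"
    unfolding eq2[symmetric] by (simp add: add.assoc)
  also have "\<dots> = rfl (a, b) + (rfl (a, c) + rfl (a, d))"
    unfolding eq1[symmetric] by (simp add: add.assoc)
  finally have "factors ([(b, c), (a, d), (b, d)] @ zs)"
    using factors_replace(1)[OF f, of "[(b, c), (a, d), (b, d)]"] pairs by simp
  then have f2: "factors ([(b, c), (a, d)] @ ((b, d) # zs))" by simp
  have "commute (\<phi> (a, d)) (\<phi> (b, c))"
    using \<phi>_swap(2)[OF f2, of "(a, d)" "(b, c)"] pairs rels(4) by (simp add: noncrossing_def)
  with 1 show ?thesis by (simp add: noncrossing_def)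
qed

lemma dual_rels_\<phi>: "dual_rels \<phi> (window i j)"
  unfolding dual_rels_def using triangle_\<phi> noncrossing_\<phi> by blast

lemma q_neg_refl_pairs: "(p i, - q j) \<in> refl_pairs n"
  using pq_refl_pairs[of i j] by (simp add: refl_pairs_def)

text \<open>Both \<open>q j\<close> and \<open>- p i\<close> occur in the cycle that
  \<open>(p i, q j)\<close> leaves behind. Rotated to begin at \<open>q j\<close>, that cycle has a
  star containing \<open>(q j, - p i)\<close>, so the two orthogonal reflections open a common
  factorization.\<close>

lemma commute_signs_\<phi>: "commute (\<phi> (p i, q j)) (\<phi> (p i, - q j))"
proof -
  let ?X = "window (i + 1) j"
  obtain Q P where X: "?X = Q @ [q j] @ P @ [- p i]" by (rule window_forms)
  have cw: "set (cycle_word ?X) \<subseteq> refl_pairs n"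
    using letters_pair[OF letters_window'[of "i + 1" j]] set_cycle_word[of _ _ ?X] by auto
  have f: "factors ([(p i, q j)] @ cycle_word ?X)"
    using cw w_factorization[of i j, symmetric] pq_refl_pairs n_pos by (simp add: factors_def cyc_def)
  have "letters n ?X" by (rule letters_window')
  then have L: "letters n ([q j] @ P @ [- p i] @ Q)"
    using letters_rotate[of n Q "[q j] @ P @ [- p i]"] by (simp add: X)
  have sub: "subseq (q j # [- p i]) ([q j] @ P @ [- p i] @ Q)"
    by (simp add: subseq_singleton_left)
  have eq: "rsum (map (Pair (q j)) (P @ [- p i] @ Q)) = rsum (cycle_word ?X)"
    using rfl.cyc_rotate[OF letters_imp_dual_rels, of n Q "[q j] @ P @ [- p i]"] letters_window'[of "i + 1" j]
      rfl.cyc_star[OF letters_imp_dual_rels, of n "q j" "P @ [- p i] @ Q"] L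
    by (simp add: X cyc_def o_def)
  have pairs: "set (map (Pair (q j)) (P @ [- p i] @ Q)) \<subseteq> refl_pairs n"
    using letters_pair[OF L] by (auto simp: subseq_singleton_left)
  have "subseq (map (Pair (q j)) [- p i]) (map (Pair (q j)) (P @ [- p i] @ Q))"
    by (rule subseq_map) (simp add: subseq_singleton_left)
  from factors_subseq[OF pairs this] obtain xs where xs: "set xs \<subseteq> refl_pairs n"
    "rsum ((q j, - p i) # xs) = rsum (cycle_word ?X)" "length ((q j, - p i) # xs) = length (P @ [- p i] @ Q)"
    unfolding eq by auto
  have "length (P @ [- p i] @ Q) = n - 1" using length_window[of "i + 1" j] unfolding X by simp
  then have "factors ([(p i, q j), (q j, - p i)] @ xs)"
    using f xs q_neg_refl_pairs[of i j] by (simp add: factors_def refl_pairs_def flip: add.assoc)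
  moreover have "commute (rfl (p i, q j)) (rfl (q j, - p i))"
  proof -
    have "cj (rfl (p i, q j)) (rfl (q j, - p i)) = rfl (p i, - q j)"
      using pq_bounds abs_p_neq_q[of i j] by (subst cj_rfl_rfl) (auto simp: swap_pm_def)
    also have "\<dots> = rfl (q j, - p i)" using rfl_uminus[of "p i" "- q j"] rfl_sym by simp
    finally show ?thesis by (simp only: cj_eq_self_iff)
  qed
  ultimately have "commute (\<phi> (p i, q j)) (\<phi> (q j, - p i))"
    using \<phi>_swap(2)[of "(p i, q j)" "(q j, - p i)" xs "(q j, - p i)" "(p i, q j)"] pq_refl_pairs[of i j]
    by (simp add: refl_pairs_def)
  moreover have "\<phi> (q j, - p i) = \<phi> (p i, - q j)"
    using \<phi>.pair_uminus[of "p i" "- q j"] \<phi>.pair_sym by simp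
  ultimately show ?thesis by simp
qed

text \<open>The vertices from 2 to \<open>n\<close> join neighbouring letters of
  \<open>window 0 0\<close> read backwards: vertex \<open>n - s\<close> belongs to the positions
  \<open>s\<close> and \<open>s + 1\<close>. Vertex 1 differs from vertex \<open>m + 1\<close> by
  the sign of \<open>q 0\<close>.\<close>

definition vertex_pair :: "nat \<Rightarrow> int \<times> int" where
  "vertex_pair k = (if k = 1 then (p 0, - q 0)
     else if k \<le> m then (p (int (m - k)), p (int (Suc (m - k))))
     else if k = m + 1 then (p 0, q 0)
     else (q (- int (Suc (k - m - 2))), q (- int (k - m - 2))))"

lemma vertex_pair_simps:
  "vertex_pair 1 = (p 0, - q 0)" "2 \<le> k \<Longrightarrow> k \<le> m \<Longrightarrow> vertex_pair k = (p (int (m - k)), p (int (Suc (m - k))))"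
  "vertex_pair (m + 1) = (p 0, q 0)" "m + 2 \<le> k \<Longrightarrow> vertex_pair k = (q (- int (Suc (k - m - 2))), q (- int (k - m - 2)))"
  using m_pos by (auto simp: vertex_pair_def)

lemma q_neg: "q (- int l + z) = - q z"
  using q_shift[of "z - int l"] by (simp add: algebra_simps)

lemma vertex_pair_window:
  assumes "Suc s < n"
  shows "vertex_pair (n - s) = (window 0 0 ! s, window 0 0 ! Suc s) \<or> vertex_pair (n - s) = (window 0 0 ! Suc s, window 0 0 ! s)"
proof -
  consider "Suc s < l" | "Suc s = l" | "l \<le> s" by linarith
  then show ?thesis
  proof cases
    case 1
    then have "n - s - m - 2 = l - 2 - s" "m + 2 \<le> n - s" using n_eq by auto
    moreover have "0 - int l + 1 + int s = - int (Suc (l - 2 - s))" "0 - int l + 1 + int (Suc s) = - int (l - 2 - s)"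
      using 1 by auto
    ultimately show ?thesis using 1 nth_window_q[of s 0 0] nth_window_q[of "Suc s" 0 0] vertex_pair_simps(4)[of "n - s"] by (simp only: simp_thms)
  next
    case 2
    then have "0 - int l + 1 + int s = 0" "n - s = m + 1" using n_eq by auto
    then have "window 0 0 ! s = q 0" "vertex_pair (n - s) = (p 0, q 0)" using nth_window_q[of s 0 0] 2 vertex_pair_simps(3) by (simp_all only:)
    moreover have "window 0 0 ! Suc s = p 0" using nth_window_p[of 0 0 0] 2 m_pos by simp
    ultimately show ?thesis by simp
  next
    case 3
    then have "vertex_pair (n - s) = (p (int (m - (n - s))), p (int (Suc (m - (n - s)))))"
      using assms n_eq by (intro vertex_pair_simps(2)) auto
    moreover have "m - (n - s) = s - l" using n_eq 3 assms by auto
    ultimately show ?thesis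
      using 3 nth_window_p[of "s - l" 0 0] nth_window_p[of "Suc s - l" 0 0] assms n_eq
      by (simp add: Suc_diff_le)
  qed
qed

lemma rfl_window_0: "Suc s < n \<Longrightarrow> rfl (window 0 0 ! s, window 0 0 ! Suc s) = rfl (vertex_pair (n - s))"
  by (drule vertex_pair_window) (auto simp: rfl_sym)

text \<open>Against \<open>window 0 0\<close> all letters of the \<open>q\<close> block have changed
  sign. Reflections inside a block are unaffected, and the link between the blocks becomes
  \<open>(p 0, - q 0)\<close>: the path runs through vertex 1 instead of
  \<open>m + 1\<close>.\<close>

lemma rfl_window_1:
  assumes "Suc s < n"
  shows "rfl (window 0 (- int l) ! s, window 0 (- int l) ! Suc s) = rfl (vertex_pair (if n - s = m + 1 then 1 else n - s))"
proof -
  consider "Suc s < l" | "Suc s = l" | "l \<le> s" by linarith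
  then show ?thesis
  proof cases
    case 1
    have "window 0 (- int l) ! s = - window 0 0 ! s" "window 0 (- int l) ! Suc s = - window 0 0 ! Suc s"
      using 1 q_neg[of "- int l + 1 + int s"] q_neg[of "- int l + 1 + int (Suc s)"]
      by (simp_all add: nth_window_q algebra_simps)
    moreover have "n - s \<noteq> m + 1" using 1 n_eq by auto
    ultimately show ?thesis using rfl_window_0[OF assms] rfl_uminus by (simp only: if_False)
  next
    case 2
    then have "- int l - int l + 1 + int s = - int l + 0" "n - s = m + 1" using n_eq by auto
    then have "window 0 (- int l) ! s = - q 0" "n - s = m + 1"
      using nth_window_q[of s 0 "- int l"] q_neg[of 0] 2 by (simp_all only:)
    moreover have "window 0 (- int l) ! Suc s = p 0" using nth_window_p[of 0 0 "- int l"] 2 m_pos by simp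
    ultimately show ?thesis using rfl_sym[of "- q 0"] vertex_pair_simps(1) by simp
  next
    case 3
    have "window 0 (- int l) ! s = window 0 0 ! s" "window 0 (- int l) ! Suc s = window 0 0 ! Suc s"
      using 3 nth_window_p[of "s - l" 0] nth_window_p[of "Suc s - l" 0] assms n_eq by (simp_all add: Suc_diff_le)
    moreover have "n - s \<noteq> m + 1" using 3 n_eq by auto
    ultimately show ?thesis using rfl_window_0[OF assms] by (simp only: if_False)
  qed
qed

lemma \<phi>_rfl_cong: "rfl x = rfl y \<Longrightarrow> \<phi> x = \<phi> y"
  by (simp add: \<phi>_def)

text \<open>The chains of the two windows reach the mixed reflections with both signs. A triangle
  with one letter of the other block then yields the reflections inside a block.\<close>

lemma \<phi>_generated:
  assumes add: "\<And>x y. x \<in> K \<Longrightarrow> y \<in> K \<Longrightarrow> x + y \<in> K" and neg: "\<And>x. x \<in> K \<Longrightarrow> - x \<in> K"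
    and vertex_pair: "\<And>k. k \<in> {1..n} \<Longrightarrow> \<phi> (vertex_pair k) \<in> K"
    and xy: "(x, y) \<in> refl_pairs n"
  shows "\<phi> (x, y) \<in> K"
proof -
  have cj: "cj x y \<in> K" if "x \<in> K" "y \<in> K" for x y
    using that add neg by (simp add: cj_def)
  have tri_close: "\<phi> (x, z) \<in> K" if "triangle \<phi> x y z" "\<phi> (x, y) \<in> K" "\<phi> (y, z) \<in> K" for x y z
  proof -
    have "\<phi> (x, z) = cj (- \<phi> (y, z)) (\<phi> (x, y))"
      using that(1) by (simp add: triangle_def cj_def eq_diff_eq)
    then show ?thesis using cj neg that by simp
  qed
  have tri_close': "\<phi> (y, z) \<in> K" if "triangle \<phi> x y z" "\<phi> (x, y) \<in> K" "\<phi> (x, z) \<in> K" for x y z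
  proof -
    have "\<phi> (y, z) = \<phi> (x, y) + \<phi> (x, z) - \<phi> (x, y)"
      using that(1) unfolding triangle_def eq_diff_eq by metis
    then show ?thesis using that add[OF add[OF that(2,3)] neg[OF that(2)]] by simp
  qed
  have tri_close'': "\<phi> (x, y) \<in> K" if "triangle \<phi> x y z" "\<phi> (x, z) \<in> K" "\<phi> (y, z) \<in> K" for x y z
  proof -
    have "\<phi> (x, y) = cj (\<phi> (y, z)) (\<phi> (x, z))"
    proof -
      have "\<phi> (y, z) + \<phi> (x, y) = \<phi> (x, z) + \<phi> (y, z)" using that(1) by (simp add: triangle_def)
      then have "- \<phi> (y, z) + (\<phi> (y, z) + \<phi> (x, y)) = - \<phi> (y, z) + (\<phi> (x, z) + \<phi> (y, z))" by (rule arg_cong)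
      then show ?thesis by (simp add: cj_def add.assoc)
    qed
    then show ?thesis using cj that by simp
  qed
  have sub3: "subseq [window i j ! k, window i j ! k', window i j ! k''] (window i j)"
    if "k < k'" "k' < k''" "k'' < n" for i j k k' k''
  proof -
    have "window i j = take k (window i j) @ window i j ! k # (take (k' - Suc k) (drop (Suc k) (window i j))
        @ window i j ! k' # (take (k'' - Suc k') (drop (Suc k') (window i j)) @ window i j ! k'' # drop (Suc k'') (window i j)))"
      (is "_ = ?r")
    proof -
      have 1: "drop (Suc k') (window i j) = take (k'' - Suc k') (drop (Suc k') (window i j)) @ window i j ! k'' # drop (Suc k'') (window i j)"
        using id_take_nth_drop[of "k'' - Suc k'" "drop (Suc k') (window i j)"] that by simp
      have 2: "drop (Suc k) (window i j) = take (k' - Suc k) (drop (Suc k) (window i j)) @ window i j ! k' # drop (Suc k') (window i j)"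
        using id_take_nth_drop[of "k' - Suc k" "drop (Suc k) (window i j)"] that by simp
      show ?thesis
        using id_take_nth_drop[of k "window i j"] that 1 2 by simp
    qed
    moreover have "subseq [window i j ! k, window i j ! k', window i j ! k''] ?r"
      by (auto simp: list_emb_append2 intro!: list_emb_append2 subseq_Cons2)
    ultimately show ?thesis by metis
  qed
  have tri: "triangle \<phi> (window i j ! k) (window i j ! k') (window i j ! k'')"
    if "k < k'" "k' < k''" "k'' < n" for i j k k' k''
    using triangle_\<phi>[OF sub3[OF that]] .
  have chain: "\<phi> (window i j ! k, window i j ! k') \<in> K"
    if "k < k'" "k' < n" and gens: "\<And>k. Suc k < n \<Longrightarrow> \<phi> (window i j ! k, window i j ! Suc k) \<in> K" for i j k k'
    using that(1,2)
  proof (induction k')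
    case (Suc k')
    show ?case
    proof (cases "k = k'")
      case False
      then show ?thesis using Suc tri_close[OF tri[of k k' "Suc k'" i j]] gens[of k'] by simp
    qed (use gens Suc in simp)
  qed simp
  have gens0: "\<phi> (window 0 0 ! k, window 0 0 ! Suc k) \<in> K" if "Suc k < n" for k
    using vertex_pair[of "n - k"] that unfolding \<phi>_rfl_cong[OF rfl_window_0[OF that]] by simp
  have gens1: "\<phi> (window 0 (- int l) ! k, window 0 (- int l) ! Suc k) \<in> K" if "Suc k < n" for k
    using vertex_pair[of 1] vertex_pair[of "n - k"] that unfolding \<phi>_rfl_cong[OF rfl_window_1[OF that]] by simp
  have mixed_base: "\<phi> (p (int r), q (1 - int l + int k)) \<in> K" "\<phi> (p (int r), - q (1 - int l + int k)) \<in> K"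
    if "r < m" "k < l" for r k
  proof -
    have "\<phi> (window 0 0 ! k, window 0 0 ! (l + r)) \<in> K" "\<phi> (window 0 (- int l) ! k, window 0 (- int l) ! (l + r)) \<in> K"
      using chain[of k "l + r" 0 0] chain[of k "l + r" 0 "- int l"] gens0 gens1 that n_eq by simp_all
    then show "\<phi> (p (int r), q (1 - int l + int k)) \<in> K" "\<phi> (p (int r), - q (1 - int l + int k)) \<in> K"
      using that nth_window_p[of r 0 0] nth_window_p[of r 0 "- int l"] q_neg[of "1 - int l + int k"] \<phi>.pair_sym
      by (simp_all add: nth_window_q algebra_simps)
  qed
  have mixed: "\<phi> (p i, q j) \<in> K" for i j
  proof -
    obtain r where r: "r < m" "p i = p (int r) \<or> p i = - p (int r)" using p_representative[of i 0] by auto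
    obtain k where k: "k < l" "q j = q (1 - int l + int k) \<or> q j = - q (1 - int l + int k)"
      using q_representative[of j 0] by (auto simp: algebra_simps)
    show ?thesis
      using r(2) k(2) mixed_base[OF r(1) k(1)] \<phi>.pair_uminus[of "p (int r)" "q (1 - int l + int k)"]
        \<phi>.pair_uminus[of "p (int r)" "- q (1 - int l + int k)"] by auto
  qed
  have pp: "\<phi> (p i, p (i + int r)) \<in> K" if "0 < r" "r < m" for i r
  proof (rule tri_close')
    show "triangle \<phi> (q 0) (p i) (p (i + int r))"
      using tri[of "l - 1" l "l + r" i 0] nth_window_q[of "l - 1" i 0] nth_window_p[of 0 i 0] nth_window_p[of r i 0]
        that l_pos m_pos n_eq by simp
  qed (use mixed \<phi>.pair_sym in metis)+
  have qq: "\<phi> (q j, q (j + int r)) \<in> K" if "0 < r" "r < l" for j r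
  proof (rule tri_close'')
    let ?j = "j + int l - 1"
    show "triangle \<phi> (q j) (q (j + int r)) (p 0)"
      using tri[of 0 r l 0 ?j] nth_window_q[of 0 0 ?j] nth_window_q[of r 0 ?j] nth_window_p[of 0 0 ?j]
        that l_pos m_pos n_eq by simp
  qed (use mixed \<phi>.pair_sym in metis)+
  have same: "\<phi> (f i, f k) \<in> K"
    if f: "\<And>i. f (i + int c) = - f i" "\<And>i r. 0 < r \<Longrightarrow> r < c \<Longrightarrow> \<phi> (f i, f (i + int r)) \<in> K"
      and rep: "\<exists>r<c. f k = f (i + int r) \<or> f k = - f (i + int r)" and ne: "\<bar>f i\<bar> \<noteq> \<bar>f k\<bar>" for f c i k
  proof -
    obtain r where r: "r < c" "f k = f (i + int r) \<or> f k = - f (i + int r)" using rep by blast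
    have r0: "0 < r" using r(2) ne by (cases r) auto
    show ?thesis
    proof (cases "f k = f (i + int r)")
      case False
      \<comment> \<open>Here the second letter is \<open>- f (i + r)\<close>; reversing both signs
        and using \<open>- f i = f (i + c)\<close> turns the pair into one with index difference
        \<open>c - r\<close>.\<close>
      then have "\<phi> (f i, f k) = \<phi> (f (i + int r), f ((i + int r) + int (c - r)))"
        using r f(1)[of i] \<phi>.pair_uminus[of "f i" "f k"] \<phi>.pair_sym by (simp add: of_nat_diff)
      then show ?thesis using f(2)[of "c - r" "i + int r"] r0 r(1) by simp
    qed (use f(2) r0 r in simp)
  qed
  have "x \<in> range p \<union> range q" "y \<in> range p \<union> range q" "\<bar>x\<bar> \<noteq> \<bar>y\<bar>"
    using xy covering by (simp_all add: refl_pairs_def)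
  then show ?thesis
    using mixed \<phi>.pair_sym same[of p m] same[of q l] p_shift q_shift pp qq p_representative
      q_representative[of _ "_ + int l - 1"] by (auto simp: image_iff)
qed

end

section \<open>Tuples satisfying the relations of the diagram\<close>

lemma commute_cj_iff: "commute (cj g x) y \<longleftrightarrow> commute x (cj (- g) y)"
  using commute_cj_cj[of g x "cj (- g) y"] by simp

text \<open>\<open>z\<close> and \<open>y\<close> satisfy the braid relation of length four, so the conjugates of \<open>y\<close> by powers of
  \<open>z\<close> lie in the subgroup generated by \<open>y\<close> and one of them.\<close>

lemma length_four_conjugates:
  fixes s t y :: "'g::group_add"
  assumes st: "commute s t" and sy: "braid s y" and ty: "braid t y"
  defines "z \<equiv> s + t" and "y' \<equiv> cj (- (s + t)) y"
  shows "cj (- z) y' = cj y' y" "cj z y = cj (- y) y'"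
proof -
  have sy': "s + y + s = y + s + y" and ty': "t + y + t = y + t + y" using sy ty by (simp_all add: braid_def)
  have zy: "z + y = y' + z"
    by (simp add: z_def y'_def cj_def add.assoc)
  have "z + y + z + y = s + t + y + (s + t) + y"
    by (simp add: z_def add.assoc)
  also have "\<dots> = s + t + y + (t + s) + y" by (simp only: st)
  also have "\<dots> = s + (t + y + t) + s + y" by (simp only: add.assoc)
  also have "\<dots> = s + y + t + (y + s + y)" unfolding ty' by (simp add: add.assoc)
  also have "\<dots> = s + y + (t + s) + y + s" unfolding sy'[symmetric] by (simp add: add.assoc)
  also have "\<dots> = (s + y + s) + t + y + s" unfolding st[symmetric] by (simp add: add.assoc)
  also have "\<dots> = y + s + (y + t + y) + s" unfolding sy' by (simp add: add.assoc)
  also have "\<dots> = y + s + t + y + (t + s)" unfolding ty'[symmetric] by (simp add: add.assoc)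
  also have "\<dots> = y + z + y + z" unfolding st[symmetric] by (simp add: z_def add.assoc)
  finally have "(z + y) + (z + y) = y + (z + y) + z" by (simp add: add.assoc)
  then have "(y' + (z + y')) + z = (y + y' + z) + z" unfolding zy by (simp add: add.assoc)
  then have *: "y' + (z + y') = y + y' + z" by simp
  have "- y' + (y' + (z + y')) = - y' + (y + y' + z)" unfolding * ..
  then have "z + y' = - y' + y + y' + z" by (simp add: add.assoc)
  then show 1: "cj (- z) y' = cj y' y" by (simp add: cj_def diff_eq_eq)
  have "cj z (cj (- z) y') = cj (cj z y') (cj z y)" unfolding 1 by (rule cj_cj_distrib)
  moreover have "cj z y' = y" by (simp add: z_def y'_def)
  ultimately have "y' = cj y (cj z y)" by simp
  then show "cj z y = cj (- y) y'" by simp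
qed

locale carter_index =
  fixes m n :: nat
  assumes n4: "4 \<le> n" and m1: "1 \<le> m" and mn: "m \<le> n div 2"
begin

text \<open>For \<open>m = 1\<close> the vertices 1 and \<open>m\<close> coincide, hence the guard
  \<open>2 \<le> m\<close>.\<close>

definition adj :: "nat \<Rightarrow> nat \<Rightarrow> bool" where
  "adj i j \<longleftrightarrow> (2 \<le> i \<and> j = i + 1) \<or> (2 \<le> j \<and> i = j + 1) \<or>
     (i = 1 \<and> (j = m + 2 \<or> 2 \<le> m \<and> j = m)) \<or> (j = 1 \<and> (i = m + 2 \<or> 2 \<le> m \<and> i = m))"

lemma carter_edges_iff: "i \<in> {1..n} \<Longrightarrow> j \<in> {1..n} \<Longrightarrow> i \<noteq> j \<Longrightarrow> {i, j} \<in> carter_edges m n \<longleftrightarrow> adj i j"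
proof -
  assume ij: "i \<in> {1..n}" "j \<in> {1..n}" "i \<noteq> j"
  have "{i, j} \<in> {{k, k + 1} | k. 2 \<le> k \<and> k \<le> n - 1} \<longleftrightarrow> (2 \<le> i \<and> j = i + 1) \<or> (2 \<le> j \<and> i = j + 1)"
  proof
    assume "(2 \<le> i \<and> j = i + 1) \<or> (2 \<le> j \<and> i = j + 1)"
    then show "{i, j} \<in> {{k, k + 1} | k. 2 \<le> k \<and> k \<le> n - 1}"
    proof
      assume "2 \<le> i \<and> j = i + 1"
      then show ?thesis using ij by (intro CollectI exI[of _ i]) simp
    next
      assume "2 \<le> j \<and> i = j + 1"
      then show ?thesis using ij by (intro CollectI exI[of _ j]) (simp add: insert_commute)
    qed
  next
    assume "{i, j} \<in> {{k, k + 1} | k. 2 \<le> k \<and> k \<le> n - 1}"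
    then obtain k where "{i, j} = {k, k + 1}" "2 \<le> k" by blast
    then show "(2 \<le> i \<and> j = i + 1) \<or> (2 \<le> j \<and> i = j + 1)" unfolding doubleton_eq_iff by blast
  qed
  moreover have "{i, j} \<in> (if m = 1 then {{1, 3}} else {{1, m}, {1, m + 2}}) \<longleftrightarrow>
      (i = 1 \<and> (j = m + 2 \<or> 2 \<le> m \<and> j = m)) \<or> (j = 1 \<and> (i = m + 2 \<or> 2 \<le> m \<and> i = m))"
    using m1 by (cases "m = 1") (simp_all add: doubleton_eq_iff, linarith+)
  ultimately show "{i, j} \<in> carter_edges m n \<longleftrightarrow> adj i j"
    unfolding carter_edges_def adj_def Un_iff by blast
qed

lemma adj_Suc: "2 \<le> j \<Longrightarrow> i = j + 1 \<or> j + 1 = i \<Longrightarrow> adj i j" "2 \<le> j \<Longrightarrow> i = j + 1 \<or> j + 1 = i \<Longrightarrow> adj j i"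
  unfolding adj_def by auto

lemma not_adj: "2 \<le> i \<Longrightarrow> 2 \<le> j \<Longrightarrow> j \<noteq> i + 1 \<Longrightarrow> i \<noteq> j + 1 \<Longrightarrow> \<not> adj i j"
  by (simp add: adj_def)

definition artin_sat :: "(nat \<Rightarrow> 'g::group_add) \<Rightarrow> bool" where
  "artin_sat x \<longleftrightarrow> (\<forall>i\<in>{1..n}. \<forall>j\<in>{1..n}. i \<noteq> j \<longrightarrow> (if adj i j then braid (x i) (x j) else commute (x i) (x j)))"

text \<open>The twisted cycle commutator in a form involving \<open>x 1\<close> and
  \<open>x (m + 1)\<close> only through their product. As these two commute, it is insensitive to
  exchanging them.\<close>

definition twisted_sat :: "(nat \<Rightarrow> 'g::group_add) \<Rightarrow> bool" where
  "twisted_sat x \<longleftrightarrow> artin_sat x \<and> (2 \<le> m \<longrightarrow> commute (x m) (cj (- (x 1 + x (m + 1))) (x (m + 2))))"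

text \<open>Candidate images of the generators: with \<open>z = x 1 + x (m + 1)\<close>, the choice
  \<open>e = z\<close> gives the automorphism and \<open>e = - z\<close> its inverse.\<close>

definition tw :: "'g::group_add \<Rightarrow> (nat \<Rightarrow> 'g) \<Rightarrow> nat \<Rightarrow> 'g" where
  "tw e x k = (if k = 1 then x (m + 1) else if k = m + 1 then x 1 else if k = m then cj e (x m) else x k)"

lemma m2n: "m + 2 \<le> n" using n4 mn by linarith

context
  fixes x :: "nat \<Rightarrow> 'g::group_add"
  assumes sat: "artin_sat x"
begin

lemma sat_braid: "i \<in> {1..n} \<Longrightarrow> j \<in> {1..n} \<Longrightarrow> adj i j \<Longrightarrow> braid (x i) (x j)"
proof -
  assume ij: "i \<in> {1..n}" "j \<in> {1..n}" "adj i j"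
  then have "i \<noteq> j" unfolding adj_def by linarith
  then have "if adj i j then braid (x i) (x j) else commute (x i) (x j)"
    using sat ij(1,2) unfolding artin_sat_def by blast
  then show "braid (x i) (x j)" using ij(3) by simp
qed

lemma sat_commute: "i \<in> {1..n} \<Longrightarrow> j \<in> {1..n} \<Longrightarrow> \<not> adj i j \<Longrightarrow> commute (x i) (x j)"
proof -
  assume ij: "i \<in> {1..n}" "j \<in> {1..n}" "\<not> adj i j"
  then have "i \<noteq> j \<Longrightarrow> if adj i j then braid (x i) (x j) else commute (x i) (x j)"
    using sat unfolding artin_sat_def by blast
  then show "commute (x i) (x j)" using ij(3) by (cases "i = j") simp_all
qed

lemma s_t: "commute (x 1) (x (m + 1))"
  using m1 m2n by (intro sat_commute) (auto simp: adj_def)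

lemma z_far: "k \<in> {1..n} \<Longrightarrow> k \<noteq> m + 2 \<Longrightarrow> k \<noteq> m \<or> m = 1 \<Longrightarrow> commute (x k) (x 1 + x (m + 1))"
proof (rule commute_add)
  assume k: "k \<in> {1..n}" "k \<noteq> m + 2" "k \<noteq> m \<or> m = 1"
  show "commute (x k) (x 1)" "commute (x k) (x (m + 1))"
  proof -
    consider "k = 1" | "k = m + 1" | "k \<noteq> 1" "k \<noteq> m + 1" by blast
    then have "commute (x k) (x 1) \<and> commute (x k) (x (m + 1))"
    proof cases
      case 3
      then have "\<not> adj k 1" "\<not> adj k (m + 1)" using k m1 by (auto simp: adj_def)
      moreover have "1 \<in> {1..n}" "m + 1 \<in> {1..n}" using m2n by simp_all
      ultimately show ?thesis using k(1) by (blast intro: sat_commute)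
    qed (use s_t in auto)
    then show "commute (x k) (x 1)" "commute (x k) (x (m + 1))" by blast+
  qed
qed

text \<open>Moving the conjugation by \<open>x m\<close> to the other side produces
  \<open>cj (- x m) (x 1)\<close>, which the braid relation replaces by
  \<open>cj (x 1) (x m)\<close>; the conjugation by \<open>x 1\<close> then joins the one by
  \<open>x (m + 1)\<close>.\<close>

lemma twisted_commutator_iff:
  assumes "2 \<le> m"
  shows "commute (x 1) (- x m + x (m + 1) + x (m + 2) - x (m + 1) + x m) \<longleftrightarrow>
    commute (x m) (cj (- (x 1 + x (m + 1))) (x (m + 2)))"
proof -
  have "braid (x 1) (x m)" using assms m2n by (intro sat_braid) (auto simp: adj_def)
  then have c: "cj (- x m) (x 1) = cj (x 1) (x m)" by (simp add: braid_iff_cj)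
  have "- x m + x (m + 1) + x (m + 2) - x (m + 1) + x m = cj (x m) (cj (- x (m + 1)) (x (m + 2)))"
    by (simp add: cj_def add.assoc diff_conv_add_uminus del: add_uminus_conv_diff)
  then have "commute (x 1) (- x m + x (m + 1) + x (m + 2) - x (m + 1) + x m) \<longleftrightarrow>
      commute (cj (x m) (cj (- x (m + 1)) (x (m + 2)))) (x 1)" by auto
  also have "\<dots> \<longleftrightarrow> commute (cj (x 1) (x m)) (cj (- x (m + 1)) (x (m + 2)))"
    unfolding commute_cj_iff[of "x m"] c by auto
  also have "\<dots> \<longleftrightarrow> commute (x m) (cj (- x 1) (cj (- x (m + 1)) (x (m + 2))))"
    by (rule commute_cj_iff)
  also have "cj (- x 1) (cj (- x (m + 1)) (x (m + 2))) = cj (- (x 1 + x (m + 1))) (x (m + 2))"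
    by (simp add: cj_cj minus_add diff_conv_add_uminus del: add_uminus_conv_diff)
  finally show ?thesis .
qed

end

text \<open>Up to exchanging the indices 1 and \<open>m + 1\<close>, the new tuple agrees with the
  old one except at \<open>m\<close>, and with its conjugate by \<open>e\<close> except at
  \<open>m + 2\<close>. Relations avoiding one of the two are inherited. For the pair
  \<open>m\<close>, \<open>m + 2\<close> the conjugates of \<open>x (m + 2)\<close> that occur lie,
  by \<open>length_four_conjugates\<close>, in the subgroup generated by \<open>x (m + 2)\<close>
  and its conjugate by \<open>- z\<close>; both commute with \<open>x m\<close>, the second by the
  twisted commutator.\<close>

lemma tw_sat:
  fixes x :: "nat \<Rightarrow> 'g::group_add"
  assumes tsat: "twisted_sat x" and e: "e = x 1 + x (m + 1) \<or> e = - (x 1 + x (m + 1))"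
  shows "twisted_sat (tw e x)"
proof -
  define z where "z = x 1 + x (m + 1)"
  define \<pi> where "\<pi> k = (if k = 1 then m + 1 else if k = m + 1 then 1 else k)" for k
  have ez: "e = z \<or> e = - z" using e unfolding z_def .
  have sat: "artin_sat x" using tsat by (simp add: twisted_sat_def)
  have \<pi>_mem: "\<pi> k \<in> {1..n}" if "k \<in> {1..n}" for k using that m2n m1 by (auto simp: \<pi>_def)
  have \<pi>_adj: "adj (\<pi> i) (\<pi> j) \<longleftrightarrow> adj i j" if "i \<in> {1..n}" "j \<in> {1..n}" for i j
    using that m1 by (auto simp: \<pi>_def adj_def)
  have fixed: "cj e (x k) = x k" if "k \<in> {1..n}" "k \<noteq> m + 2" "k \<noteq> m \<or> m = 1" for k
  proof -
    have "commute z (x k)" using z_far[OF sat that] by (simp add: z_def)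
    then show ?thesis using ez cj_fixed cj_fixed_uminus by blast
  qed
  have tw1: "tw e x k = cj e (x (\<pi> k))" if "k \<in> {1..n}" "k \<noteq> m + 2" for k
  proof (cases "k = m \<and> 2 \<le> m")
    case False
    then have "x (\<pi> k) = tw e x k" using that m1 by (auto simp: tw_def \<pi>_def)
    moreover have "\<pi> k \<noteq> m + 2" "\<pi> k \<noteq> m \<or> m = 1" using False that m1 by (auto simp: \<pi>_def)
    ultimately show ?thesis using fixed[OF \<pi>_mem[OF that(1)]] by simp
  qed (use m1 in \<open>auto simp: tw_def \<pi>_def\<close>)
  have tw2: "tw e x k = x (\<pi> k)" if "k \<noteq> m \<or> m = 1" for k
    using that by (auto simp: tw_def \<pi>_def)
  have abc: "2 \<le> m \<Longrightarrow> commute (x m) (x (m + 2))"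
    using m2n by (intro sat_commute[OF sat]) (auto simp: adj_def)
  note four = length_four_conjugates[of "x 1" "x (m + 1)" "x (m + 2)", OF s_t[OF sat]
      sat_braid[OF sat, of 1 "m + 2"] sat_braid[OF sat, of "m + 1" "m + 2"], folded z_def]
  have four1: "cj (- z) (cj (- z) (x (m + 2))) = cj (cj (- z) (x (m + 2))) (x (m + 2))"
    "cj z (x (m + 2)) = cj (- x (m + 2)) (cj (- z) (x (m + 2)))"
    using four m2n m1 by (simp_all add: adj_def)
  have special: "commute (cj e (x m)) (x (m + 2))" "commute (cj e (x m)) (cj (- z) (x (m + 2)))" if m: "2 \<le> m"
  proof -
    have tc: "commute (x m) (cj (- z) (x (m + 2)))" using tsat m by (simp add: twisted_sat_def z_def)
    have up: "commute (x m) (cj z (x (m + 2)))"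
      unfolding four1(2) by (rule commute_cj[OF _ tc]) (rule commute_uminus[OF abc[OF m]])
    have down: "commute (x m) (cj (- z) (cj (- z) (x (m + 2))))"
      unfolding four1(1) by (rule commute_cj[OF tc abc[OF m]])
    show "commute (cj e (x m)) (x (m + 2))" "commute (cj e (x m)) (cj (- z) (x (m + 2)))"
      unfolding commute_cj_iff[of e] using ez tc up down abc[OF m] by auto
  qed
  have "if adj i j then braid (tw e x i) (tw e x j) else commute (tw e x i) (tw e x j)"
    if ij: "i \<in> {1..n}" "j \<in> {1..n}" "i \<noteq> j" for i j
  proof -
    have xx: "if adj i j then braid (x (\<pi> i)) (x (\<pi> j)) else commute (x (\<pi> i)) (x (\<pi> j))"
      using sat_braid[OF sat \<pi>_mem[OF ij(1)] \<pi>_mem[OF ij(2)]] sat_commute[OF sat \<pi>_mem[OF ij(1)] \<pi>_mem[OF ij(2)]]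
        \<pi>_adj[OF ij(1,2)] by simp
    consider "i \<noteq> m + 2" "j \<noteq> m + 2" | "i \<noteq> m \<or> m = 1" "j \<noteq> m \<or> m = 1"
      | "i = m" "j = m + 2" "2 \<le> m" | "j = m" "i = m + 2" "2 \<le> m" using m1 by linarith
    then show ?thesis
    proof cases
      case 1
      then show ?thesis using xx tw1 ij by simp
    next
      case 2
      then show ?thesis using xx tw2 by simp
    next
      case 3
      then show ?thesis using special(1) by (simp add: tw_def adj_def)
    next
      case 4
      then show ?thesis using special(1) by (simp add: tw_def adj_def)
    qed
  qed
  moreover have "commute (tw e x m) (cj (- (tw e x 1 + tw e x (m + 1))) (tw e x (m + 2)))" if m: "2 \<le> m"
    using special(2)[OF m] s_t[OF sat] m by (simp add: tw_def z_def)
  ultimately show ?thesis unfolding twisted_sat_def artin_sat_def by blast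
qed

lemma twisted_chain_of_sat:
  fixes x :: "nat \<Rightarrow> 'g::group_add"
  assumes tsat: "twisted_sat x" and \<sigma>: "\<And>k. k \<in> {1..n} \<Longrightarrow> cj \<sigma> (x k) = tw (x 1 + x (m + 1)) x k"
  shows "twisted_chain m (n - m) (\<lambda>i. x (m - i)) (\<lambda>j. x (m + 2 + j)) \<sigma> (- \<sigma> + (x 1 + x (m + 1))) (x (m + 1))"
proof -
  define z where "z = x 1 + x (m + 1)"
  have sat: "artin_sat x" using tsat by (simp add: twisted_sat_def)
  note braid' = sat_braid[OF sat] and commute' = sat_commute[OF sat]
  have \<sigma>s: "cj \<sigma> (x 1) = x (m + 1)" "cj \<sigma> (x (m + 1)) = x 1"
    using \<sigma>[of 1] \<sigma>[of "m + 1"] m2n m1 by (simp_all add: tw_def)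
  have \<sigma>z: "commute \<sigma> z"
    using \<sigma>s s_t[OF sat] cj_eq_self_iff[of \<sigma> z] by (simp add: z_def cj_add)
  have \<sigma>x: "commute \<sigma> (x k)" if "k \<in> {2..n}" "k \<noteq> m" "k \<noteq> m + 1" for k
    using \<sigma>[of k] that cj_eq_self_iff[of \<sigma> "x k"] by (simp add: tw_def)
  have zx: "commute z (x k)" if "k \<in> {1..n}" "k \<noteq> m + 2" "k \<noteq> m \<or> m = 1" for k
    using z_far[OF sat that] by (simp add: z_def)
  have \<tau>: "commute (x k) (- \<sigma> + z)" if "commute \<sigma> (x k)" "commute z (x k)" for k
    using that by (intro commute_add commute_uminus) simp_all
  \<comment> \<open>\<open>\<sigma>\<close> and \<open>z\<close> conjugate \<open>x m\<close> in the
    same way, so their quotient centralizes it.\<close>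
  have \<tau>m: "commute (x m) (- \<sigma> + z)" if "2 \<le> m"
  proof -
    have "cj \<sigma> (x m) = cj z (x m)" using \<sigma>[of m] that m2n by (simp add: tw_def z_def)
    then have "cj (- \<sigma>) (cj z (x m)) = x m" by (metis cj_minus_cancel)
    then have "cj z (cj (- \<sigma>) (x m)) = x m"
      using cj_commute[of "- \<sigma>" z "x m"] commute_uminus[of z \<sigma>] \<sigma>z by simp
    then have "cj (- \<sigma> + z) (x m) = x m" by (simp add: cj_cj)
    then show ?thesis by (simp add: cj_eq_self_iff)
  qed
  show ?thesis
    unfolding z_def[symmetric]
  proof
    show "0 < m" "0 < n - m" using m1 m2n by auto
    have idx: "m - i \<in> {1..n}" "2 \<le> m - i" if "i < m - 1" for i using that m2n by auto
    have idx': "m + 2 + j \<in> {1..n}" if "j < n - m - 1" for j using that by auto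
    have idx1: "m + 1 \<in> {1..n}" "2 \<le> m + 1" using m1 m2n by auto
    show "braid_chain (m - 1) (\<lambda>i. x (m - i))"
      unfolding braid_chain_def
    proof (intro conjI allI impI)
      show "braid (x (m - i)) (x (m - Suc i))" if "Suc i < m - 1" for i
        using that idx[of i] idx[of "Suc i"] by (intro braid' adj_Suc(1)) auto
      show "commute (x (m - i)) (x (m - j))" if "Suc i < j" "j < m - 1" for i j
        using that idx[of i] idx[of j] by (intro commute' not_adj) auto
    qed
    show "braid_chain (n - m - 1) (\<lambda>j. x (m + 2 + j))"
      unfolding braid_chain_def
    proof (intro conjI allI impI)
      show "braid (x (m + 2 + j)) (x (m + 2 + Suc j))" if "Suc j < n - m - 1" for j
        using that idx'[of j] idx'[of "Suc j"] by (intro braid' adj_Suc(2)) auto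
      show "commute (x (m + 2 + i)) (x (m + 2 + j))" if "Suc i < j" "j < n - m - 1" for i j
        using that idx'[of i] idx'[of j] by (intro commute' not_adj) auto
    qed
    show "commute (x (m - i)) (x (m + 2 + j))" if "i < m - 1" "j < n - m - 1" for i j
      using idx[OF that(1)] idx'[OF that(2)] by (intro commute' not_adj) auto
    show "commute \<sigma> (x (m - i))" if "0 < i" "i < m - 1" for i
      using that m2n by (intro \<sigma>x) auto
    show "commute \<sigma> (x (m + 2 + j))" if "j < n - m - 1" for j
      using that m2n by (intro \<sigma>x) auto
    show "commute (- \<sigma> + z) (x (m - i))" if "i < m - 1" for i
    proof (cases "i = 0")
      case True
      then show ?thesis using \<tau>m that by simp
    next
      case False
      then have "m - i \<in> {2..n}" "m - i \<in> {1..n}" "m - i \<noteq> m" "m - i \<noteq> m + 1" "m - i \<noteq> m + 2"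
        using that m2n by auto
      then have "commute (x (m - i)) (- \<sigma> + z)" by (intro \<tau> \<sigma>x zx disjI1)
      then show ?thesis by simp
    qed
    show "commute (- \<sigma> + z) (x (m + 2 + j))" if "0 < j" "j < n - m - 1" for j
      using \<tau>[of "m + 2 + j"] \<sigma>x[of "m + 2 + j"] zx[of "m + 2 + j"] that m2n by simp
    show "commute \<sigma> (- \<sigma> + z)"
      using \<sigma>z by (intro commute_add commute_uminus) simp_all
    show "braid (x (m + 1)) (x (m - 0))" if "1 < m"
      using idx[of 0] idx1 that by (intro braid' adj_Suc(1)) auto
    show "braid (x (m + 1)) (x (m + 2 + 0))" if "1 < n - m"
      using idx'[of 0] idx1 that by (intro braid' adj_Suc(2)) auto
    show "commute (x (m + 1)) (x (m - i))" if "0 < i" "i < m - 1" for i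
      using idx[OF that(2)] idx1 that by (intro commute' not_adj) auto
    show "commute (x (m + 1)) (x (m + 2 + j))" if "0 < j" "j < n - m - 1" for j
      using idx'[OF that(2)] idx1 that by (intro commute' not_adj) auto
    have "- \<sigma> + z = z + - \<sigma>" using commute_uminus[of z \<sigma>] \<sigma>z by simp
    also have "\<dots> = x (m + 1) + cj \<sigma> (x (m + 1)) + - \<sigma>" using \<sigma>s s_t[OF sat] by (simp add: z_def)
    also have "\<dots> = x (m + 1) - \<sigma> + x (m + 1)"
      by (simp add: cj_def add.assoc diff_conv_add_uminus del: add_uminus_conv_diff)
    finally show "x (m + 1) - \<sigma> + x (m + 1) = - \<sigma> + z" by simp
    have "cj (\<sigma> + \<sigma>) (x (m + 1)) = x (m + 1)" by (simp only: cj_plus \<sigma>s)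
    then show "commute (\<sigma> + \<sigma>) (x (m + 1))" by (simp add: cj_eq_self_iff)
  qed
qed

end

section \<open>The isomorphism\<close>

lemma subseq_upt: "sorted_wrt (<) ks \<Longrightarrow> set ks \<subseteq> {a..<b} \<Longrightarrow> subseq ks [a..<b]"
proof (induction ks arbitrary: a)
  case (Cons k ks)
  then have k: "a \<le> k" "k < b" by auto
  have "subseq ks [Suc k..<b]" using Cons by (intro Cons.IH) fastforce+
  moreover have "[a..<b] = [a..<k] @ k # [Suc k..<b]"
    using k upt_add_eq_append[of a k "b - k"] by (simp add: upt_conv_Cons)
  ultimately show ?case by (simp add: list_emb_append2)
qed simp

lemma subseq_map_nth:
  assumes "sorted_wrt (<) ks" "set ks \<subseteq> {0..<length xs}"
  shows "subseq (map ((!) xs) ks) xs"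
  using subseq_map[OF subseq_upt[OF assms], of "(!) xs"] by (simp add: map_nth)

lemma braid_of_triangle:
  assumes "triangle \<psi> a b c"
  shows "braid (\<psi> (a, b)) (\<psi> (b, c))"
proof -
  have 1: "\<psi> (b, c) + \<psi> (a, b) = \<psi> (a, c) + \<psi> (b, c)" and 2: "\<psi> (b, c) + \<psi> (a, b) = \<psi> (a, b) + \<psi> (a, c)"
    using assms unfolding triangle_def by blast+
  have "\<psi> (b, c) + \<psi> (a, b) + \<psi> (b, c) = \<psi> (a, b) + (\<psi> (a, c) + \<psi> (b, c))"
    unfolding 2 by (simp only: add.assoc)
  also have "\<dots> = \<psi> (a, b) + (\<psi> (b, c) + \<psi> (a, b))" by (simp only: 1)
  finally show ?thesis by (simp add: braid_def add.assoc)
qed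

lemma braid_chain_of_dual_rels:
  assumes "dual_rels \<psi> xs"
  shows "braid_chain (length xs - 1) (\<lambda>i. \<psi> (xs ! i, xs ! Suc i))"
  unfolding braid_chain_def
proof (intro conjI allI impI)
  fix i assume "Suc i < length xs - 1"
  then have "subseq (map ((!) xs) [i, Suc i, Suc (Suc i)]) xs" by (intro subseq_map_nth) auto
  then show "braid (\<psi> (xs ! i, xs ! Suc i)) (\<psi> (xs ! Suc i, xs ! Suc (Suc i)))"
    using assms by (intro braid_of_triangle) (simp add: dual_rels_def)
next
  fix i j assume "Suc i < j" "j < length xs - 1"
  then have "subseq (map ((!) xs) [i, Suc i, j, Suc j]) xs" by (intro subseq_map_nth) auto
  then have "noncrossing \<psi> (xs ! i) (xs ! Suc i) (xs ! j) (xs ! Suc j)"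
    using assms by (simp add: dual_rels_def)
  then show "commute (\<psi> (xs ! i, xs ! Suc i)) (\<psi> (xs ! j, xs ! Suc j))"
    by (simp add: noncrossing_def)
qed

context carter_index
begin

definition tc_word :: "nat word" where
  "tc_word = [(1, True), (m, False), (m + 1, True), (m + 2, True), (m + 1, False), (m, True),
     (1, False), (m, False), (m + 1, True), (m + 2, False), (m + 1, False), (m, True)]"

definition rels :: "(nat word \<times> nat word) set" where
  "rels = (if 2 \<le> m then insert (tc_word, []) (artin_relations {1..n} (carter_edges m n))
     else artin_relations {1..n} (carter_edges m n))"

definition P :: "nat word set monoid" where "P = presented_group {1..n} rels"

definition x\<^sub>P :: "nat \<Rightarrow> nat word set" where "x\<^sub>P = pres_gen {1..n} rels"

lemma tc_word_words: "2 \<le> m \<Longrightarrow> tc_word \<in> words {1..n}"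
  using m2n by (simp add: tc_word_def)

lemma word_eval_tc:
  "word_eval perm_group y tc_word = 0 \<longleftrightarrow>
    commute (y 1) (- y m + y (m + 1) + y (m + 2) - y (m + 1) + y m)" for y :: "nat \<Rightarrow> 'b perms"
proof -
  let ?Y = "- y m + y (m + 1) + y (m + 2) - y (m + 1) + y m"
  have "word_eval perm_group y tc_word = (y 1 + ?Y) - (?Y + y 1)"
    by (simp add: tc_word_def add.assoc minus_add diff_conv_add_uminus del: add_uminus_conv_diff)
  then show ?thesis by (simp only: right_minus_eq)
qed

lemma rels_of_twisted_sat:
  fixes y :: "nat \<Rightarrow> 'b perms"
  assumes tsat: "twisted_sat y" and uv: "(u, v) \<in> rels"
  shows "word_eval perm_group y u = word_eval perm_group y v"
proof -
  have sat: "artin_sat y" using tsat by (simp add: twisted_sat_def)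
  consider "2 \<le> m" "u = tc_word" "v = []" | "(u, v) \<in> artin_relations {1..n} (carter_edges m n)"
    using uv by (auto simp: rels_def split: if_splits)
  then show ?thesis
  proof cases
    case 1
    then show ?thesis
      using tsat word_eval_tc[of y] twisted_commutator_iff[OF sat 1(1)] by (simp add: twisted_sat_def)
  next
    case 2
    then show ?thesis
      unfolding artin_relations_def
    proof (elim UnE CollectE exE conjE)
      fix a b assume *: "(u, v) = ([(a, True), (b, True), (a, True)], [(b, True), (a, True), (b, True)])"
        "a \<in> {1..n}" "b \<in> {1..n}" "a \<noteq> b" "{a, b} \<in> carter_edges m n"
      then have "braid (y a) (y b)" using sat_braid[OF sat] carter_edges_iff by blast
      then show ?thesis using *(1) by (simp add: braid_def add.assoc)
    next
      fix a b assume *: "(u, v) = ([(a, True), (b, True)], [(b, True), (a, True)])"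
        "a \<in> {1..n}" "b \<in> {1..n}" "a \<noteq> b" "{a, b} \<notin> carter_edges m n"
      then have "commute (y a) (y b)" using sat_commute[OF sat] carter_edges_iff by blast
      then show ?thesis using *(1) by simp
    qed
  qed
qed

sublocale P: group P unfolding P_def by (rule group_presented_group)

lemma x\<^sub>P_carrier: "k \<in> {1..n} \<Longrightarrow> x\<^sub>P k \<in> carrier P"
  unfolding P_def x\<^sub>P_def by (rule pres_gen_carrier)

lemma P_hom_eqI:
  "group K \<Longrightarrow> h \<in> hom P K \<Longrightarrow> h' \<in> hom P K \<Longrightarrow> (\<And>k. k \<in> {1..n} \<Longrightarrow> h (x\<^sub>P k) = h' (x\<^sub>P k)) \<Longrightarrow>
    y \<in> carrier P \<Longrightarrow> h y = h' y"
  unfolding P_def x\<^sub>P_def by (rule presented_group_hom_eqI)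

definition xr :: "nat \<Rightarrow> nat word set perms" where "xr k = right_mult P (x\<^sub>P k)"

lemma xr_rels:
  assumes "(u, v) \<in> rels" "u \<in> words {1..n}" "v \<in> words {1..n}"
  shows "word_eval perm_group xr u = word_eval perm_group xr v"
proof -
  have g: "x\<^sub>P \<in> {1..n} \<rightarrow> carrier P" using x\<^sub>P_carrier by blast
  have "right_mult P \<circ> x\<^sub>P = xr" by (simp add: fun_eq_iff xr_def)
  then show ?thesis
    using hom_word_eval[OF P.is_group group_perm_group P.right_mult_hom g assms(2)]
      hom_word_eval[OF P.is_group group_perm_group P.right_mult_hom g assms(3)]
      pres_gen_relation[OF assms, folded P_def x\<^sub>P_def] by simp
qed

lemma twisted_sat_xr: "twisted_sat xr"
proof -
  have sat: "artin_sat xr"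
    unfolding artin_sat_def
  proof (intro ballI impI)
    fix i j assume ij: "i \<in> {1..n}" "j \<in> {1..n}" "i \<noteq> j"
    show "if adj i j then braid (xr i) (xr j) else commute (xr i) (xr j)"
    proof (cases "adj i j")
      case True
      then have "([(i, True), (j, True), (i, True)], [(j, True), (i, True), (j, True)]) \<in> rels"
        using ij carter_edges_iff[OF ij] unfolding rels_def artin_relations_def by auto
      from xr_rels[OF this] show ?thesis using True ij by (simp add: braid_def add.assoc)
    next
      case False
      then have "([(i, True), (j, True)], [(j, True), (i, True)]) \<in> rels"
        using ij carter_edges_iff[OF ij] unfolding rels_def artin_relations_def by auto
      from xr_rels[OF this] show ?thesis using False ij by simp
    qed
  qed
  moreover have "commute (xr m) (cj (- (xr 1 + xr (m + 1))) (xr (m + 2)))" if m: "2 \<le> m"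
  proof -
    have "(tc_word, []) \<in> rels" using m by (simp add: rels_def)
    from xr_rels[OF this tc_word_words[OF m]] show ?thesis
      using word_eval_tc[of xr] twisted_commutator_iff[OF sat m] by simp
  qed
  ultimately show ?thesis by (simp add: twisted_sat_def)
qed

lemma hom_from_P:
  assumes H: "group H" and f: "f \<in> {1..n} \<rightarrow> carrier H" and tsat: "twisted_sat (\<lambda>k. right_mult H (f k))"
  obtains h where "h \<in> hom P H" "\<And>k. k \<in> {1..n} \<Longrightarrow> h (x\<^sub>P k) = f k"
proof -
  interpret H: group H by (rule H)
  have rel: "word_eval H f u = word_eval H f v"
    if "(u, v) \<in> rels" "u \<in> words {1..n}" "v \<in> words {1..n}" for u v
  proof (rule H.right_mult_inj)
    have "(right_mult H \<circ> f) = (\<lambda>k. right_mult H (f k))" by (simp add: fun_eq_iff)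
    then show "right_mult H (word_eval H f u) = right_mult H (word_eval H f v)"
      using hom_word_eval[OF H group_perm_group H.right_mult_hom f] that rels_of_twisted_sat[OF tsat that(1)] by simp
  qed (use H.word_eval_closed[OF f] that in auto)
  obtain h where h: "h \<in> hom (presented_group {1..n} rels) H"
    and ev: "\<And>u. u \<in> words {1..n} \<Longrightarrow> h (pres_class {1..n} rels u) = word_eval H f u"
    by (rule H.presented_group_universal[OF f, of rels], rule rel, assumption+) (rule that)
  have "h (x\<^sub>P k) = f k" if "k \<in> {1..n}" for k
    using ev[of "[(k, True)]"] that f by (simp add: x\<^sub>P_def pres_gen_def Pi_iff)
  moreover have "h \<in> hom P H" using h by (simp add: P_def)
  ultimately show thesis using that by blast
qed

definition tw\<^sub>P :: "nat word set \<Rightarrow> nat \<Rightarrow> nat word set" where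
  "tw\<^sub>P e k = (if k = 1 then x\<^sub>P (m + 1) else if k = m + 1 then x\<^sub>P 1
     else if k = m then inv\<^bsub>P\<^esub> e \<otimes>\<^bsub>P\<^esub> (x\<^sub>P m \<otimes>\<^bsub>P\<^esub> e) else x\<^sub>P k)"

lemma idx: "1 \<in> {1..n}" "m \<in> {1..n}" "m + 1 \<in> {1..n}" "m + 2 \<in> {1..n}"
  using m1 m2n by auto

lemma right_mult_tw\<^sub>P: "e \<in> carrier P \<Longrightarrow> right_mult P (tw\<^sub>P e k) = tw (right_mult P e) xr k"
  using x\<^sub>P_carrier[OF idx(2)]
  by (simp add: tw\<^sub>P_def tw_def xr_def P.right_mult_mult P.right_mult_inv cj_def add.assoc)

lemma tw\<^sub>P_carrier: "e \<in> carrier P \<Longrightarrow> tw\<^sub>P e \<in> {1..n} \<rightarrow> carrier P"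
  using x\<^sub>P_carrier[OF idx(1)] x\<^sub>P_carrier[OF idx(2)] x\<^sub>P_carrier[OF idx(3)] x\<^sub>P_carrier
  by (auto simp: tw\<^sub>P_def)

text \<open>The automorphism is realized inside the group of permutations of the carrier, next to the
  right translations.\<close>

lemma twisting_permutation:
  obtains \<sigma> where "\<And>k. k \<in> {1..n} \<Longrightarrow> cj \<sigma> (xr k) = tw (xr 1 + xr (m + 1)) xr k"
proof -
  define z where "z = x\<^sub>P 1 \<otimes>\<^bsub>P\<^esub> x\<^sub>P (m + 1)"
  have z: "z \<in> carrier P" "right_mult P z = xr 1 + xr (m + 1)"
    using x\<^sub>P_carrier[OF idx(1)] x\<^sub>P_carrier[OF idx(3)] by (simp_all add: z_def P.right_mult_mult xr_def)
  have z': "inv\<^bsub>P\<^esub> z \<in> carrier P" "right_mult P (inv\<^bsub>P\<^esub> z) = - (xr 1 + xr (m + 1))"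
    using z by (simp_all add: P.right_mult_inv)
  have "twisted_sat (\<lambda>k. right_mult P (tw\<^sub>P z k))"
    using tw_sat[OF twisted_sat_xr] unfolding right_mult_tw\<^sub>P[OF z(1)] z(2) by blast
  then obtain h where h: "h \<in> hom P P" "\<And>k. k \<in> {1..n} \<Longrightarrow> h (x\<^sub>P k) = tw\<^sub>P z k"
    using hom_from_P[OF P.is_group tw\<^sub>P_carrier[OF z(1)]] by metis
  have "twisted_sat (\<lambda>k. right_mult P (tw\<^sub>P (inv\<^bsub>P\<^esub> z) k))"
    using tw_sat[OF twisted_sat_xr] unfolding right_mult_tw\<^sub>P[OF z'(1)] z'(2) by blast
  then obtain h' where h': "h' \<in> hom P P" "\<And>k. k \<in> {1..n} \<Longrightarrow> h' (x\<^sub>P k) = tw\<^sub>P (inv\<^bsub>P\<^esub> z) k"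
    using hom_from_P[OF P.is_group tw\<^sub>P_carrier[OF z'(1)]] by metis
  interpret h: group_hom P P h by unfold_locales (rule h(1))
  interpret h': group_hom P P h' by unfold_locales (rule h'(1))
  have comm: "x\<^sub>P (m + 1) \<otimes>\<^bsub>P\<^esub> x\<^sub>P 1 = z"
  proof (rule P.right_mult_inj)
    have "commute (xr 1) (xr (m + 1))"
      using twisted_sat_xr by (intro s_t) (simp add: twisted_sat_def)
    then show "right_mult P (x\<^sub>P (m + 1) \<otimes>\<^bsub>P\<^esub> x\<^sub>P 1) = right_mult P z"
      using x\<^sub>P_carrier[OF idx(1)] x\<^sub>P_carrier[OF idx(3)] by (simp add: z(2) P.right_mult_mult flip: xr_def)
  qed (use x\<^sub>P_carrier[OF idx(1)] x\<^sub>P_carrier[OF idx(3)] z in auto)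
  \<comment> \<open>Both endomorphisms fix \<open>z\<close>, so the conjugations by \<open>z\<close>
    and by its inverse cancel at \<open>x m\<close>.\<close>
  have hz: "h z = z" "h' z = z"
    using h(2)[OF idx(1)] h(2)[OF idx(3)] h'(2)[OF idx(1)] h'(2)[OF idx(3)] comm m1 x\<^sub>P_carrier[OF idx(1)] x\<^sub>P_carrier[OF idx(3)]
    by (simp_all add: z_def tw\<^sub>P_def h.hom_mult h'.hom_mult)
  have cancel: "inv\<^bsub>P\<^esub> a \<otimes>\<^bsub>P\<^esub> (a \<otimes>\<^bsub>P\<^esub> (b \<otimes>\<^bsub>P\<^esub> (inv\<^bsub>P\<^esub> a \<otimes>\<^bsub>P\<^esub> a))) = b"
    "a \<otimes>\<^bsub>P\<^esub> (inv\<^bsub>P\<^esub> a \<otimes>\<^bsub>P\<^esub> (b \<otimes>\<^bsub>P\<^esub> (a \<otimes>\<^bsub>P\<^esub> inv\<^bsub>P\<^esub> a))) = b"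
    if "a \<in> carrier P" "b \<in> carrier P" for a b
    using that by (simp_all flip: P.m_assoc)
  have inv1: "h (h' (x\<^sub>P k)) = x\<^sub>P k" and inv2: "h' (h (x\<^sub>P k)) = x\<^sub>P k" if k: "k \<in> {1..n}" for k
  proof -
    have "h (h' (x\<^sub>P k)) = x\<^sub>P k \<and> h' (h (x\<^sub>P k)) = x\<^sub>P k"
    proof (cases "k = m \<and> k \<noteq> 1")
      case True
      then have km: "k = m" "h (x\<^sub>P m) = inv\<^bsub>P\<^esub> z \<otimes>\<^bsub>P\<^esub> (x\<^sub>P m \<otimes>\<^bsub>P\<^esub> z)" "h' (x\<^sub>P m) = z \<otimes>\<^bsub>P\<^esub> (x\<^sub>P m \<otimes>\<^bsub>P\<^esub> inv\<^bsub>P\<^esub> z)"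
        using h(2)[OF k] h'(2)[OF k] z(1) by (simp_all add: tw\<^sub>P_def)
      show ?thesis
        using km(2,3) z(1) x\<^sub>P_carrier[OF idx(2)] cancel[OF z(1) x\<^sub>P_carrier[OF idx(2)]] hz
        by (simp add: km(1) P.m_assoc)
    next
      case False
      then show ?thesis
        using h(2) h'(2) k idx by (cases "k = 1"; cases "k = m + 1"; simp add: tw\<^sub>P_def)
    qed
    then show "h (h' (x\<^sub>P k)) = x\<^sub>P k" "h' (h (x\<^sub>P k)) = x\<^sub>P k" by simp_all
  qed
  have id: "(\<lambda>y. y) \<in> hom P P" by (rule homI) auto
  have hh': "h (h' y) = y" if "y \<in> carrier P" for y
    using P_hom_eqI[OF P.is_group hom_compose[OF h'(1) h(1)] id _ that] inv1 by simp
  have h'h: "h' (h y) = y" if "y \<in> carrier P" for y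
    using P_hom_eqI[OF P.is_group hom_compose[OF h(1) h'(1)] id _ that] inv2 by simp
  define \<sigma> where "\<sigma> = Perm (\<lambda>y. if y \<in> carrier P then h y else y)"
  have "bij (\<lambda>y. if y \<in> carrier P then h y else y)"
    by (rule o_bij[of "\<lambda>y. if y \<in> carrier P then h' y else y"]) (auto simp: fun_eq_iff hh' h'h)
  then have app_\<sigma>: "app \<sigma> y = (if y \<in> carrier P then h y else y)" for y
    by (simp add: \<sigma>_def app_Perm)
  have "cj \<sigma> (right_mult P x) = right_mult P (h x)" if "x \<in> carrier P" for x
  proof -
    have "right_mult P x + \<sigma> = \<sigma> + right_mult P (h x)"
      using that by (intro perms_eqI) (simp add: app_\<sigma> P.app_right_mult)
    then show ?thesis by (simp add: cj_def add.assoc)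
  qed
  then have "cj \<sigma> (xr k) = tw (xr 1 + xr (m + 1)) xr k" if "k \<in> {1..n}" for k
    using x\<^sub>P_carrier[OF that] h(2)[OF that] right_mult_tw\<^sub>P[OF z(1)] z(2) by (simp add: xr_def)
  then show thesis by (rule that)
qed

end

lemma braid_chain_rev_index:
  assumes "braid_chain (n - 1) (\<lambda>s. z (n - s))" "2 \<le> i" "i < j" "j \<le> n"
  shows "if j = i + 1 then braid (z i) (z j) else commute (z i) (z j)"
proof (cases "j = i + 1")
  case True
  then have "Suc (n - j) = n - i" "n - (n - j) = j" "n - (n - i) = i" using assms by auto
  then show ?thesis using chain_braid[OF assms(1), of "n - j"] assms True by (simp add: braid_sym)
next
  case False
  have "n - (n - j) = j" "n - (n - i) = i" using assms by auto
  moreover have "commute (z (n - (n - i))) (z (n - (n - j)))"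
    by (rule chain_commute[OF assms(1)]) (use assms False in auto)
  ultimately show ?thesis using False by simp
qed

context carter_index
begin

text \<open>The diagram is covered by two paths on \<open>n - 1\<close> vertices, one omitting 1 and
  the other omitting \<open>m + 1\<close>. The only pair of vertices contained in neither path is 1
  and \<open>m + 1\<close>.\<close>

lemma artin_satI:
  fixes y :: "nat \<Rightarrow> 'g::group_add"
  assumes 1: "braid_chain (n - 1) (\<lambda>s. y (n - s))"
    and 2: "braid_chain (n - 1) (\<lambda>s. y (if n - s = m + 1 then 1 else n - s))"
    and st: "commute (y 1) (y (m + 1))"
  shows "artin_sat y"
proof -
  define z where "z k = y (if k = m + 1 then 1 else k)" for k
  have z: "z (m + 1) = y 1" "\<And>k. k \<noteq> m + 1 \<Longrightarrow> z k = y k" by (simp_all add: z_def)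
  note 3 = 2[folded z_def]
  have main: "if adj i j then braid (y i) (y j) else commute (y i) (y j)"
    if ij: "1 \<le> i" "i < j" "j \<le> n" for i j
  proof -
    consider "2 \<le> i" | "i = 1" "j = m + 1" | "i = 1" "j < m + 1" | "i = 1" "m + 1 < j"
      using ij by linarith
    then show ?thesis
    proof cases
      case 1
      then have "adj i j \<longleftrightarrow> j = i + 1" using ij by (auto simp: adj_def)
      then show ?thesis using braid_chain_rev_index[OF assms(1) 1 ij(2,3)] by simp
    next
      case 2
      then have "\<not> adj i j" using m1 by (auto simp: adj_def)
      then show ?thesis using st 2 by (simp only: if_False)
    next
      case 3
      then have "adj i j \<longleftrightarrow> m + 1 = j + 1" using ij by (auto simp: adj_def)
      then show ?thesis
        using braid_chain_rev_index[OF \<open>braid_chain (n - 1) (\<lambda>s. z (n - s))\<close>, of j "m + 1"] 3 ij z m2n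
        by (auto simp: braid_sym split: if_splits)
    next
      case 4
      then have "adj i j \<longleftrightarrow> j = m + 1 + 1" using ij m1 by (auto simp: adj_def)
      then show ?thesis
        using braid_chain_rev_index[OF \<open>braid_chain (n - 1) (\<lambda>s. z (n - s))\<close>, of "m + 1" j] 4 ij z m1
        by (auto split: if_splits)
    qed
  qed
  show ?thesis
    unfolding artin_sat_def
  proof (intro ballI impI)
    fix i j assume ij: "i \<in> {1..n}" "j \<in> {1..n}" "i \<noteq> j"
    have "adj i j \<longleftrightarrow> adj j i" unfolding adj_def by blast
    then show "if adj i j then braid (y i) (y j) else commute (y i) (y j)"
      using main[of i j] main[of j i] ij by (cases "i < j") (auto simp: braid_sym split: if_splits)
  qed
qed

end

section \<open>Maps out of the interval group, and generation by reflections\<close>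

context D_interval
begin

lemma hom_from_interval:
  fixes \<psi> :: "int \<times> int \<Rightarrow> 'b perms"
  assumes "dual_braid_rep n m l p q w \<psi> c"
  obtains h where "h \<in> hom I perm_group"
    "\<And>ps zs. factors (ps @ zs) \<Longrightarrow> h (gen (rsum ps)) = sum_list (map \<psi> ps)"
proof -
  interpret \<psi>: dual_braid_rep n m l p q w \<psi> c by (rule assms)
  have total: "sum_list (map \<psi> ps) = c" if "factors ps" for ps
    using \<psi>.factorization_sum[of ps] that by (simp add: factors_def)
  \<comment> \<open>Prefixes with the same product and length are completed to factorizations of
    \<open>w\<close> by the same remainder; both totals are \<open>c\<close>, and the remainder
    cancels. The value thus depends only on the element.\<close>
  have eq: "sum_list (map \<psi> ps) = sum_list (map \<psi> ps')"
    if "factors (ps @ zs)" "set ps' \<subseteq> refl_pairs n" "smat n (rsum ps) = smat n (rsum ps')" "length ps = length ps'" for ps zs ps'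
  proof -
    have "rsum ps = rsum ps'"
      using that by (intro smat_inj[of n] signed_sum_rfl) (auto simp: factors_def)
    then have "factors (ps' @ zs)" using that by (simp add: factors_def)
    from total[OF this] total[OF that(1)]
    have "sum_list (map \<psi> ps) + sum_list (map \<psi> zs) = sum_list (map \<psi> ps') + sum_list (map \<psi> zs)" by simp
    then show ?thesis by simp
  qed
  have eq': "sum_list (map \<psi> ps) = sum_list (map \<psi> ps')"
    if "factors (ps @ zs)" "factors (ps' @ zs')" "smat n (rsum ps) = smat n (rsum ps')" for ps zs ps' zs'
  proof (rule eq[OF that(1) _ that(3)])
    show "set ps' \<subseteq> refl_pairs n" using that(2) by (simp add: factors_def)
    show "length ps = length ps'" using factors_prefix(2)[OF that(1)] factors_prefix(2)[OF that(2)] that(3) by simp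
  qed
  define f where "f v = sum_list (map \<psi> (SOME ps. \<exists>zs. factors (ps @ zs) \<and> v = smat n (rsum ps)))" for v
  have f: "f (smat n (rsum ps)) = sum_list (map \<psi> ps)" if "factors (ps @ zs)" for ps zs
  proof -
    let ?Q = "\<lambda>qs. \<exists>zs. factors (qs @ zs) \<and> smat n (rsum ps) = smat n (rsum qs)"
    have "?Q ps" using that by blast
    then have "?Q (Eps ?Q)" by (rule someI)
    then obtain zs' where "factors (Eps ?Q @ zs')" "smat n (rsum ps) = smat n (rsum (Eps ?Q))" by blast
    from eq'[OF that this] show ?thesis by (simp only: f_def)
  qed
  let ?R = "{([(u, True), (v, True)], [(r, True)]) | u v r.
          u \<in> X \<and> v \<in> X \<and> r \<in> X \<and> u \<otimes>\<^bsub>W\<^esub> v = r \<and> len r = len u + len v}"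
  have rel: "word_eval perm_group f g = word_eval perm_group f g'"
    if gg': "(g, g') \<in> ?R" "g \<in> words X" "g' \<in> words X" for g g'
  proof -
    obtain u v r where uvr: "g = [(u, True), (v, True)]" "g' = [(r, True)]" "u \<in> X" "v \<in> X" "r \<in> X"
      "u \<otimes>\<^bsub>W\<^esub> v = r" "len r = len u + len v" using gg'(1) by blast
    obtain ps zs where ps: "factors (ps @ zs)" "u = smat n (rsum ps)" "length ps = len u"
      using interval_factors[OF uvr(3)] by blast
    obtain qs ys where qs: "factors (qs @ ys)" "v = smat n (rsum qs)" "length qs = len v"
      using interval_factors[OF uvr(4)] by blast
    obtain rs xs where rs: "factors (rs @ xs)" "r = smat n (rsum rs)" "length rs = len r"
      using interval_factors[OF uvr(5)] by blast
    have sets: "set ps \<subseteq> refl_pairs n" "set qs \<subseteq> refl_pairs n" using ps(1) qs(1) by (simp_all add: factors_def)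
    have "sum_list (map \<psi> rs) = sum_list (map \<psi> (ps @ qs))"
    proof (rule eq[OF rs(1)])
      show "smat n (rsum rs) = smat n (rsum (ps @ qs))"
        using uvr(6) smat_rsum_mult[OF sets] ps(2) qs(2) rs(2) by simp
    qed (use sets ps(3) qs(3) rs(3) uvr(7) in auto)
    then show ?thesis using f[OF ps(1)] f[OF qs(1)] f[OF rs(1)] by (simp add: uvr(1,2) ps(2) qs(2) rs(2))
  qed
  have fX: "f \<in> X \<rightarrow> carrier perm_group" by simp
  obtain h where h: "h \<in> hom (presented_group X ?R) perm_group"
    and ev: "\<And>u. u \<in> words X \<Longrightarrow> h (pres_class X ?R u) = word_eval perm_group f u"
    by (rule group.presented_group_universal[OF group_perm_group fX, of ?R], rule rel, assumption+) (rule that)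
  have "h (gen (rsum ps)) = sum_list (map \<psi> ps)" if "factors (ps @ zs)" for ps zs
    using ev[of "[(smat n (rsum ps), True)]"] factors_prefix(1)[OF that] f[OF that]
    by (simp add: gen_def pres_gen_def)
  moreover have "h \<in> hom I perm_group" using h by (simp add: interval_group_def)
  ultimately show thesis using that by blast
qed

lemma interval_generated:
  assumes K: "subgroup K I" and \<phi>: "\<And>x y. (x, y) \<in> refl_pairs n \<Longrightarrow> \<phi> (x, y) \<in> right_mult I ` K"
  shows "K = carrier I"
proof -
  interpret K: subgroup K I by (rule K)
  let ?R = "{([(u, True), (v, True)], [(r, True)]) | u v r.
          u \<in> X \<and> v \<in> X \<and> r \<in> X \<and> u \<otimes>\<^bsub>W\<^esub> v = r \<and> len r = len u + len v}"
  have sum: "sum_list (map \<phi> ps) \<in> right_mult I ` K" if "set ps \<subseteq> refl_pairs n" for ps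
    using that
  proof (induction ps)
    case Nil
    show ?case using K.one_closed by (auto intro!: image_eqI[of _ _ "\<one>\<^bsub>I\<^esub>"])
  next
    case (Cons x ps)
    obtain y where y: "\<phi> x = right_mult I y" "y \<in> K"
      using \<phi>[of "fst x" "snd x"] Cons.prems by auto
    obtain z where z: "sum_list (map \<phi> ps) = right_mult I z" "z \<in> K"
      using Cons by auto
    show ?case
      using y z K.subset by (intro image_eqI[of _ _ "y \<otimes>\<^bsub>I\<^esub> z"]) (auto simp: I.right_mult_mult)
  qed
  have gen: "pres_gen X ?R v \<in> K" if v: "v \<in> X" for v
  proof -
    obtain ps zs where ps: "factors (ps @ zs)" "v = smat n (rsum ps)"
      using interval_factors[OF v] by blast
    have "set ps \<subseteq> refl_pairs n" using ps(1) by (simp add: factors_def)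
    then obtain y where y: "right_mult I (gen (rsum ps)) = right_mult I y" "y \<in> K"
      using sum gen_sum[OF ps(1)] by auto
    have "gen (rsum ps) = y"
      using I.right_mult_inj[OF gen_carrier[OF ps(1)] _ y(1)] y(2) K.subset by blast
    then show ?thesis using y(2) ps(2) by (simp add: gen_def)
  qed
  have eval: "word_eval I (pres_gen X ?R) u \<in> K" if "u \<in> words X" for u
    using that
  proof (induction u)
    case (Cons a u)
    obtain x b where "a = (x, b)" by (cases a)
    then show ?case using Cons gen[of x] by (auto intro!: K.m_closed)
  qed simp
  have "y \<in> K" if y: "y \<in> carrier I" for y
  proof -
    obtain u where u: "u \<in> words X" "y = pres_class X ?R u"
      using y unfolding interval_group_def by (rule presented_group_carrierE)
    then show ?thesis using eval[OF u(1)] word_eval_pres_gen[OF u(1), of ?R] by (simp add: interval_group_def)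
  qed
  then show ?thesis using K.subset by blast
qed

end

locale carter_interval = D_interval n m l p q w + carter_index m n for n m l p q w
begin

lemma l_eq: "l = n - m" and l2: "2 \<le> l"
  using n_eq n4 mn by auto

lemma twisted_sat_\<phi>: "twisted_sat (\<lambda>k. \<phi> (vertex_pair k))"
proof -
  have cong: "braid_chain M f" if "braid_chain M g" "\<And>s. s < M \<Longrightarrow> f s = g s" for M and f g :: "nat \<Rightarrow> int mat word set perms"
    using that unfolding braid_chain_def by auto
  have sat: "artin_sat (\<lambda>k. \<phi> (vertex_pair k))"
  proof (rule artin_satI)
    show "braid_chain (n - 1) (\<lambda>s. \<phi> (vertex_pair (n - s)))"
      using braid_chain_of_dual_rels[OF dual_rels_\<phi>[of 0 0]] unfolding length_window
      by (rule cong) (auto intro!: \<phi>_rfl_cong rfl_window_0[symmetric])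
    show "braid_chain (n - 1) (\<lambda>s. \<phi> (vertex_pair (if n - s = m + 1 then 1 else n - s)))"
      using braid_chain_of_dual_rels[OF dual_rels_\<phi>[of 0 "- int l"]] unfolding length_window
      by (rule cong) (rule \<phi>_rfl_cong, rule rfl_window_1[symmetric], simp)
    show "commute (\<phi> (vertex_pair 1)) (\<phi> (vertex_pair (m + 1)))"
      unfolding vertex_pair_simps using commute_signs_\<phi>[of 0 0] by simp
  qed
  moreover have "commute (\<phi> (vertex_pair m)) (cj (- (\<phi> (vertex_pair 1) + \<phi> (vertex_pair (m + 1)))) (\<phi> (vertex_pair (m + 2))))" if m: "2 \<le> m"
  proof -
    let ?s = "\<phi> (p 0, - q 0)" and ?t = "\<phi> (p 0, q 0)"
    have pair_m: "vertex_pair m = (p 0, p 1)" "vertex_pair (m + 2) = (q (- 1), q 0)"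
      using vertex_pair_simps(2)[of m] vertex_pair_simps(4)[of "m + 2"] m by simp_all
    have len: "l - 1 < n" "l < n" "l + 1 < n" "l - 2 < n" using n_eq m l2 by auto
    have p01: "window 0 j ! l = p 0" "window 0 j ! (l + 1) = p 1" for j
      using nth_window_p[of 0 0 j] nth_window_p[of 1 0 j] m by simp_all
    have last: "window 0 j ! (l - 1) = q j" for j
      using nth_window_q[of "l - 1" 0 j] l2 by (simp add: of_nat_diff)
    have ql: "q (- int l) = - q 0" using q_neg[of 0] by simp
    have T1: "triangle \<phi> (q (- 1)) (q 0) (p 0)"
    proof -
      have "subseq (map ((!) (window 0 0)) [l - 2, l - 1, l]) (window 0 0)"
        using len l2 by (intro subseq_map_nth) auto
      moreover have "window 0 0 ! (l - 2) = q (- 1)"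
        using nth_window_q[of "l - 2" 0 0] l2 by (simp add: of_nat_diff)
      ultimately show ?thesis using p01 last by (intro triangle_\<phi>[of _ _ _ 0 0]) simp
    qed
    have T2: "triangle \<phi> (- q 0) (p 0) (p 1)"
    proof -
      have "subseq (map ((!) (window 0 (- int l))) [l - 1, l, l + 1]) (window 0 (- int l))"
        using len l2 by (intro subseq_map_nth) auto
      then show ?thesis using p01 last ql by (intro triangle_\<phi>[of _ _ _ 0 "- int l"]) simp
    qed
    \<comment> \<open>Conjugation turns \<open>(p 0, p 1)\<close> into \<open>(- q 0, p 1)\<close>
      by \<open>?s\<close>, and \<open>(q (- 1), q 0)\<close> into \<open>(q (- 1), p 0)\<close> by
      the inverse of \<open>?t\<close>. In \<open>window 0 (- 1)\<close>, which begins with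
      \<open>- q 0\<close> and in which \<open>q (- 1)\<close>, \<open>p 0\<close>,
      \<open>p 1\<close> are consecutive, these are nested chords.\<close>
    have N: "noncrossing \<phi> (- q 0) (q (- 1)) (p 0) (p 1)"
    proof -
      have "subseq (map ((!) (window 0 (- 1))) [0, l - 1, l, l + 1]) (window 0 (- 1))"
        using len l2 by (intro subseq_map_nth) auto
      moreover have "window 0 (- 1) ! 0 = - q 0"
        using nth_window_q[of 0 0 "- 1"] l2 ql by simp
      ultimately show ?thesis using p01 last by (intro noncrossing_\<phi>[of _ _ _ _ 0 "- 1"]) simp
    qed
    have "?t + \<phi> (q (- 1), q 0) = \<phi> (q (- 1), p 0) + ?t"
      using T1 \<phi>.pair_sym[of "q 0" "p 0"] by (simp add: triangle_def)
    then have c1: "cj (- ?t) (\<phi> (q (- 1), q 0)) = \<phi> (q (- 1), p 0)"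
      by (simp add: cj_def)
    have "\<phi> (p 0, p 1) + ?s = ?s + \<phi> (- q 0, p 1)"
      using T2 unfolding triangle_def \<phi>.pair_sym[of "- q 0" "p 0"] by (elim conjE)
    then have "- ?s + (\<phi> (p 0, p 1) + ?s) = - ?s + (?s + \<phi> (- q 0, p 1))" by (rule arg_cong)
    then have c2: "cj ?s (\<phi> (p 0, p 1)) = \<phi> (- q 0, p 1)"
      by (simp add: cj_def add.assoc)
    have "commute (cj ?s (\<phi> (p 0, p 1))) (cj (- ?t) (\<phi> (q (- 1), q 0)))"
      unfolding c1 c2 using N by (simp add: noncrossing_def)
    then have "commute (\<phi> (p 0, p 1)) (cj (- ?s) (cj (- ?t) (\<phi> (q (- 1), q 0))))"
      by (simp only: commute_cj_iff)
    then show ?thesis unfolding vertex_pair_simps pair_m cj_cj by (simp only: minus_add)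
  qed
  ultimately show ?thesis by (simp add: twisted_sat_def)
qed

lemma vertex_pair_refl_pairs: "k \<in> {1..n} \<Longrightarrow> vertex_pair k \<in> refl_pairs n"
proof (cases "k = 1")
  case False
  assume k: "k \<in> {1..n}"
  then have s: "Suc (n - k) < n" "n - (n - k) = k" using False by auto
  then have "subseq (map ((!) (window 0 0)) [n - k, Suc (n - k)]) (window 0 0)"
    by (intro subseq_map_nth) auto
  then have "(window 0 0 ! (n - k), window 0 0 ! Suc (n - k)) \<in> refl_pairs n"
    using letters_pair[OF letters_window'[of 0 0]] by simp
  then show ?thesis using vertex_pair_window[OF s(1)] unfolding s(2) by (auto simp: refl_pairs_def)
qed (use q_neg_refl_pairs vertex_pair_simps(1) in simp)

lemma vertex_pair_factors:
  assumes k: "k \<in> {1..n}"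
  shows "\<exists>zs. factors ([vertex_pair k] @ zs)"
proof -
  have *: ?thesis if "rfl (vertex_pair k) = rfl (window i j ! s, window i j ! Suc s)" "Suc s < n" for i j s
  proof -
    have "subseq (map ((!) (window i j)) [s, Suc s]) (window i j)"
      using that(2) by (intro subseq_map_nth) auto
    then obtain zs where "factors ([(window i j ! s, window i j ! Suc s)] @ zs)"
      using window_star[of "window i j ! s" "[window i j ! Suc s]" i j] by auto
    from factors_replace(1)[OF this, of "[vertex_pair k]"] show ?thesis
      using vertex_pair_refl_pairs[OF k] that(1) by auto
  qed
  show ?thesis
  proof (cases "k = 1")
    case True
    have "Suc (l - 1) < n" "n - (l - 1) = m + 1" using n_eq l_pos n4 m1 l2 by auto
    then show ?thesis using *[of 0 "- int l" "l - 1"] rfl_window_1[of "l - 1"] True by simp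
  next
    case False
    then have "Suc (n - k) < n" "n - (n - k) = k" using k by auto
    then show ?thesis using *[of 0 0 "n - k"] rfl_window_0[of "n - k"] by simp
  qed
qed

theorem interval_group_iso: "I \<cong> P"
proof -
  have carr: "(\<lambda>k. gen (rfl (vertex_pair k))) \<in> {1..n} \<rightarrow> carrier I"
  proof
    fix k assume "k \<in> {1..n}"
    then obtain zs where "factors ([vertex_pair k] @ zs)" using vertex_pair_factors by blast
    then show "gen (rfl (vertex_pair k)) \<in> carrier I" using gen_carrier[of "[vertex_pair k]" zs] by simp
  qed
  have "twisted_sat (\<lambda>k. right_mult I (gen (rfl (vertex_pair k))))"
    using twisted_sat_\<phi> by (simp add: \<phi>_def)
  from hom_from_P[OF I.is_group carr this] obtain \<Phi> where
    \<Phi>: "\<Phi> \<in> hom P I" "\<And>k. k \<in> {1..n} \<Longrightarrow> \<Phi> (x\<^sub>P k) = gen (rfl (vertex_pair k))" by blast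
  interpret \<Phi>: group_hom P I \<Phi> by unfold_locales (rule \<Phi>(1))
  have K: "subgroup (\<Phi> ` carrier P) I" by (rule \<Phi>.img_is_subgroup)
  interpret K: subgroup "\<Phi> ` carrier P" I by (rule K)
  have surj: "\<Phi> ` carrier P = carrier I"
  proof (rule interval_generated[OF K])
    fix x y assume xy: "(x, y) \<in> refl_pairs n"
    let ?K = "right_mult I ` \<Phi> ` carrier P"
    show "\<phi> (x, y) \<in> ?K"
    proof (rule \<phi>_generated[OF _ _ _ xy])
      show "\<phi> (vertex_pair k) \<in> ?K" if "k \<in> {1..n}" for k
        using \<Phi>(2)[OF that] x\<^sub>P_carrier[OF that] unfolding \<phi>_def by (metis image_eqI)
      show "u + v \<in> ?K" if uv: "u \<in> ?K" "v \<in> ?K" for u v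
      proof -
        obtain y z where "u = right_mult I y" "y \<in> \<Phi> ` carrier P" "v = right_mult I z" "z \<in> \<Phi> ` carrier P"
          using uv by blast
        then show ?thesis
          using K.subset by (intro image_eqI[of _ _ "y \<otimes>\<^bsub>I\<^esub> z"] K.m_closed) (auto simp: I.right_mult_mult)
      qed
      show "- u \<in> ?K" if u: "u \<in> ?K" for u
      proof -
        obtain y where "u = right_mult I y" "y \<in> \<Phi> ` carrier P" using u by blast
        then show ?thesis
          using K.subset by (intro image_eqI[of _ _ "inv\<^bsub>I\<^esub> y"] K.m_inv_closed) (auto simp: I.right_mult_inv)
      qed
    qed
  qed
  obtain \<sigma> where \<sigma>: "\<And>k. k \<in> {1..n} \<Longrightarrow> cj \<sigma> (xr k) = tw (xr 1 + xr (m + 1)) xr k"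
    by (rule twisting_permutation) blast
  interpret chain: twisted_chain m l "\<lambda>i. xr (m - i)" "\<lambda>j. xr (m + 2 + j)" \<sigma> "- \<sigma> + (xr 1 + xr (m + 1))" "xr (m + 1)"
    unfolding l_eq by (rule twisted_chain_of_sat[OF twisted_sat_xr \<sigma>])
  interpret L: letter_rep n m l p q w "\<lambda>i. xr (m - i)" "\<lambda>j. xr (m + 2 + j)" \<sigma> "- \<sigma> + (xr 1 + xr (m + 1))" "xr (m + 1)"
    by unfold_locales
  have \<psi>_vertex_pair: "L.\<psi> (vertex_pair k) = xr k" if k: "k \<in> {1..n}" for k
  proof -
    consider "k = 1" | "2 \<le> k" "k \<le> m" | "k = m + 1" | "m + 2 \<le> k" using k by fastforce
    then show ?thesis
    proof cases
      case 1
      have "cj \<sigma> (xr (m + 1)) = xr 1" using \<sigma>[OF idx(3)] m_pos by (simp add: tw_def)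
      then show ?thesis using L.\<psi>_s unfolding 1 vertex_pair_simps by simp
    next
      case 2
      then have "m - k < m - 1" "m - (m - k) = k" by auto
      then show ?thesis using L.\<psi>_a[of "m - k"] unfolding vertex_pair_simps(2)[OF 2] by simp
    next
      case 3
      then show ?thesis using L.\<psi>_t unfolding 3 vertex_pair_simps by simp
    next
      case 4
      then have "k - m - 2 < l - 1" "m + 2 + (k - m - 2) = k" using k n_eq by auto
      then show ?thesis using L.\<psi>_b[of "k - m - 2"] unfolding vertex_pair_simps(4)[OF 4] by (simp only:)
    qed
  qed
  obtain h where h: "h \<in> hom I perm_group"
    "\<And>ps zs. factors (ps @ zs) \<Longrightarrow> h (gen (rsum ps)) = sum_list (map L.\<psi> ps)"
    using hom_from_interval[OF L.dual_braid_rep_axioms] by blast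
  have h\<Phi>: "h (\<Phi> y) = right_mult P y" if y: "y \<in> carrier P" for y
  proof -
    have "(h \<circ> \<Phi>) y = right_mult P y"
    proof (rule P_hom_eqI[OF group_perm_group _ P.right_mult_hom _ y])
      show "h \<circ> \<Phi> \<in> hom P perm_group" using \<Phi>(1) h(1) by (rule hom_compose)
      fix k assume k: "k \<in> {1..n}"
      then obtain zs where zs: "factors ([vertex_pair k] @ zs)" using vertex_pair_factors by blast
      have "h (gen (rfl (vertex_pair k))) = L.\<psi> (vertex_pair k)" using h(2)[OF zs] by simp
      then show "(h \<circ> \<Phi>) (x\<^sub>P k) = right_mult P (x\<^sub>P k)"
        using \<Phi>(2)[OF k] \<psi>_vertex_pair[OF k] by (simp add: xr_def)
    qed
    then show ?thesis by simp
  qed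
  have "inj_on \<Phi> (carrier P)"
  proof (rule inj_onI)
    fix y z assume yz: "y \<in> carrier P" "z \<in> carrier P" "\<Phi> y = \<Phi> z"
    then show "y = z" using h\<Phi>[of y] h\<Phi>[of z] P.right_mult_inj[of y z] by simp
  qed
  then have "\<Phi> \<in> iso P I" using \<Phi>(1) surj by (simp add: iso_def bij_betw_def)
  then show ?thesis using P.iso_sym unfolding is_iso_def by blast
qed

end

section \<open>Passage to the quotient of the Artin group\<close>

context carter_index
begin

lemma pres_class_tc_word:
  assumes "2 \<le> m"
  shows "pres_class {1..n} (artin_relations {1..n} (carter_edges m n)) tc_word =
    twisted_cycle_commutator {1..n} (carter_edges m n) 1 m (m + 1) (m + 2)"
proof -
  define A where "A = artin_group {1..n} (carter_edges m n)"
  define x where "x = artin_gen {1..n} (carter_edges m n)"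
  interpret A: group A unfolding A_def artin_group_def by (rule group_presented_group)
  have x: "pres_gen {1..n} (artin_relations {1..n} (carter_edges m n)) = x"
    by (simp add: fun_eq_iff x_def artin_gen_def pres_gen_def)
  have carr: "x k \<in> carrier A" if "k \<in> {1..n}" for k
    unfolding x[symmetric] A_def artin_group_def using that by (rule pres_gen_carrier)
  note carr' = carr[OF idx(1)] carr[OF idx(2)] carr[OF idx(3)] carr[OF idx(4)]
  have "pres_class {1..n} (artin_relations {1..n} (carter_edges m n)) tc_word = word_eval A x tc_word"
    unfolding A_def artin_group_def x[symmetric] by (rule word_eval_pres_gen[OF tc_word_words[OF assms], symmetric])
  also have "\<dots> = commutator A (x 1)
      (inv\<^bsub>A\<^esub> x m \<otimes>\<^bsub>A\<^esub> x (m + 1) \<otimes>\<^bsub>A\<^esub> x (m + 2) \<otimes>\<^bsub>A\<^esub> inv\<^bsub>A\<^esub> x (m + 1) \<otimes>\<^bsub>A\<^esub> x m)"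
    using carr' by (simp add: tc_word_def commutator_def A.m_assoc A.inv_mult_group)
  finally show ?thesis by (simp add: twisted_cycle_commutator_def Let_def x_def A_def)
qed

lemma P_iso_quotient:
  assumes "2 \<le> m"
  shows "P \<cong> artin_group {1..n} (carter_edges m n) Mod
    normal_closure (artin_group {1..n} (carter_edges m n))
      {twisted_cycle_commutator {1..n} (carter_edges m n) 1 m (m + 1) (m + 2)}"
  using presented_group_add_relator[OF tc_word_words[OF assms], of "artin_relations {1..n} (carter_edges m n)"] assms
  by (simp only: P_def rels_def if_True pres_class_tc_word artin_group_def)

lemma P_Coxeter: "m = 1 \<Longrightarrow> P = artin_group {1..n} (carter_edges 1 n)"
  unfolding P_def rels_def artin_group_def by simp

end

lemma interval_group_iso_presented:
  assumes n4: "n \<ge> 4" and qc: "quasi_Coxeter (D_group n) (D_reflections n) n w"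
    and diagram: "has_carter_diagram n w m"
  shows "interval_group (D_group n) (D_reflections n) w \<cong> carter_index.P m n"
proof -
  have m: "1 \<le> m" "m \<le> n div 2" using diagram by (auto simp: has_carter_diagram_def)
  then have mn: "m < n" using n4 by auto
  obtain ts where ts: "reduced_decomposition (D_group n) (D_reflections n) w ts" "length ts = n"
      "generate (D_group n) (set ts) = carrier (D_group n)"
    and w_carrier: "w \<in> carrier (D_group n)" using qc by (auto simp: quasi_Coxeter_def)
  have "set ts \<subseteq> D_reflections n" and w_length: "refl_length (D_group n) (D_reflections n) w = n"
    using ts(1,2) unfolding reduced_decomposition_def by (elim conjE, simp)+
  note D_rep = D_group_generated[OF ts(3) this(1)]
  interpret D: group "D_group n" by (rule D_group_group) (rule D_rep)
  obtain g where g: "g \<in> carrier (D_group n)"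
    "w = g \<otimes>\<^bsub>D_group n\<^esub> carter_rep m n \<otimes>\<^bsub>D_group n\<^esub> inv\<^bsub>D_group n\<^esub> g"
    using diagram by (auto simp: has_carter_diagram_def)
  then obtain ps where ps: "set ps \<subseteq> refl_pairs n" "g = smat n (rsum ps)" using D_rep by blast
  have G: "signed n (rsum ps)" using ps(1) by (rule signed_sum_rfl)
  define v where "v = neg_cycle 0 m + neg_cycle m n"
  have v: "signed n v" using m mn by (auto simp: v_def intro!: signed_plus signed_neg_cycle)
  have "smat n (- rsum ps) \<in> carrier (D_group n)"
    unfolding D_rep using ps(1) by (intro exI[of _ "rev ps"]) (simp add: rsum_uminus)
  then have "inv\<^bsub>D_group n\<^esub> g = smat n (- rsum ps)"
    using g(1) G by (intro D.inv_equality) (simp_all add: ps(2) smat_mult signed_uminus smat_zero)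
  \<comment> \<open>Composition runs from left to right, so the conjugator in the form
    \<open>- h + v + h\<close> is \<open>h = - rsum ps\<close>.\<close>
  then have w: "w = smat n (- (- rsum ps) + v + (- rsum ps))"
    using g(2) G v m mn
    by (simp add: ps(2) carter_rep_eq smat_mult signed_plus signed_uminus v_def[symmetric] del: add_uminus_conv_diff)
  define p where "p = (\<lambda>i. app (- rsum ps) (cycle_letter m m i))"
  define q where "q = (\<lambda>j. - app (- rsum ps) (cycle_letter (n - m) n (j - 1)))"
  interpret two_cycles n m "n - m" p q "- (- rsum ps) + v + (- rsum ps)"
    unfolding p_def q_def v_def by (rule two_cycles_carter[OF m(1) mn signed_uminus[OF G]])
  interpret carter_interval n m "n - m" p q "- (- rsum ps) + v + (- rsum ps)"
    by unfold_locales (use D_rep w_length w_carrier n4 m in \<open>simp_all only: w[symmetric]\<close>)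
  show ?thesis unfolding w by (rule interval_group_iso)
qed

theorem theoremA:
  fixes n m :: nat and w :: "int mat"
  assumes "n \<ge> 4"
    and "quasi_Coxeter (D_group n) (D_reflections n) n w"
    and "has_carter_diagram n w m"
  shows "(m \<ge> 2 \<longrightarrow>
            interval_group (D_group n) (D_reflections n) w \<cong>
              artin_group {1..n} (carter_edges m n) Mod
                normal_closure (artin_group {1..n} (carter_edges m n))
                  {twisted_cycle_commutator {1..n} (carter_edges m n) 1 m (m + 1) (m + 2)}) \<and>
         (m = 1 \<longrightarrow>
            interval_group (D_group n) (D_reflections n) w \<cong>
              artin_group {1..n} (carter_edges 1 n))"
proof -
  interpret carter_index m n
    using assms(1,3) by unfold_locales (auto simp: has_carter_diagram_def)
  note iso = interval_group_iso_presented[OF assms]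
  show ?thesis
  proof (intro conjI impI)
    assume "2 \<le> m"
    from iso_trans[OF iso P_iso_quotient[OF this]]
    show "interval_group (D_group n) (D_reflections n) w \<cong>
        artin_group {1..n} (carter_edges m n) Mod
          normal_closure (artin_group {1..n} (carter_edges m n))
            {twisted_cycle_commutator {1..n} (carter_edges m n) 1 m (m + 1) (m + 2)}" .
  next
    assume "m = 1"
    then show "interval_group (D_group n) (D_reflections n) w \<cong> artin_group {1..n} (carter_edges 1 n)"
      using iso P_Coxeter by simp
  qed
qed

end
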